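(* Let $K$ be a field, let $\Delta$ be a simplicial complex on $X=\{x_1,\ldots,x_n\}$ and let $\alpha=(s_1,\ldots,s_n)\in\mathbb{N}^n$. Then $$\mathrm{reg}(I_{\Delta^{\alpha}})\leq \mathrm{reg}(I_{\Delta})+r,\qquad\text{where } r=|\{i: s_i>1\}|.$$
   Context: $\mathbb{N}$ denotes the positive integers. For $\alpha=(s_1,\ldots,s_n)\in\mathbb{N}^n$ put $X^\alpha=\{x_{11},\ldots,x_{1s_1},\ldots,x_{n1},\ldots,x_{ns_n}\}$, $S=K[X]$ and $S^\alpha=K[X^\alpha]$. For $F=\{x_{i_1},\ldots,x_{i_r}\}\in\Delta$ (distinct vertices), $\langle F\rangle^\alpha$ is the simplicial complex on $\{x_{i_lt_l}: 1\le l\le r,\ 1\le t_l\le s_{i_l}\}$ whose facets are the sets $\{x_{i_1j_1},\ldots,x_{i_rj_r}\}$ with $1\le j_m\le s_{i_m}$ for all $m$. The expansion of $\Delta$ with respect to $\alpha$ is $\Delta^\alpha=\bigcup_{F\in\Delta}\langle F\rangle^\alpha$, a simplicial complex on $X^\alpha$. $I_\Delta\subseteq S$ and $I_{\Delta^\alpha}\subseteq S^\alpha$ are the Stanley-Reisner ideals (generated by the squarefree monomials $\prod_{x\in G}x$ over non-faces $G$). For a $\mathbb{Z}$-graded module $M$ over a polynomial ring, the Castelnuovo-Mumford regularity is $\mathrm{reg}(M)=\max\{j-i:\beta_{i,j}(M)\ne 0\}$, where $\beta_{i,j}(M)$ are the graded Betti numbers. The relation $\mathrm{reg}(I)=\mathrm{reg}(S/I)+1$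 is used as a convention also when $I=0$, so $\mathrm{reg}(0)=1$ for the zero ideal. *)

theory Defs
  imports Complex_Main "HOL-Library.Poly_Mapping"
begin

section \<open>Polynomials\<close>

text \<open>
  A monomial is its exponent vector; the monomial \<open>1\<close> is the exponent vector \<open>0\<close>.
  The type admits all of \<open>'v\<close> as variables; the ring $K[V]$ is cut out by \<open>poly_ring V\<close>.
\<close>
type_synonym ('v, 'k) mpoly = "('v \<Rightarrow>\<^sub>0 nat) \<Rightarrow>\<^sub>0 'k"

definition poly_ring :: "'v set \<Rightarrow> ('v, 'k::field) mpoly set" where
  "poly_ring V = {p. \<forall>m\<in>Poly_Mapping.keys p. Poly_Mapping.keys m \<subseteq> V}"

definition var :: "'v \<Rightarrow> ('v, 'k::field) mpoly" where
  "var x = Poly_Mapping.single (Poly_Mapping.single x 1) 1"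

text \<open>Zero is homogeneous of every degree, and is the only polynomial of negative degree.\<close>
definition homogeneous :: "int \<Rightarrow> ('v, 'k::field) mpoly \<Rightarrow> bool" where
  "homogeneous d p \<longleftrightarrow>
     (\<forall>m\<in>Poly_Mapping.keys p. int (\<Sum>v\<in>Poly_Mapping.keys m. Poly_Mapping.lookup m v) = d)"

definition gen_ideal :: "'v set \<Rightarrow> ('v, 'k::field) mpoly set \<Rightarrow> ('v, 'k) mpoly set" where
  "gen_ideal V B = {\<Sum>b\<in>A. q b * b | A q. finite A \<and> A \<subseteq> B \<and> (\<forall>b\<in>A. q b \<in> poly_ring V)}"


section \<open>Graded Betti numbers and regularity\<close>

text \<open>
  A \<open>\<int>\<close>-graded module with scalars \<open>'s\<close> (here, polynomials): a carrier inside an ambient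
  abelian group, the scalar action, and the homogeneous component of each degree.
\<close>
record ('s, 'm) graded_module =
  mcarrier :: "'m set"
  mscale :: "'s \<Rightarrow> 'm \<Rightarrow> 'm"
  mcomp :: "int \<Rightarrow> 'm set"

text \<open>The free module $K[V]^r$; vectors are padded with zeros so that equality is extensional.\<close>
definition free_module :: "'v set \<Rightarrow> nat \<Rightarrow> (nat \<Rightarrow> ('v, 'k::field) mpoly) set" where
  "free_module V r = {f. (\<forall>k<r. f k \<in> poly_ring V) \<and> (\<forall>k\<ge>r. f k = 0)}"

text \<open>Multiplication by the \<open>r\<close> by \<open>s\<close> matrix with entry \<open>A k l\<close> in row \<open>k\<close> and column \<open>l\<close>.\<close>
definition mat_map ::
  "nat \<Rightarrow> nat \<Rightarrow> (nat \<Rightarrow> nat \<Rightarrow> ('v, 'k::field) mpoly) \<Rightarrow>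
   (nat \<Rightarrow> ('v, 'k) mpoly) \<Rightarrow> nat \<Rightarrow> ('v, 'k) mpoly" where
  "mat_map r s A f = (\<lambda>k. if k < r then \<Sum>l<s. A k l * f l else 0)"

text \<open>The map $K[V]^r \to M$ sending the \<open>k\<close>-th basis vector to \<open>g k\<close>.\<close>
definition gens_map ::
  "(('v, 'k::field) mpoly, 'm::ab_group_add) graded_module \<Rightarrow> nat \<Rightarrow> (nat \<Rightarrow> 'm) \<Rightarrow>
   (nat \<Rightarrow> ('v, 'k) mpoly) \<Rightarrow> 'm" where
  "gens_map M r g f = (\<Sum>k<r. mscale M (f k) (g k))"

text \<open>
  \<open>minimal_graded_resolution V M b d g A\<close>: with $S = K[V]$ and
  $F_i = \bigoplus_{k < b_i} S(-d_{i,k})$,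
  \[ \cdots \to F_2 \stackrel{A_1}{\to} F_1 \stackrel{A_0}{\to} F_0 \stackrel{g}{\to} M \to 0 \]
  is a minimal graded free resolution of \<open>M\<close>. The maps have degree zero: \<open>g\<close> sends basis vectors
  to elements of the right degree, and the matrix entries are homogeneous of the degree dictated
  by the shifts. Minimality says that the matrix entries lie in the maximal ideal $(V)$,
  i.e. have zero constant term.
\<close>
definition minimal_graded_resolution ::
  "'v set \<Rightarrow> (('v, 'k::field) mpoly, 'm::ab_group_add) graded_module \<Rightarrow>
   (nat \<Rightarrow> nat) \<Rightarrow> (nat \<Rightarrow> nat \<Rightarrow> int) \<Rightarrow> (nat \<Rightarrow> 'm) \<Rightarrow>
   (nat \<Rightarrow> nat \<Rightarrow> nat \<Rightarrow> ('v, 'k) mpoly) \<Rightarrow> bool" where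
  "minimal_graded_resolution V M b d g A \<longleftrightarrow>
     (\<forall>k<b 0. g k \<in> mcomp M (d 0 k)) \<and>
     (\<forall>i. \<forall>k<b i. \<forall>l<b (Suc i).
        A i k l \<in> poly_ring V \<and> homogeneous (d (Suc i) l - d i k) (A i k l) \<and>
        Poly_Mapping.lookup (A i k l) 0 = 0) \<and>
     gens_map M (b 0) g ` free_module V (b 0) = mcarrier M \<and>
     {f \<in> free_module V (b 0). gens_map M (b 0) g f = 0} =
       mat_map (b 0) (b 1) (A 0) ` free_module V (b 1) \<and>
     (\<forall>i. {f \<in> free_module V (b (Suc i)). mat_map (b i) (b (Suc i)) (A i) f = (\<lambda>_. 0)} =
       mat_map (b (Suc i)) (b (Suc (Suc i))) (A (Suc i)) ` free_module V (b (Suc (Suc i))))"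

text \<open>
  $\beta_{i,j}(M)$ is the number of summands $S(-j)$ of $F_i$ in a minimal graded free
  resolution. For finite \<open>V\<close> and finitely generated \<open>M\<close> such a resolution exists and is unique
  up to isomorphism, so the choice is immaterial.
\<close>
definition graded_betti ::
  "'v set \<Rightarrow> (('v, 'k::field) mpoly, 'm::ab_group_add) graded_module \<Rightarrow> nat \<Rightarrow> int \<Rightarrow> nat" where
  "graded_betti V M i j =
     (SOME c. \<exists>b d g A. minimal_graded_resolution V M b d g A \<and> c = card {k. k < b i \<and> d i k = j})"

definition regularity :: "'v set \<Rightarrow> (('v, 'k::field) mpoly, 'm::ab_group_add) graded_module \<Rightarrow> int" where
  "regularity V M = Max {j - int i | i j. graded_betti V M i j \<noteq> 0}"

definition ideal_module :: "('v, 'k::field) mpoly set \<Rightarrow> (('v, 'k) mpoly, ('v, 'k) mpoly) graded_module" where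
  "ideal_module I = \<lparr>mcarrier = I, mscale = (*), mcomp = (\<lambda>j. {p \<in> I. homogeneous j p})\<rparr>"

text \<open>
  The zero ideal has no nonzero Betti numbers; its regularity is set to 1 so that
  $\mathrm{reg}(I) = \mathrm{reg}(S/I) + 1$ also holds for it.
\<close>
definition reg_ideal :: "'v set \<Rightarrow> ('v, 'k::field) mpoly set \<Rightarrow> int" where
  "reg_ideal V I = (if I = {0} then 1 else regularity V (ideal_module I))"


section \<open>Simplicial complexes and expansions\<close>

text \<open>Not every element of \<open>X\<close> has to be a vertex.\<close>
definition simplicial_complex_on :: "'v set \<Rightarrow> 'v set set \<Rightarrow> bool" where
  "simplicial_complex_on X \<Delta> \<longleftrightarrow>
     \<Delta> \<subseteq> Pow X \<and> {} \<in> \<Delta> \<and> (\<forall>F\<in>\<Delta>. \<forall>G. G \<subseteq> F \<longrightarrow> G \<in> \<Delta>)"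

definition stanley_reisner_ideal :: "'v set \<Rightarrow> 'v set set \<Rightarrow> ('v, 'k::field) mpoly set" where
  "stanley_reisner_ideal X \<Delta> = gen_ideal X ((\<lambda>G. \<Prod>x\<in>G. var x) ` {G. G \<subseteq> X \<and> G \<notin> \<Delta>})"

text \<open>The variable $x_{ij}$ is the pair \<open>(i, j)\<close>.\<close>
definition expansion_vertices :: "('v \<Rightarrow> nat) \<Rightarrow> 'v set \<Rightarrow> ('v \<times> nat) set" where
  "expansion_vertices \<alpha> X = (SIGMA i:X. {1..\<alpha> i})"

definition expansion_facets :: "('v \<Rightarrow> nat) \<Rightarrow> 'v set \<Rightarrow> ('v \<times> nat) set set" where
  "expansion_facets \<alpha> F = {(\<lambda>i. (i, j i)) ` F | j. \<forall>i\<in>F. j i \<in> {1..\<alpha> i}}"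

definition simplex_expansion :: "('v \<Rightarrow> nat) \<Rightarrow> 'v set \<Rightarrow> ('v \<times> nat) set set" where
  "simplex_expansion \<alpha> F = {G. \<exists>H\<in>expansion_facets \<alpha> F. G \<subseteq> H}"

definition expansion :: "('v \<Rightarrow> nat) \<Rightarrow> 'v set set \<Rightarrow> ('v \<times> nat) set set" where
  "expansion \<alpha> \<Delta> = (\<Union>F\<in>\<Delta>. simplex_expansion \<alpha> F)"

end

theory Submission
  imports Defs "HOL-Library.Function_Algebras" "HOL-Library.Product_Lexorder"
begin

text \<open>
  Regularity is read off from Koszul homology. The group $\mathrm{Tor}_i(M,K)_j$ is the \<open>i\<close>-th
  homology of the Koszul complex of \<open>M\<close> in degree \<open>j\<close>, and only its vanishing matters here. Since the
  Koszul complex of a free module is exact in positive homological degree, passing from \<open>M\<close> to the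
  syzygies of a minimal cover lowers \<open>i\<close> by one (\<open>tor_vanishes_Suc\<close>), while in homological degree 0
  the vanishing says that no minimal generator has degree \<open>j\<close> (\<open>tor_vanishes_0\<close>). Hence every minimal
  resolution has a summand $S(-j)$ in position \<open>i\<close> exactly when the Koszul homology is nonzero
  (\<open>resolution_tor\<close>). The same vanishing, for large \<open>j\<close>, shows that all syzygy modules are finitely
  generated, so that a minimal resolution exists (\<open>resolution_exists\<close>).

  For a squarefree monomial ideal the Koszul complex splits into multidegrees. Let \<open>U\<close> be the set of
  supports of the monomials in the ideal, for a Stanley-Reisner ideal the set of nonfaces. The
  strand of multidegree \<open>W\<close> is the chain complex of the simplicial complex
  $N(U,W)=\{F\subseteq W : W\setminus F\in U\}$, the Alexander dual of the restriction of $\Delta$ to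
  \<open>W\<close>; the strands of non-squarefree multidegrees are cones. So the regularity is the maximum of
  $|W|-i$ over all \<open>W\<close> and \<open>i\<close> such that $N(U,W)$ has homology on faces of cardinality \<open>i\<close>
  (\<open>graded_betti_monomial_ideal\<close>); this is a form of Hochster's formula.

  What remains is combinatorics (\<open>acyclic_expanded\<close>). Let \<open>W\<close> be a set of vertices of the expansion
  and \<open>y\<close> one of at least two copies in \<open>W\<close> of the same vertex \<open>x\<close>. The link of \<open>y\<close> in
  the complex of \<open>W\<close> is the complex of $W\setminus\{y\}$, with the same difference $|W|-i$. The
  deletion of \<open>y\<close> is, up to homology, a suspension as long as there is another copy of \<open>x\<close>, because
  two copies of \<open>x\<close> never lie in a common face. Removing the other copies in this way also preserves
  the difference. Once \<open>y\<close> is the only copy left, a last exact sequence costs one unit. So every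
  vertex with several copies raises the bound by at most 1, which gives the summand \<open>r\<close>.
\<close>


section \<open>Koszul complexes\<close>

text \<open>
  The sign $(-1)^{|\{u\in F : u<v\}|}$ of exterior multiplication by \<open>v\<close>, as an operator, so that it
  makes sense with coefficients in any abelian group.
\<close>
definition osign :: "'v::linorder \<Rightarrow> 'v set \<Rightarrow> 'm::ab_group_add \<Rightarrow> 'm" where
  "osign v F x = (if even (card {u \<in> F. u < v}) then x else - x)"

lemma osign_0 [simp]: "osign v F 0 = 0"
  by (simp add: osign_def)

lemma osign_add: "osign v F (x + y) = osign v F x + osign v F y"
  by (simp add: osign_def)

lemma osign_uminus: "osign v F (- x) = - osign v F x"
  by (simp add: osign_def)

lemma osign_sum: "osign v F (sum f A) = (\<Sum>a\<in>A. osign v F (f a))"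
  by (simp add: osign_def sum_negf)

lemma osign_osign [simp]: "osign v F (osign v F x) = x"
  by (simp add: osign_def)

lemma osign_eq_0_iff [simp]: "osign v F x = 0 \<longleftrightarrow> x = 0"
  by (simp add: osign_def)

text \<open>
  Of two distinct vertices, inserting the larger one leaves the sign of the smaller one alone, and
  inserting the smaller one flips the sign of the larger one. This is what makes $\partial\partial=0$.
\<close>
lemma osign_swap:
  assumes "finite F" "u \<noteq> v" "u \<notin> F" "v \<notin> F"
  shows "osign u F (osign v (insert u F) x) = - osign v F (osign u (insert v F) x)"
proof -
  have *: "osign u F (osign v (insert u F) x) = - osign v F (osign u (insert v F) x)"
    if "u < v" "u \<notin> F" for u v x
  proof -
    have "{w \<in> insert u F. w < v} = insert u {w \<in> F. w < v}"
      and "{w \<in> insert v F. w < u} = {w \<in> F. w < u}"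
      using that by auto
    then show ?thesis
      using that assms(1) by (simp add: osign_def)
  qed
  show ?thesis
  proof (cases "u < v")
    case True
    then show ?thesis using * assms by blast
  next
    case False
    then have "v < u" using assms(2) by simp
    from *[OF this assms(4), of x] show ?thesis by simp
  qed
qed

text \<open>
  The Koszul differential $e_F\otimes m\mapsto\sum_{v\in F}\pm e_{F\setminus v}\otimes vm$, written in
  terms of the coefficient functions. With the trivial action $vm=m$ it is the boundary of augmented
  simplicial chains, so both kinds of complexes can be treated at once.
\<close>
definition koszul_bd ::
  "'v::linorder set \<Rightarrow> ('v \<Rightarrow> 'm \<Rightarrow> 'm) \<Rightarrow> ('v set \<Rightarrow> 'm::ab_group_add) \<Rightarrow> 'v set \<Rightarrow> 'm" where
  "koszul_bd V act c F =
     (if F \<subseteq> V then \<Sum>v\<in>V - F. osign v F (act v (c (insert v F))) else 0)"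

text \<open>
  The set of coefficients that are allowed at \<open>F\<close> may depend on \<open>F\<close>. This covers the degree \<open>j\<close> strand
  of a Koszul complex (elements of degree $j-|F|$ at \<open>F\<close>) as well as the chains of a simplicial complex (only
  0 at nonfaces). Chains are indexed by the cardinality of \<open>F\<close>, so the empty face sits in
  degree 0.
\<close>
definition chains :: "'v set \<Rightarrow> ('v set \<Rightarrow> 'm::ab_group_add set) \<Rightarrow> nat \<Rightarrow> ('v set \<Rightarrow> 'm) set" where
  "chains V C i = {c. \<forall>F. c F \<in> C F \<and> (c F \<noteq> 0 \<longrightarrow> F \<subseteq> V \<and> card F = i)}"

definition exact_at ::
  "'v::linorder set \<Rightarrow> ('v \<Rightarrow> 'm \<Rightarrow> 'm) \<Rightarrow> ('v set \<Rightarrow> 'm::ab_group_add set) \<Rightarrow> nat \<Rightarrow> bool" where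
  "exact_at V act C i \<longleftrightarrow>
     (\<forall>c\<in>chains V C i. koszul_bd V act c = (\<lambda>_. 0) \<longrightarrow>
        (\<exists>w\<in>chains V C (Suc i). koszul_bd V act w = c))"

lemma chainsI:
  assumes "\<And>F. c F \<in> C F" "\<And>F. c F \<noteq> 0 \<Longrightarrow> F \<subseteq> V \<and> card F = i"
  shows "c \<in> chains V C i"
  using assms by (auto simp: chains_def)

lemma chains_mem: "c \<in> chains V C i \<Longrightarrow> c F \<in> C F"
  by (simp add: chains_def)

lemma chains_supp: "c \<in> chains V C i \<Longrightarrow> c F \<noteq> 0 \<Longrightarrow> F \<subseteq> V \<and> card F = i"
  by (simp add: chains_def)

locale coeff_system =
  fixes V :: "'v::linorder set" and act :: "'v \<Rightarrow> 'm::ab_group_add \<Rightarrow> 'm" and C :: "'v set \<Rightarrow> 'm set"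
  assumes finV: "finite V"
    and act_add: "act v (x + y) = act v x + act v y"
    and act_comm: "act u (act v x) = act v (act u x)"
    and C_0: "0 \<in> C F"
    and C_add: "x \<in> C F \<Longrightarrow> y \<in> C F \<Longrightarrow> x + y \<in> C F"
    and C_uminus: "x \<in> C F \<Longrightarrow> - x \<in> C F"
    and C_act: "F \<subseteq> V \<Longrightarrow> v \<in> V \<Longrightarrow> v \<notin> F \<Longrightarrow> x \<in> C (insert v F) \<Longrightarrow> act v x \<in> C F"
begin

lemma act_0: "act v 0 = 0"
  using act_add[of v 0 0] by simp

lemma act_uminus: "act v (- x) = - act v x"
  using act_add[of v x "- x"] by (simp add: act_0 eq_neg_iff_add_eq_0 add.commute)

lemma act_sum: "act v (sum f A) = (\<Sum>a\<in>A. act v (f a))"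
  by (induction A rule: infinite_finite_induct) (auto simp: act_add act_0)

lemma act_osign: "act v (osign u F x) = osign u F (act v x)"
  by (simp add: osign_def act_uminus)

lemma C_osign: "x \<in> C F \<Longrightarrow> osign v G x \<in> C F"
  by (simp add: osign_def C_uminus)

lemma C_sum: "(\<And>a. a \<in> A \<Longrightarrow> f a \<in> C F) \<Longrightarrow> sum f A \<in> C F"
  by (induction A rule: infinite_finite_induct) (auto simp: C_0 C_add)

lemma C_diff: "x \<in> C F \<Longrightarrow> y \<in> C F \<Longrightarrow> x - y \<in> C F"
  using C_add[of x F "- y"] C_uminus[of y F] by simp

lemma bd_add: "koszul_bd V act (\<lambda>F. c F + e F) = (\<lambda>F. koszul_bd V act c F + koszul_bd V act e F)"
  by (auto simp: koszul_bd_def fun_eq_iff act_add osign_add sum.distrib)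

lemma bd_uminus: "koszul_bd V act (\<lambda>F. - c F) = (\<lambda>F. - koszul_bd V act c F)"
  by (auto simp: koszul_bd_def fun_eq_iff act_uminus osign_uminus sum_negf)

lemma bd_diff: "koszul_bd V act (\<lambda>F. c F - e F) = (\<lambda>F. koszul_bd V act c F - koszul_bd V act e F)"
  using bd_add[of c "\<lambda>F. - e F"] by (simp add: bd_uminus)

lemma bd_zero [simp]: "koszul_bd V act (\<lambda>_. 0) = (\<lambda>_. 0)"
  by (simp add: koszul_bd_def fun_eq_iff act_0)

lemma chains_diff: "c \<in> chains V C i \<Longrightarrow> e \<in> chains V C i \<Longrightarrow> (\<lambda>F. c F - e F) \<in> chains V C i"
  unfolding chains_def using C_diff by force

lemma bd_chain:
  assumes c: "c \<in> chains V C (Suc i)"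
  shows "koszul_bd V act c \<in> chains V C i"
proof (rule chainsI)
  fix F
  show "koszul_bd V act c F \<in> C F"
    unfolding koszul_bd_def using chains_mem[OF c] by (auto intro!: C_sum C_osign C_act C_0)
  assume nz: "koszul_bd V act c F \<noteq> 0"
  then have F: "F \<subseteq> V" by (auto simp: koszul_bd_def split: if_splits)
  have "\<exists>v\<in>V - F. c (insert v F) \<noteq> 0"
  proof (rule ccontr)
    assume "\<not> ?thesis"
    then have "koszul_bd V act c F = 0" unfolding koszul_bd_def by (simp add: sum.neutral act_0)
    with nz show False ..
  qed
  then obtain v where v: "v \<in> V - F" "c (insert v F) \<noteq> 0" by blast
  with chains_supp[OF c] have "card (insert v F) = Suc i" by blast
  then have "card F = i"
    using v F finV by (metis Diff_iff card_insert_disjoint finite_subset nat.inject)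
  with F show "F \<subseteq> V \<and> card F = i" by simp
qed

text \<open>
  The terms of the double sum belong to ordered pairs of distinct vertices, and exchanging
  the two vertices changes the sign. Pairing $u<v$ with $v<u$ avoids any division by 2.
\<close>
lemma bd_bd [simp]: "koszul_bd V act (koszul_bd V act c) = (\<lambda>_. 0)"
proof
  fix F
  show "koszul_bd V act (koszul_bd V act c) F = 0"
  proof (cases "F \<subseteq> V")
    case True
    have finF: "finite F" using True finV finite_subset by blast
    define g where "g u v = osign u F (osign v (insert u F) (act u (act v (c (insert v (insert u F))))))" for u v
    have g: "g u v = - g v u" if "u \<in> V - F" "v \<in> V - F" "u \<noteq> v" for u v
      using that osign_swap[OF finF, of u v "act u (act v (c (insert v (insert u F))))"]
      by (auto simp: g_def act_comm[of u] insert_commute)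
    let ?P = "{(u, v). u \<in> V - F \<and> v \<in> V - F \<and> u < v}"
    let ?Q = "{(u, v). u \<in> V - F \<and> v \<in> V - F \<and> v < u}"
    have finP: "finite ?P" "finite ?Q"
      using finV by (auto intro: finite_subset[of _ "V \<times> V"])
    have "koszul_bd V act (koszul_bd V act c) F = (\<Sum>u\<in>V - F. \<Sum>v\<in>V - insert u F. g u v)"
      using True by (auto simp: koszul_bd_def g_def act_sum act_osign osign_sum intro!: sum.cong)
    also have "\<dots> = (\<Sum>(u, v)\<in>(SIGMA u:V - F. V - insert u F). g u v)"
      using finV by (subst sum.Sigma) auto
    also have "(SIGMA u:V - F. V - insert u F) = ?P \<union> ?Q" by auto
    also have "(\<Sum>(u, v)\<in>?P \<union> ?Q. g u v) = (\<Sum>(u, v)\<in>?P. g u v) + (\<Sum>(u, v)\<in>?Q. g u v)"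
      using finP by (subst sum.union_disjoint) auto
    also have "(\<Sum>(u, v)\<in>?Q. g u v) = (\<Sum>(u, v)\<in>?P. g v u)"
      by (rule sum.reindex_bij_witness[where i = prod.swap and j = prod.swap]) auto
    also have "\<dots> = (\<Sum>(u, v)\<in>?P. - g u v)"
      using g by (intro sum.cong) auto
    finally show ?thesis by (simp add: case_prod_unfold sum_negf)
  qed (simp add: koszul_bd_def)
qed

end

lemma exact_atD:
  assumes "exact_at V act C i" "c \<in> chains V C i" "koszul_bd V act c = (\<lambda>_. 0)"
  obtains w where "w \<in> chains V C (Suc i)" "koszul_bd V act w = c"
  using assms unfolding exact_at_def by blast

section \<open>Vanishing in the long exact sequence\<close>

text \<open>
  A short exact sequence of coefficients $0\to Z\to F\to M\to 0$. The lemmas of this locale are the parts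
  of the long exact homology sequence that concern vanishing.
\<close>
locale coeff_sequence =
  F: coeff_system V actF CF + M: coeff_system V actM CM
  for V :: "'v::linorder set" and actF :: "'v \<Rightarrow> 'f::ab_group_add \<Rightarrow> 'f" and CF
    and actM :: "'v \<Rightarrow> 'm::ab_group_add \<Rightarrow> 'm" and CM +
  fixes \<phi> :: "'f \<Rightarrow> 'm" and CZ
  assumes phi_add: "\<phi> (x + y) = \<phi> x + \<phi> y"
    and phi_act: "\<phi> (actF v x) = actM v (\<phi> x)"
    and phi_onto: "\<phi> ` CF A = CM A"
    and CZ_eq: "CZ A = {x \<in> CF A. \<phi> x = 0}"
begin

lemma phi_0: "\<phi> 0 = 0"
  using phi_add[of 0 0] by simp

lemma phi_uminus: "\<phi> (- x) = - \<phi> x"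
  using phi_add[of x "- x"] by (simp add: phi_0 eq_neg_iff_add_eq_0 add.commute)

lemma phi_diff: "\<phi> (x - y) = \<phi> x - \<phi> y"
  using phi_add[of x "- y"] phi_uminus[of y] by simp

lemma phi_sum: "\<phi> (sum f A) = (\<Sum>a\<in>A. \<phi> (f a))"
  by (induction A rule: infinite_finite_induct) (auto simp: phi_add phi_0)

lemma phi_osign: "\<phi> (osign v A x) = osign v A (\<phi> x)"
  by (simp add: osign_def phi_uminus)

lemma phi_bd: "koszul_bd V actM (\<lambda>A. \<phi> (c A)) = (\<lambda>A. \<phi> (koszul_bd V actF c A))"
  by (auto simp: koszul_bd_def fun_eq_iff phi_sum phi_osign phi_act phi_0)

lemma phi_chain: "c \<in> chains V CF i \<Longrightarrow> (\<lambda>A. \<phi> (c A)) \<in> chains V CM i"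
  by (rule chainsI) (metis chains_mem imageI phi_onto, metis chains_supp phi_0)

lemma lift_chain:
  assumes c: "c \<in> chains V CM i"
  obtains c' where "c' \<in> chains V CF i" "c = (\<lambda>A. \<phi> (c' A))"
proof -
  have "\<exists>x\<in>CF A. c A = \<phi> x \<and> (c A = 0 \<longrightarrow> x = 0)" for A
  proof (cases "c A = 0")
    case True then show ?thesis using F.C_0[of A] by (intro bexI[of _ 0]) (auto simp: phi_0)
  next
    case False
    then show ?thesis using chains_mem[OF c, of A] phi_onto[of A] by (metis imageE)
  qed
  then obtain c' where c': "\<And>A. c' A \<in> CF A \<and> c A = \<phi> (c' A) \<and> (c A = 0 \<longrightarrow> c' A = 0)"
    by metis
  have "c' \<in> chains V CF i"
    using c' chains_supp[OF c] by (intro chainsI) blast+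
  then show ?thesis using that c' by blast
qed

lemma chains_CZ_iff: "c \<in> chains V CZ i \<longleftrightarrow> c \<in> chains V CF i \<and> (\<forall>A. \<phi> (c A) = 0)"
  by (auto simp: chains_def CZ_eq)

text \<open>
  The connecting map $H_{i+1}(M)\to H_i(Z)$ is onto the classes that die in \<open>F\<close>. The assumption \<open>bdF\<close>
  is on the cycles of \<open>Z\<close> only, because in homological degree 0 a free module itself is not exact.
\<close>
lemma exact_kernel:
  assumes ex: "exact_at V actM CM (Suc i)"
    and bdF: "\<And>c. c \<in> chains V CZ i \<Longrightarrow> koszul_bd V actF c = (\<lambda>_. 0) \<Longrightarrow>
                \<exists>w\<in>chains V CF (Suc i). koszul_bd V actF w = c"
  shows "exact_at V actF CZ i"
  unfolding exact_at_def
proof (intro ballI impI)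
  fix c assume c: "c \<in> chains V CZ i" and cyc: "koszul_bd V actF c = (\<lambda>_. 0)"
  from bdF[OF c cyc] obtain w where w: "w \<in> chains V CF (Suc i)" "koszul_bd V actF w = c" ..
  have "koszul_bd V actM (\<lambda>A. \<phi> (w A)) = (\<lambda>_. 0)"
    using c by (simp add: phi_bd w(2) chains_CZ_iff)
  from exact_atD[OF ex phi_chain[OF w(1)] this]
  obtain u where u: "u \<in> chains V CM (Suc (Suc i))" "koszul_bd V actM u = (\<lambda>A. \<phi> (w A))" .
  from lift_chain[OF u(1)] obtain u' where u': "u' \<in> chains V CF (Suc (Suc i))" "u = (\<lambda>A. \<phi> (u' A))" .
  let ?z = "\<lambda>A. w A - koszul_bd V actF u' A"
  have "\<phi> (?z A) = 0" for A
    using fun_cong[OF u(2), of A] unfolding u'(2) phi_bd by (simp add: phi_diff)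
  then have "?z \<in> chains V CZ (Suc i)"
    unfolding chains_CZ_iff using F.chains_diff[OF w(1) F.bd_chain[OF u'(1)]] by blast
  moreover have "koszul_bd V actF ?z = c"
    by (simp add: F.bd_diff w(2))
  ultimately show "\<exists>w\<in>chains V CZ (Suc i). koszul_bd V actF w = c" by blast
qed

lemma exact_quotient:
  assumes exZ: "exact_at V actF CZ i" and exF: "exact_at V actF CF (Suc i)"
  shows "exact_at V actM CM (Suc i)"
  unfolding exact_at_def
proof (intro ballI impI)
  fix c assume c: "c \<in> chains V CM (Suc i)" and cyc: "koszul_bd V actM c = (\<lambda>_. 0)"
  from lift_chain[OF c] obtain c' where c': "c' \<in> chains V CF (Suc i)" "c = (\<lambda>A. \<phi> (c' A))" .
  have "koszul_bd V actF c' \<in> chains V CZ i"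
    unfolding chains_CZ_iff using F.bd_chain[OF c'(1)] cyc
    unfolding c'(2) phi_bd by (auto dest: fun_cong)
  from exact_atD[OF exZ this F.bd_bd]
  obtain z where z: "z \<in> chains V CZ (Suc i)" "koszul_bd V actF z = koszul_bd V actF c'" .
  have z': "z \<in> chains V CF (Suc i)" "\<And>A. \<phi> (z A) = 0"
    using z(1) unfolding chains_CZ_iff by auto
  have "koszul_bd V actF (\<lambda>A. c' A - z A) = (\<lambda>_. 0)"
    by (simp add: F.bd_diff z(2))
  from exact_atD[OF exF F.chains_diff[OF c'(1) z'(1)] this]
  obtain w where w: "w \<in> chains V CF (Suc (Suc i))" "koszul_bd V actF w = (\<lambda>A. c' A - z A)" .
  have "koszul_bd V actM (\<lambda>A. \<phi> (w A)) = c"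
    unfolding phi_bd w(2) c'(2) by (simp add: phi_diff z'(2))
  with phi_chain[OF w(1)] show "\<exists>w\<in>chains V CM (Suc (Suc i)). koszul_bd V actM w = c" by blast
qed

lemma exact_quotient_0:
  assumes "exact_at V actF CF 0"
  shows "exact_at V actM CM 0"
  unfolding exact_at_def
proof (intro ballI impI)
  fix c assume c: "c \<in> chains V CM 0"
  from lift_chain[OF c] obtain c' where c': "c' \<in> chains V CF 0" "c = (\<lambda>A. \<phi> (c' A))" .
  have "c' (insert v A) = 0" if "A \<subseteq> V" for v A
    using chains_supp[OF c'(1), of "insert v A"] that F.finV
    by (metis card_eq_0_iff finite_subset insert_not_empty)
  then have "koszul_bd V actF c' = (\<lambda>_. 0)" by (auto simp: koszul_bd_def fun_eq_iff F.act_0)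
  from exact_atD[OF assms c'(1) this]
  obtain w where w: "w \<in> chains V CF (Suc 0)" "koszul_bd V actF w = c'" .
  then have "koszul_bd V actM (\<lambda>A. \<phi> (w A)) = c"
    unfolding phi_bd w(2) c'(2) by simp
  with phi_chain[OF w(1)] show "\<exists>w\<in>chains V CM (Suc 0). koszul_bd V actM w = c" by blast
qed

end

section \<open>Simplicial complexes\<close>

definition simplicial_coeff :: "'v set set \<Rightarrow> 'v set \<Rightarrow> 'k::ab_group_add set" where
  "simplicial_coeff \<Gamma> F = (if F \<in> \<Gamma> then UNIV else {0})"

definition acyclic_at :: "'k::ab_group_add itself \<Rightarrow> 'v::linorder set \<Rightarrow> 'v set set \<Rightarrow> nat \<Rightarrow> bool" where
  "acyclic_at k V \<Gamma> i \<longleftrightarrow> exact_at V (\<lambda>_ x. x) (simplicial_coeff \<Gamma> :: 'v set \<Rightarrow> 'k set) i"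

abbreviation "simplicial_bd V \<equiv> koszul_bd V (\<lambda>_ x. x)"

definition down_closed :: "'v set set \<Rightarrow> bool" where
  "down_closed \<Gamma> \<longleftrightarrow> (\<forall>F\<in>\<Gamma>. \<forall>G\<subseteq>F. G \<in> \<Gamma>)"

lemma down_closedD: "down_closed \<Gamma> \<Longrightarrow> F \<in> \<Gamma> \<Longrightarrow> G \<subseteq> F \<Longrightarrow> G \<in> \<Gamma>"
  by (auto simp: down_closed_def)

lemma simplicial_coeff_system:
  assumes "finite V" "down_closed \<Gamma>"
  shows "coeff_system V (\<lambda>_ x. x) (simplicial_coeff \<Gamma>)"
proof
  fix F v x assume "x \<in> simplicial_coeff \<Gamma> (insert v F)"
  then show "x \<in> simplicial_coeff \<Gamma> F"
    using down_closedD[OF assms(2), of "insert v F" F] by (auto simp: simplicial_coeff_def split: if_splits)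
qed (use assms in \<open>auto simp: simplicial_coeff_def split: if_splits\<close>)

lemma simplicial_chains_iff:
  "c \<in> chains V (simplicial_coeff \<Gamma>) i \<longleftrightarrow> (\<forall>F. c F \<noteq> 0 \<longrightarrow> F \<in> \<Gamma> \<and> F \<subseteq> V \<and> card F = i)"
  by (auto simp: chains_def simplicial_coeff_def)

lemma acyclic_at_iff:
  "acyclic_at TYPE('k::ab_group_add) V \<Gamma> i \<longleftrightarrow>
     (\<forall>c :: _ \<Rightarrow> 'k::ab_group_add. (\<forall>F. c F \<noteq> 0 \<longrightarrow> F \<in> \<Gamma> \<and> F \<subseteq> V \<and> card F = i) \<longrightarrow> (\<forall>F. simplicial_bd V c F = 0) \<longrightarrow>
        (\<exists>w. (\<forall>F. w F \<noteq> 0 \<longrightarrow> F \<in> \<Gamma> \<and> F \<subseteq> V \<and> card F = Suc i) \<and> (\<forall>F. simplicial_bd V w F = c F)))"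
  unfolding acyclic_at_def exact_at_def by (simp only: Ball_def Bex_def simplicial_chains_iff fun_eq_iff)

lemma acyclic_atD:
  assumes "acyclic_at TYPE('k::ab_group_add) V \<Gamma> i"
    and "\<And>F. c F \<noteq> 0 \<Longrightarrow> F \<in> \<Gamma> \<and> F \<subseteq> V \<and> card F = i" "\<And>F. simplicial_bd V c F = 0"
  obtains w :: "_ \<Rightarrow> 'k::ab_group_add" where
    "\<And>F. w F \<noteq> 0 \<Longrightarrow> F \<in> \<Gamma> \<and> F \<subseteq> V \<and> card F = Suc i" "\<And>F. simplicial_bd V w F = c F"
proof -
  have "\<forall>F. c F \<noteq> 0 \<longrightarrow> F \<in> \<Gamma> \<and> F \<subseteq> V \<and> card F = i" "\<forall>F. simplicial_bd V c F = 0"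
    using assms(2,3) by simp_all
  from assms(1)[unfolded acyclic_at_iff, rule_format, OF this(1)[rule_format] this(2)[rule_format]]
  show ?thesis using that by (metis (mono_tags))
qed

lemma acyclic_atI:
  assumes "\<And>c :: _ \<Rightarrow> 'k::ab_group_add. (\<And>F. c F \<noteq> 0 \<Longrightarrow> F \<in> \<Gamma> \<and> F \<subseteq> V \<and> card F = i) \<Longrightarrow> (\<And>F. simplicial_bd V c F = 0) \<Longrightarrow>
     \<exists>w. (\<forall>F. w F \<noteq> 0 \<longrightarrow> F \<in> \<Gamma> \<and> F \<subseteq> V \<and> card F = Suc i) \<and> (\<forall>F. simplicial_bd V w F = c F)"
  shows "acyclic_at TYPE('k::ab_group_add) V \<Gamma> i"
  using assms unfolding acyclic_at_iff by blast

definition link :: "'v \<Rightarrow> 'v set set \<Rightarrow> 'v set set" where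
  "link y \<Gamma> = {F. y \<notin> F \<and> insert y F \<in> \<Gamma>}"

definition deletion :: "'v \<Rightarrow> 'v set set \<Rightarrow> 'v set set" where
  "deletion y \<Gamma> = {F \<in> \<Gamma>. y \<notin> F}"

text \<open>
  Taking the coefficients at the faces that contain \<open>y\<close> is, up to sign, a chain map to the chains of the link.
\<close>
lemma simplicial_bd_slice:
  fixes c :: "'v::linorder set \<Rightarrow> 'k::ab_group_add"
  assumes "finite V" "y \<in> V" "y \<notin> G" "G \<subseteq> V"
  shows "simplicial_bd V (\<lambda>F. if y \<in> F then 0 else osign y F (c (insert y F))) G = - osign y G (simplicial_bd V c (insert y G))"
proof -
  have finG: "finite G" using assms finite_subset by blast
  have "simplicial_bd V (\<lambda>F. if y \<in> F then 0 else osign y F (c (insert y F))) G =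
      (\<Sum>v\<in>V - G. osign v G (if y = v then 0 else osign y (insert v G) (c (insert y (insert v G)))))"
    using assms by (auto simp: koszul_bd_def intro!: sum.cong)
  also have "\<dots> = (\<Sum>v\<in>V - insert y G. osign v G (osign y (insert v G) (c (insert y (insert v G)))))"
    using assms by (intro sum.mono_neutral_cong_right) auto
  also have "\<dots> = (\<Sum>v\<in>V - insert y G. - osign y G (osign v (insert y G) (c (insert v (insert y G)))))"
  proof (intro sum.cong refl)
    fix v assume v: "v \<in> V - insert y G"
    then show "osign v G (osign y (insert v G) (c (insert y (insert v G)))) =
        - osign y G (osign v (insert y G) (c (insert v (insert y G))))"
      using osign_swap[OF finG, of v y "c (insert y (insert v G))"] assms
      by (auto simp: insert_commute)
  qed
  also have "\<dots> = - osign y G (simplicial_bd V c (insert y G))"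
    using assms by (simp add: koszul_bd_def osign_sum sum_negf)
  finally show ?thesis .
qed

text \<open>
  Joining with \<open>y\<close> is a right inverse of the map to the link, and it is the null homotopy of the
  cone over \<open>y\<close>.
\<close>
lemma simplicial_bd_join:
  fixes u :: "'v::linorder set \<Rightarrow> 'k::ab_group_add"
  assumes "finite V" "y \<in> V" "y \<notin> G" "G \<subseteq> V" and u: "\<And>F. y \<in> F \<Longrightarrow> u F = 0"
  shows "simplicial_bd V (\<lambda>F. if y \<in> F then osign y (F - {y}) (u (F - {y})) else 0) G = u G"
    and "simplicial_bd V (\<lambda>F. if y \<in> F then osign y (F - {y}) (u (F - {y})) else 0) (insert y G) = - osign y G (simplicial_bd V u G)"
proof -
  let ?w = "\<lambda>F. if y \<in> F then osign y (F - {y}) (u (F - {y})) else 0"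
  have "simplicial_bd V ?w G = (\<Sum>v\<in>V - G. if v = y then u G else 0)"
    unfolding koszul_bd_def using assms(3,4)
    by (simp only: if_True, intro sum.cong refl) (auto simp: Diff_insert0)
  then show "simplicial_bd V ?w G = u G" using assms by simp
  have "u = (\<lambda>F. if y \<in> F then 0 else osign y F (?w (insert y F)))"
    using u by (auto simp: fun_eq_iff)
  then have "simplicial_bd V u G = simplicial_bd V (\<lambda>F. if y \<in> F then 0 else osign y F (?w (insert y F))) G" by (rule arg_cong)
  also have "\<dots> = - osign y G (simplicial_bd V ?w (insert y G))"
    by (rule simplicial_bd_slice) (use assms in auto)
  finally show "simplicial_bd V ?w (insert y G) = - osign y G (simplicial_bd V u G)"
    by (simp add: osign_uminus)
qed

lemma simplicial_bd_outside: "\<not> F \<subseteq> V \<Longrightarrow> simplicial_bd V c F = 0"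
  by (simp add: koszul_bd_def)

lemma acyclic_cone:
  assumes "finite V" "y \<in> V" and cone: "\<And>F. F \<in> \<Gamma> \<Longrightarrow> insert y F \<in> \<Gamma>"
  shows "acyclic_at TYPE('k::ab_group_add) V \<Gamma> i"
proof (rule acyclic_atI)
  fix c :: "_ \<Rightarrow> 'k"
  assume c: "\<And>F. c F \<noteq> 0 \<Longrightarrow> F \<in> \<Gamma> \<and> F \<subseteq> V \<and> card F = i" and cyc: "\<And>F. simplicial_bd V c F = 0"
  define u where "u F = (if y \<in> F then 0 else c F)" for F
  let ?w = "\<lambda>F. if y \<in> F then osign y (F - {y}) (u (F - {y})) else 0"
  have "simplicial_bd V ?w F = c F" for F
  proof (cases "F \<subseteq> V")
    case True
    show ?thesis
    proof (cases "y \<in> F")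
      case False
      then show ?thesis using simplicial_bd_join(1)[OF assms(1,2) False True, of u] by (simp add: u_def)
    next
      case yF: True
      define G where "G = F - {y}"
      have G: "y \<notin> G" "G \<subseteq> V" "F = insert y G" using yF True by (auto simp: G_def)
      have "0 = simplicial_bd V c G" by (simp add: cyc)
      also have "\<dots> = osign y G (c F) + (\<Sum>v\<in>V - insert y G. osign v G (c (insert v G)))"
        using G assms(1,2) by (simp add: koszul_bd_def sum.remove[of "V - G" y] Diff_insert[symmetric])
      also have "(\<Sum>v\<in>V - insert y G. osign v G (c (insert v G))) = simplicial_bd V u G"
        unfolding koszul_bd_def using G assms(1)
        by (auto simp: u_def intro!: sum.mono_neutral_cong_left)
      finally have "- simplicial_bd V u G = osign y G (c F)" by (metis add_eq_0_iff2)
      then have "- osign y G (simplicial_bd V u G) = c F" by (metis osign_osign osign_uminus)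
      then show ?thesis using simplicial_bd_join(2)[OF assms(1,2) G(1,2), of u] G(3) by (simp add: u_def)
    qed
  next
    case False
    then show ?thesis using c by (auto simp: simplicial_bd_outside)
  qed
  moreover have "F \<in> \<Gamma> \<and> F \<subseteq> V \<and> card F = Suc i" if "?w F \<noteq> 0" for F
  proof -
    from that have y: "y \<in> F" and nz: "c (F - {y}) \<noteq> 0" by (auto simp: u_def split: if_splits)
    note c' = c[OF nz]
    have "finite (F - {y})" using c' assms(1) finite_subset by blast
    then have "finite F" by simp
    then have "card F = Suc i" using c' y by (metis card_Suc_Diff1)
    moreover have "insert y (F - {y}) = F" using y by auto
    ultimately show ?thesis using c' cone[of "F - {y}"] assms(2) y by auto
  qed
  ultimately show "\<exists>w. (\<forall>F. w F \<noteq> 0 \<longrightarrow> F \<in> \<Gamma> \<and> F \<subseteq> V \<and> card F = Suc i) \<and> (\<forall>F. simplicial_bd V w F = c F)"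
    by (intro exI[of _ ?w]) blast
qed

lemma slice_support:
  fixes c :: "'v::linorder set \<Rightarrow> 'k::ab_group_add"
  assumes "finite V" and c: "\<And>F. c F \<noteq> 0 \<Longrightarrow> F \<in> \<Gamma> \<and> F \<subseteq> V \<and> card F = i"
    and nz: "(if y \<in> F then 0 else osign y F (c (insert y F))) \<noteq> 0"
  shows "F \<in> link y \<Gamma> \<and> F \<subseteq> V \<and> Suc (card F) = i"
proof -
  from nz have y: "y \<notin> F" and "c (insert y F) \<noteq> 0" by (auto split: if_splits)
  from c[OF this(2)] y show ?thesis
    using finite_subset[OF _ assms(1), of F] by (auto simp: link_def)
qed

text \<open>
  From the exact sequence $H_i(\mathrm{del})\to H_i(\Gamma)\to H_{i-1}(\mathrm{lk})$. Degrees count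
  vertices, so removing \<open>y\<close> from a face lowers the degree by one.
\<close>
lemma acyclic_of_link_deletion:
  assumes fin: "finite V" and yV: "y \<in> V" and down: "down_closed \<Gamma>"
    and del: "acyclic_at TYPE('k::ab_group_add) V (deletion y \<Gamma>) i"
    and lk: "\<And>i'. i = Suc i' \<Longrightarrow> acyclic_at TYPE('k::ab_group_add) V (link y \<Gamma>) i'"
  shows "acyclic_at TYPE('k::ab_group_add) V \<Gamma> i"
proof (rule acyclic_atI)
  interpret coeff_system V "\<lambda>_ x. x" "simplicial_coeff \<Gamma> :: _ \<Rightarrow> 'k set"
    by (rule simplicial_coeff_system[OF fin down])
  fix c :: "_ \<Rightarrow> 'k"
  assume c: "\<And>F. c F \<noteq> 0 \<Longrightarrow> F \<in> \<Gamma> \<and> F \<subseteq> V \<and> card F = i" and cyc: "\<And>F. simplicial_bd V c F = 0"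
  define c1 where "c1 F = (if y \<in> F then 0 else osign y F (c (insert y F)))" for F
  have c1: "F \<in> link y \<Gamma> \<and> F \<subseteq> V \<and> Suc (card F) = i" if "c1 F \<noteq> 0" for F
    using slice_support[of V c \<Gamma> i y F, OF fin c] that unfolding c1_def by blast
  have c1_fun: "c1 = (\<lambda>F. if y \<in> F then 0 else osign y F (c (insert y F)))"
    by (rule ext) (rule c1_def)
  have cyc1: "simplicial_bd V c1 G = 0" for G
  proof (cases "G \<subseteq> V \<and> y \<notin> G")
    case True
    then have "simplicial_bd V c1 G = - osign y G (simplicial_bd V c (insert y G))"
      using simplicial_bd_slice[OF fin yV, of G c] unfolding c1_fun by blast
    then show ?thesis by (simp only: cyc osign_0 minus_zero)
  next
    case False
    then show ?thesis by (auto simp: koszul_bd_def c1_def)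
  qed
  obtain u where u: "\<And>F. u F \<noteq> 0 \<Longrightarrow> F \<in> link y \<Gamma> \<and> F \<subseteq> V \<and> card F = i" "\<And>F. simplicial_bd V u F = c1 F"
  proof (cases i)
    case 0
    then have "c1 F = 0" for F using c1[of F] by auto
    then show ?thesis using that[of "\<lambda>_. 0"] by simp
  next
    case (Suc i')
    have "F \<in> link y \<Gamma> \<and> F \<subseteq> V \<and> card F = i'" if "c1 F \<noteq> 0" for F
      using c1[OF that] Suc by simp
    from acyclic_atD[OF lk[OF Suc] this cyc1] show ?thesis using that Suc by blast
  qed
  have uy: "u F = 0" if "y \<in> F" for F using u(1)[of F] that by (auto simp: link_def)
  \<comment> \<open>The filling of the link is joined with \<open>y\<close>; subtracting its boundary clears all faces through \<open>y\<close>.\<close>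
  define w where "w F = - (if y \<in> F then osign y (F - {y}) (u (F - {y})) else 0)" for F
  have w_chain: "F \<in> \<Gamma> \<and> F \<subseteq> V \<and> card F = Suc i" if "w F \<noteq> 0" for F
  proof -
    from that have y: "y \<in> F" and nz: "u (F - {y}) \<noteq> 0" by (auto simp: w_def split: if_splits)
    note u' = u(1)[OF nz]
    have e: "insert y (F - {y}) = F" using y by auto
    have "finite (F - {y})" using u' fin finite_subset by blast
    then have "finite F" by simp
    then have "card F = Suc i" using u' y by (metis card_Suc_Diff1)
    then show ?thesis using u' e yV y by (auto simp: link_def)
  qed
  have bd_w: "simplicial_bd V w (insert y G) = c (insert y G)" if "y \<notin> G" "G \<subseteq> V" for G
  proof -
    have "simplicial_bd V w (insert y G) = - (- osign y G (simplicial_bd V u G))"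
      unfolding w_def bd_uminus using simplicial_bd_join(2)[where u = u, OF fin yV that uy] by simp
    then show ?thesis using that by (simp add: u(2) c1_def)
  qed
  define e where "e F = c F - simplicial_bd V w F" for F
  have wc: "w \<in> chains V (simplicial_coeff \<Gamma>) (Suc i)"
    unfolding simplicial_chains_iff using w_chain by blast
  have "c \<in> chains V (simplicial_coeff \<Gamma>) i"
    unfolding simplicial_chains_iff using c by blast
  then have "e \<in> chains V (simplicial_coeff \<Gamma>) i"
    unfolding e_def by (rule chains_diff[OF _ bd_chain[OF wc]])
  then have e1: "F \<in> \<Gamma> \<and> F \<subseteq> V \<and> card F = i" if "e F \<noteq> 0" for F
    using that unfolding simplicial_chains_iff by blast
  have e2: "y \<notin> F" if "e F \<noteq> 0" for F
  proof
    assume "y \<in> F"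
    then have "insert y (F - {y}) = F" by auto
    then show False using bd_w[of "F - {y}"] e1[OF that] that by (auto simp: e_def)
  qed
  have "simplicial_bd V e = (\<lambda>_. 0)"
    unfolding e_def bd_diff using cyc by (simp add: fun_eq_iff)
  then have e3: "simplicial_bd V e F = 0" for F by simp
  have "F \<in> deletion y \<Gamma> \<and> F \<subseteq> V \<and> card F = i" if "e F \<noteq> 0" for F
    using e1[OF that] e2[OF that] by (simp add: deletion_def)
  from acyclic_atD[OF del this e3]
  obtain w' where w': "\<And>F. w' F \<noteq> 0 \<Longrightarrow> F \<in> deletion y \<Gamma> \<and> F \<subseteq> V \<and> card F = Suc i" "\<And>F. simplicial_bd V w' F = e F"
    by blast
  have "simplicial_bd V (\<lambda>F. w' F + w F) F = c F" for F
    by (simp add: bd_add w' e_def)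
  moreover have "F \<in> \<Gamma> \<and> F \<subseteq> V \<and> card F = Suc i" if "w' F + w F \<noteq> 0" for F
    using that w'(1)[of F] w_chain[of F] by (cases "w F = 0") (auto simp: deletion_def)
  ultimately show "\<exists>w. (\<forall>F. w F \<noteq> 0 \<longrightarrow> F \<in> \<Gamma> \<and> F \<subseteq> V \<and> card F = Suc i) \<and> (\<forall>F. simplicial_bd V w F = c F)"
    by (intro exI[of _ "\<lambda>F. w' F + w F"]) blast
qed

text \<open>
  From the exact sequence $H_i(\mathrm{lk})\to H_i(\mathrm{del})\to H_i(\Gamma)$.
\<close>
lemma acyclic_deletion:
  assumes fin: "finite V" and yV: "y \<in> V" and down: "down_closed \<Gamma>"
    and all: "acyclic_at TYPE('k::ab_group_add) V \<Gamma> i"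
    and lk: "acyclic_at TYPE('k::ab_group_add) V (link y \<Gamma>) i"
  shows "acyclic_at TYPE('k::ab_group_add) V (deletion y \<Gamma>) i"
proof (rule acyclic_atI)
  interpret coeff_system V "\<lambda>_ x. x" "simplicial_coeff \<Gamma> :: _ \<Rightarrow> 'k set"
    by (rule simplicial_coeff_system[OF fin down])
  fix c :: "_ \<Rightarrow> 'k"
  assume c: "\<And>F. c F \<noteq> 0 \<Longrightarrow> F \<in> deletion y \<Gamma> \<and> F \<subseteq> V \<and> card F = i" and cyc: "\<And>F. simplicial_bd V c F = 0"
  have "F \<in> \<Gamma> \<and> F \<subseteq> V \<and> card F = i" if "c F \<noteq> 0" for F
    using c[OF that] by (simp add: deletion_def)
  from acyclic_atD[OF all this cyc]
  obtain w where w: "\<And>F. w F \<noteq> 0 \<Longrightarrow> F \<in> \<Gamma> \<and> F \<subseteq> V \<and> card F = Suc i" "\<And>F. simplicial_bd V w F = c F"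
    by blast
  \<comment> \<open>The filling is split into the faces that avoid \<open>y\<close> and those that contain it.\<close>
  define w0 where "w0 F = (if y \<in> F then 0 else w F)" for F
  define w1 where "w1 F = (if y \<in> F then 0 else osign y F (w (insert y F)))" for F
  have w1: "F \<in> link y \<Gamma> \<and> F \<subseteq> V \<and> card F = i" if "w1 F \<noteq> 0" for F
    using slice_support[of V w \<Gamma> "Suc i" y F, OF fin w(1)] that unfolding w1_def by blast
  have w1_fun: "w1 = (\<lambda>F. if y \<in> F then 0 else osign y F (w (insert y F)))"
    by (rule ext) (rule w1_def)
  have cyc1: "simplicial_bd V w1 G = 0" for G
  proof (cases "G \<subseteq> V \<and> y \<notin> G")
    case True
    moreover have "c (insert y G) = 0" using c[of "insert y G"] by (auto simp: deletion_def)
    moreover have "simplicial_bd V w1 G = - osign y G (simplicial_bd V w (insert y G))"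
      using True simplicial_bd_slice[OF fin yV, of G w] unfolding w1_fun by blast
    ultimately show ?thesis by (simp only: w(2) osign_0 minus_zero)
  next
    case False
    then show ?thesis by (auto simp: koszul_bd_def w1_def)
  qed
  from acyclic_atD[OF lk w1 cyc1]
  obtain u where u: "\<And>F. u F \<noteq> 0 \<Longrightarrow> F \<in> link y \<Gamma> \<and> F \<subseteq> V \<and> card F = Suc i" "\<And>F. simplicial_bd V u F = w1 F"
    by blast
  have "F \<in> deletion y \<Gamma> \<and> F \<subseteq> V \<and> card F = Suc i" if "w0 F + u F \<noteq> 0" for F
  proof (cases "u F = 0")
    case True
    then show ?thesis using that w(1)[of F] by (auto simp: w0_def deletion_def split: if_splits)
  next
    case False
    then show ?thesis using u(1)[of F] down_closedD[OF down, of "insert y F" F]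
      by (auto simp: link_def deletion_def)
  qed
  moreover have "simplicial_bd V (\<lambda>F. w0 F + u F) F = c F" for F
  proof (cases "F \<subseteq> V")
    case V: True
    show ?thesis
    proof (cases "y \<in> F")
      case True
      then have "simplicial_bd V w0 F = 0" by (auto simp: koszul_bd_def w0_def)
      moreover have "c F = 0" using c[of F] True by (auto simp: deletion_def)
      ultimately show ?thesis using True by (simp add: bd_add u(2) w1_def)
    next
      case False
      have "c F = (\<Sum>v\<in>V - F. osign v F (w (insert v F)))"
        using w(2)[of F] V by (simp add: koszul_bd_def)
      also have "\<dots> = osign y F (w (insert y F)) + (\<Sum>v\<in>V - F - {y}. osign v F (w (insert v F)))"
        using False V fin yV by (subst sum.remove[of "V - F" y]) auto
      also have "(\<Sum>v\<in>V - F - {y}. osign v F (w (insert v F))) = simplicial_bd V w0 F"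
        unfolding koszul_bd_def using V False fin
        by (simp only: if_True, intro sum.mono_neutral_cong_left) (auto simp: w0_def)
      finally show ?thesis using False by (simp add: bd_add u(2) w1_def add.commute)
    qed
  next
    case False
    then show ?thesis using c by (auto simp: simplicial_bd_outside)
  qed
  ultimately show "\<exists>w. (\<forall>F. w F \<noteq> 0 \<longrightarrow> F \<in> deletion y \<Gamma> \<and> F \<subseteq> V \<and> card F = Suc i) \<and> (\<forall>F. simplicial_bd V w F = c F)"
    by (intro exI[of _ "\<lambda>F. w0 F + u F"]) blast
qed

lemma acyclic_Pow:
  assumes "finite V" "W \<subseteq> V" "i > 0 \<or> W \<noteq> {}"
  shows "acyclic_at TYPE('k::ab_group_add) V (Pow W) i"
proof (cases "W = {}")
  case False
  then obtain y where "y \<in> W" by blast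
  then show ?thesis using assms(2) by (intro acyclic_cone[OF assms(1), of y]) auto
next
  case True
  show ?thesis
  proof (rule acyclic_atI)
    fix c :: "_ \<Rightarrow> 'k" assume c: "\<And>F. c F \<noteq> 0 \<Longrightarrow> F \<in> Pow W \<and> F \<subseteq> V \<and> card F = i"
    have "c F = 0" for F using c[of F] True assms(3) by (cases "c F = 0") auto
    then show "\<exists>w. (\<forall>F. w F \<noteq> 0 \<longrightarrow> F \<in> Pow W \<and> F \<subseteq> V \<and> card F = Suc i) \<and> (\<forall>F. simplicial_bd V w F = c F)"
      by (intro exI[of _ "\<lambda>_. 0"]) (simp add: koszul_bd_def)
  qed
qed

lemma osign_image:
  assumes "strict_mono_on W f" "insert v F \<subseteq> W"
  shows "osign (f v) (f ` F) x = osign v F x"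
proof -
  have "f u < f v \<longleftrightarrow> u < v" if "u \<in> F" for u
  proof -
    have "u \<in> W" "v \<in> W" using assms(2) that by auto
    then show ?thesis
      using strict_mono_onD[OF assms(1), of u v] strict_mono_onD[OF assms(1), of v u]
      by (cases u v rule: linorder_cases) auto
  qed
  then have "{u \<in> f ` F. u < f v} = f ` {u \<in> F. u < v}" by auto
  moreover have "inj_on f {u \<in> F. u < v}"
    using strict_mono_on_imp_inj_on[OF assms(1)] assms(2) by (auto intro: inj_on_subset)
  ultimately show ?thesis by (simp add: osign_def card_image)
qed

lemma simplicial_bd_image:
  fixes c :: "_ \<Rightarrow> 'k::ab_group_add"
  assumes f: "strict_mono_on W f" and VW: "finite V" "f ` W \<subseteq> V" and F: "F \<subseteq> W"
    and c: "\<And>G. c G \<noteq> 0 \<Longrightarrow> G \<subseteq> f ` W"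
  shows "simplicial_bd V c (f ` F) = simplicial_bd W (\<lambda>G. c (f ` G)) F"
proof -
  note inj = strict_mono_on_imp_inj_on[OF f]
  have d: "f ` (W - F) = f ` W - f ` F" using inj F by (simp add: inj_on_image_set_diff[of f W])
  have "simplicial_bd V c (f ` F) = (\<Sum>v\<in>V - f ` F. osign v (f ` F) (c (insert v (f ` F))))"
    using F VW(2) by (auto simp: koszul_bd_def)
  also have "\<dots> = (\<Sum>v\<in>f ` (W - F). osign v (f ` F) (c (insert v (f ` F))))"
    unfolding d using VW c by (intro sum.mono_neutral_right) (auto, blast)
  also have "\<dots> = (\<Sum>v\<in>W - F. osign (f v) (f ` F) (c (insert (f v) (f ` F))))"
    using inj by (subst sum.reindex) (auto intro: inj_on_subset)
  also have "\<dots> = simplicial_bd W (\<lambda>G. c (f ` G)) F"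
    using F osign_image[OF f] by (auto simp: koszul_bd_def intro!: sum.cong)
  finally show ?thesis .
qed

text \<open>
  The signs depend on the order of the vertices, so the relabelling is required to be monotone. Taking
  for \<open>f\<close> the identity changes the ambient vertex set.
\<close>
lemma acyclic_image:
  assumes f: "strict_mono_on W f" and VW: "finite V" "f ` W \<subseteq> V" and \<Gamma>: "\<Gamma> \<subseteq> Pow W"
  shows "acyclic_at TYPE('k::ab_group_add) W \<Gamma> i \<longleftrightarrow> acyclic_at TYPE('k::ab_group_add) V ((`) f ` \<Gamma>) i"
proof -
  note inj = strict_mono_on_imp_inj_on[OF f]
  have mem: "f ` G \<in> (`) f ` \<Gamma> \<longleftrightarrow> G \<in> \<Gamma>" if "G \<subseteq> W" for G
  proof
    assume "f ` G \<in> (`) f ` \<Gamma>"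
    then obtain H where "H \<in> \<Gamma>" "f ` G = f ` H" by blast
    then show "G \<in> \<Gamma>" using that \<Gamma> inj_on_image_eq_iff[OF inj that, of H] by auto
  qed simp
  have card: "card (f ` G) = card G" if "G \<subseteq> W" for G
    using that inj by (meson card_image inj_on_subset)
  define pull :: "('b set \<Rightarrow> 'k) \<Rightarrow> 'a set \<Rightarrow> 'k" where "pull c G = (if G \<subseteq> W then c (f ` G) else 0)" for c G
  define push :: "('a set \<Rightarrow> 'k) \<Rightarrow> 'b set \<Rightarrow> 'k" where
    "push c G = (if G \<subseteq> f ` W then c (W \<inter> f -` G) else 0)" for c G
  have img: "f ` (W \<inter> f -` G) = G" if "G \<subseteq> f ` W" for G using that by blast
  have pre: "W \<inter> f -` (f ` G) = G" if "G \<subseteq> W" for G using that inj by (auto dest: inj_onD)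
  let ?ch = "\<lambda>(V::'b set) i c. \<forall>F. c F \<noteq> 0 \<longrightarrow> F \<in> (`) f ` \<Gamma> \<and> F \<subseteq> V \<and> card F = i"
  let ?ch' = "\<lambda>(V::'a set) i c. \<forall>F. c F \<noteq> 0 \<longrightarrow> F \<in> \<Gamma> \<and> F \<subseteq> V \<and> card F = i"
  have supp: "F \<subseteq> f ` W" if "?ch V i c" "c F \<noteq> 0" for c :: "'b set \<Rightarrow> 'k" and i F
  proof -
    from that have "F \<in> (`) f ` \<Gamma>" by simp
    then obtain G where "G \<in> \<Gamma>" "F = f ` G" by (rule imageE) simp
    then show ?thesis using \<Gamma> by auto
  qed
  have pull_ch: "?ch' W i (pull c)" if "?ch V i c" for c i
  proof (intro allI impI)
    fix F assume "pull c F \<noteq> 0"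
    then have F: "F \<subseteq> W" "c (f ` F) \<noteq> 0" by (auto simp: pull_def split: if_splits)
    from that F(2) have "f ` F \<in> (`) f ` \<Gamma> \<and> card (f ` F) = i" by simp
    then show "F \<in> \<Gamma> \<and> F \<subseteq> W \<and> card F = i" using F(1) mem card by simp
  qed
  have push_ch: "?ch V i (push c)" if "?ch' W i c" for c i
  proof (intro allI impI)
    fix F assume "push c F \<noteq> 0"
    then have F: "F \<subseteq> f ` W" "c (W \<inter> f -` F) \<noteq> 0" by (auto simp: push_def split: if_splits)
    with that have "W \<inter> f -` F \<in> \<Gamma> \<and> card (W \<inter> f -` F) = i" by blast
    then show "F \<in> (`) f ` \<Gamma> \<and> F \<subseteq> V \<and> card F = i"
      using img[OF F(1)] F(1) VW(2) card[of "W \<inter> f -` F"] by (metis imageI inf_le1 order_trans)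
  qed
  have pull_push: "pull (push c) = c" if "?ch' W i c" for c i
    using that pre by (auto simp: pull_def push_def fun_eq_iff)
  have push_pull: "push (pull c) = c" if "?ch V i c" for c i
    using supp[OF that] img by (auto simp: pull_def push_def fun_eq_iff)
  have bd_pull: "simplicial_bd W (pull c) G = (if G \<subseteq> W then simplicial_bd V c (f ` G) else 0)" if "?ch V i c" for c i G
  proof (cases "G \<subseteq> W")
    case True
    have "simplicial_bd W (pull c) G = simplicial_bd W (\<lambda>G. c (f ` G)) G"
      using True by (auto simp: koszul_bd_def pull_def intro!: sum.cong)
    then show ?thesis using True simplicial_bd_image[where c = c, OF f VW True supp[OF that]] by simp
  qed (simp add: simplicial_bd_outside)
  have bd_supp: "simplicial_bd V c G = 0" if "?ch V i c" "\<not> G \<subseteq> f ` W" for c :: "'b set \<Rightarrow> 'k" and i G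
  proof -
    have "c (insert v G) = 0" for v using supp[OF that(1), of "insert v G"] that(2) by auto
    then show ?thesis by (simp add: koszul_bd_def)
  qed
  show ?thesis
  proof
    assume A: "acyclic_at TYPE('k::ab_group_add) W \<Gamma> i"
    show "acyclic_at TYPE('k::ab_group_add) V ((`) f ` \<Gamma>) i"
      unfolding acyclic_at_iff
    proof (intro allI impI)
      fix c :: "_ \<Rightarrow> 'k" assume c: "?ch V i c" and cyc: "\<forall>F. simplicial_bd V c F = 0"
      have "\<forall>G. simplicial_bd W (pull c) G = 0" using bd_pull[OF c] cyc by simp
      from acyclic_atD[OF A pull_ch[OF c, rule_format] this[rule_format]]
      obtain w where "\<And>F. w F \<noteq> 0 \<Longrightarrow> F \<in> \<Gamma> \<and> F \<subseteq> W \<and> card F = Suc i"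
        and w2: "\<And>G. simplicial_bd W w G = pull c G" by metis
      then have w: "?ch' W (Suc i) w" by blast
      have "simplicial_bd V (push w) G = c G" for G
      proof (cases "G \<subseteq> f ` W")
        case True
        then have "simplicial_bd W (pull (push w)) (W \<inter> f -` G) = simplicial_bd V (push w) G"
          using bd_pull[OF push_ch[OF w]] img by simp
        then have "simplicial_bd V (push w) G = pull c (W \<inter> f -` G)"
          using pull_push[OF w] w2 by simp
        then show ?thesis using True img by (simp add: pull_def)
      next
        case False
        then show ?thesis using bd_supp[OF push_ch[OF w]] supp[OF c] by auto
      qed
      then show "\<exists>w. ?ch V (Suc i) w \<and> (\<forall>F. simplicial_bd V w F = c F)"
        using push_ch[OF w] by blast
    qed
  next
    assume A: "acyclic_at TYPE('k::ab_group_add) V ((`) f ` \<Gamma>) i"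
    show "acyclic_at TYPE('k::ab_group_add) W \<Gamma> i"
      unfolding acyclic_at_iff
    proof (intro allI impI)
      fix c :: "_ \<Rightarrow> 'k" assume c: "?ch' W i c" and cyc: "\<forall>F. simplicial_bd W c F = 0"
      have "simplicial_bd V (push c) G = 0" for G
      proof (cases "G \<subseteq> f ` W")
        case True
        then have "simplicial_bd V (push c) G = simplicial_bd W (pull (push c)) (W \<inter> f -` G)"
          using bd_pull[OF push_ch[OF c]] img by simp
        then show ?thesis using pull_push[OF c] cyc by simp
      qed (use bd_supp[OF push_ch[OF c]] in simp)
      from acyclic_atD[OF A push_ch[OF c, rule_format] this]
      obtain w where "\<And>F. w F \<noteq> 0 \<Longrightarrow> F \<in> (`) f ` \<Gamma> \<and> F \<subseteq> V \<and> card F = Suc i"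
        and w2: "\<And>G. simplicial_bd V w G = push c G" by metis
      then have w: "?ch V (Suc i) w" by blast
      have "simplicial_bd W (pull w) G = c G" for G
      proof (cases "G \<subseteq> W")
        case True
        then have "f ` G \<subseteq> f ` W" by blast
        then show ?thesis using True bd_pull[OF w, of G] pre[OF True] by (simp add: w2 push_def)
      next
        case False
        then have "c G = 0" using c by blast
        then show ?thesis using False by (simp add: simplicial_bd_outside)
      qed
      then show "\<exists>w. ?ch' W (Suc i) w \<and> (\<forall>F. simplicial_bd W w F = c F)"
        using pull_ch[OF w] by blast
    qed
  qed
qed

section \<open>Duplicating vertices\<close>

text \<open>
  The Alexander dual of the restriction to \<open>W\<close> of the complex with nonfaces \<open>U\<close>.
\<close>
definition koszul_complex :: "'v set set \<Rightarrow> 'v set \<Rightarrow> 'v set set" where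
  "koszul_complex U W = {F. F \<subseteq> W \<and> W - F \<in> U}"

text \<open>
  A set of copies is a face of the expansion iff it contains no two copies of a vertex and
  projects to a face. The index ranges of the copies are imposed by the ambient vertex set.
\<close>
definition expanded_nonfaces :: "'v set set \<Rightarrow> ('v \<times> nat) set set" where
  "expanded_nonfaces U = {G. \<not> inj_on fst G \<or> fst ` G \<in> U}"

definition repeated_vertices :: "('v \<times> nat) set \<Rightarrow> 'v set" where
  "repeated_vertices W = {x. \<exists>a b. a \<noteq> b \<and> (x, a) \<in> W \<and> (x, b) \<in> W}"

definition up_closed :: "'v set set \<Rightarrow> bool" where
  "up_closed U \<longleftrightarrow> (\<forall>G\<in>U. \<forall>H. G \<subseteq> H \<longrightarrow> H \<in> U)"

lemma up_closedD: "up_closed U \<Longrightarrow> G \<in> U \<Longrightarrow> G \<subseteq> H \<Longrightarrow> H \<in> U"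
  by (auto simp: up_closed_def)

lemma up_closed_expanded_nonfaces: "up_closed U \<Longrightarrow> up_closed (expanded_nonfaces U)"
  unfolding up_closed_def expanded_nonfaces_def by (auto intro: inj_on_subset dest: image_mono)

lemma down_closed_koszul_complex: "up_closed U \<Longrightarrow> down_closed (koszul_complex U W)"
  unfolding down_closed_def koszul_complex_def
  by (auto intro: up_closedD[of U "W - F" "W - G" for F G])

lemma down_closed_deletion: "down_closed \<Gamma> \<Longrightarrow> down_closed (deletion y \<Gamma>)"
  by (auto simp: down_closed_def deletion_def)

text \<open>
  If \<open>F\<close> contains \<open>y\<close>, the complement of \<open>F\<close> in \<open>W\<close> and that of $F\setminus\{y\}$ in
  $W\setminus\{y\}$ agree.
\<close>
lemma link_koszul_complex: "y \<in> W \<Longrightarrow> link y (koszul_complex U W) = koszul_complex U (W - {y})"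
  by (auto simp: link_def koszul_complex_def insert_Diff_if Diff_insert2[symmetric] Diff_insert[symmetric])

lemma repeated_vertices_mono: "A \<subseteq> B \<Longrightarrow> repeated_vertices A \<subseteq> repeated_vertices B"
  unfolding repeated_vertices_def by blast

lemma repeated_vertices_empty_iff: "repeated_vertices W = {} \<longleftrightarrow> inj_on fst W"
  unfolding repeated_vertices_def inj_on_def by force

lemma finite_repeated_vertices: "finite W \<Longrightarrow> finite (repeated_vertices W)"
  by (rule finite_subset[of _ "fst ` W"]) (force simp: repeated_vertices_def)+

text \<open>
  If another copy \<open>y'\<close> of the same vertex is present, then every face of the deletion that misses \<open>y'\<close> is
  allowed, because its complement contains both copies. So the deletion of \<open>y'\<close> is a full simplex,
  and the question passes to the link of \<open>y'\<close>, where one copy and one degree are gone. When \<open>y\<close> is the only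
  copy left, the exact sequence of link and deletion applies; the link has one vertex less in the
  same degree, which accounts for the additional 1 in the bound. In the assumption \<open>c\<close> stands for the
  number of vertices other than that of \<open>y\<close> that have several copies.
\<close>
lemma acyclic_deletion_multiple:
  fixes V :: "('v::linorder \<times> nat) set"
  assumes fin: "finite V" and up: "up_closed U" and R: "1 \<le> R"
    and "W \<subseteq> V" "y \<in> W"
    and "\<And>W2 i. W2 \<subseteq> W \<Longrightarrow> fst y \<notin> repeated_vertices W2 \<Longrightarrow> int (card W2) - int i > R + c \<Longrightarrow>
           acyclic_at TYPE('k::ab_group_add) V (koszul_complex (expanded_nonfaces U) W2) i"
    and "0 \<le> c" "int (card W) - int i > R + 1 + c"
  shows "acyclic_at TYPE('k::ab_group_add) V (deletion y (koszul_complex (expanded_nonfaces U) W)) i"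
  using assms(4-8)
proof (induction "card W" arbitrary: W i rule: less_induct)
  case less
  let ?U = "expanded_nonfaces U"
  note down = down_closed_koszul_complex[OF up_closed_expanded_nonfaces[OF up]]
  have finW: "finite W" using less.prems(1) fin finite_subset by blast
  show ?case
  proof (cases "\<exists>y'\<in>W. y' \<noteq> y \<and> fst y' = fst y")
    case False
    then have m: "fst y \<notin> repeated_vertices W"
      using less.prems(2) unfolding repeated_vertices_def
      by (smt (verit, best) fst_conv mem_Collect_eq snd_conv)
    have m': "fst y \<notin> repeated_vertices (W - {y})" using m repeated_vertices_mono[of "W - {y}" W] by blast
    have "card (W - {y}) = card W - 1" "card W \<ge> 1"
      using less.prems(2) finW by (auto simp: Suc_le_eq card_gt_0_iff)
    then have "int (card (W - {y})) - int i > R + c" using less.prems(5) by linarith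
    then have "acyclic_at TYPE('k) V (koszul_complex ?U (W - {y})) i"
      using less.prems(3)[OF _ m'] by blast
    moreover have "acyclic_at TYPE('k) V (koszul_complex ?U W) i"
      using less.prems(3)[OF _ m] less.prems(5) by auto
    ultimately show ?thesis
      using acyclic_deletion[OF fin _ down] link_koszul_complex[OF less.prems(2)] less.prems(1,2)
      by (metis subsetD)
  next
    case True
    then obtain y' where y': "y' \<in> W" "y' \<noteq> y" "fst y' = fst y" by blast
    let ?D = "deletion y (koszul_complex ?U W)"
    have del: "deletion y' ?D = Pow (W - {y, y'})"
    proof
      show "Pow (W - {y, y'}) \<subseteq> deletion y' ?D"
      proof
        fix F assume F: "F \<in> Pow (W - {y, y'})"
        then have "y \<in> W - F" "y' \<in> W - F" using y' less.prems(2) by auto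
        then have "\<not> inj_on fst (W - F)" using y'(2,3) by (auto dest: inj_onD)
        then show "F \<in> deletion y' ?D"
          using F by (auto simp: deletion_def koszul_complex_def expanded_nonfaces_def)
      qed
    qed (auto simp: deletion_def koszul_complex_def)
    have lk: "link y' ?D = deletion y (koszul_complex ?U (W - {y'}))"
      using y'(2) unfolding link_koszul_complex[OF y'(1), symmetric]
      by (auto simp: link_def deletion_def)
    have card': "card (W - {y'}) < card W" "int (card (W - {y'})) = int (card W) - 1"
      using card_Suc_Diff1[OF finW y'(1)] by linarith+
    show ?thesis
    proof (rule acyclic_of_link_deletion[OF fin])
      show "y' \<in> V" using y' less.prems(1) by blast
      show "down_closed ?D" by (rule down_closed_deletion[OF down])
      \<comment> \<open>The full simplex on no vertices has homology in degree 0; the bound rules this case out.\<close>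
      have "i > 0 \<or> W - {y, y'} \<noteq> {}"
      proof (rule ccontr)
        assume "\<not> ?thesis"
        then have "i = 0" "W = {y, y'}" using y'(1) less.prems(2) by auto
        then have "int (card W) - int i = 2" using y'(2) by simp
        then show False using less.prems(4,5) R by linarith
      qed
      then show "acyclic_at TYPE('k) V (deletion y' ?D) i"
        unfolding del using less.prems(1) by (intro acyclic_Pow[OF fin]) auto
      fix i' assume i: "i = Suc i'"
      show "acyclic_at TYPE('k) V (link y' ?D) i'"
        unfolding lk
      proof (rule less.hyps[OF card'(1)])
        show "W - {y'} \<subseteq> V" "y \<in> W - {y'}" using less.prems(1,2) y'(2) by auto
        show "0 \<le> c" by fact
        show "int (card (W - {y'})) - int i' > R + 1 + c" using less.prems(5) card'(2) i by simp
      qed (use less.prems(3) in blast)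
    qed
  qed
qed

text \<open>
  Induction on the number of copies. If no vertex is repeated, the complex is a relabelling of one
  for the original nonfaces, since the lexicographic order makes the projection monotone. Otherwise a repeated copy \<open>y\<close> is
  split off: the link of \<open>y\<close> is covered by the induction hypothesis and the deletion by
  \<open>acyclic_deletion_multiple\<close>.
\<close>
lemma acyclic_expanded:
  fixes V :: "('v::linorder \<times> nat) set"
  assumes fin: "finite V" and up: "up_closed U" and R: "1 \<le> R"
    and finX: "finite X" and VX: "fst ` V \<subseteq> X"
    and base: "\<And>W i. W \<subseteq> X \<Longrightarrow> int (card W) - int i > R \<Longrightarrow>
                 acyclic_at TYPE('k::ab_group_add) X (koszul_complex U W) i"
    and "W \<subseteq> V" "int (card W) - int i > R + int (card (repeated_vertices W))"
  shows "acyclic_at TYPE('k::ab_group_add) V (koszul_complex (expanded_nonfaces U) W) i"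
  using assms(7,8)
proof (induction "card W" arbitrary: W i rule: less_induct)
  case less
  let ?U = "expanded_nonfaces U"
  have finW: "finite W" using less.prems(1) fin finite_subset by blast
  show ?case
  proof (cases "repeated_vertices W = {}")
    case True
    then have inj: "inj_on fst W" by (simp add: repeated_vertices_empty_iff)
    have mono: "strict_mono_on W fst"
    proof (rule strict_mono_onI)
      fix p q assume "p \<in> W" "q \<in> W" "p < q"
      then show "fst p < fst q" using inj by (auto simp: less_prod_def' dest: inj_onD)
    qed
    have fX: "fst ` W \<subseteq> X" using VX less.prems(1) by blast
    have sub: "koszul_complex ?U W \<subseteq> Pow W" by (auto simp: koszul_complex_def)
    have "(`) fst ` koszul_complex ?U W = koszul_complex U (fst ` W)"
    proof (intro equalityI subsetI)
      fix H assume "H \<in> (`) fst ` koszul_complex ?U W"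
      then obtain F where F: "H = fst ` F" "F \<subseteq> W" "W - F \<in> ?U"
        by (auto simp: koszul_complex_def)
      have "inj_on fst (W - F)" using inj by (auto intro: inj_on_subset)
      then have "fst ` (W - F) \<in> U" using F(3) by (simp add: expanded_nonfaces_def)
      then show "H \<in> koszul_complex U (fst ` W)"
        using F inj by (auto simp: koszul_complex_def inj_on_image_set_diff)
    next
      fix H assume "H \<in> koszul_complex U (fst ` W)"
      then have H: "H \<subseteq> fst ` W" "fst ` W - H \<in> U" by (auto simp: koszul_complex_def)
      let ?F = "W \<inter> fst -` H"
      have e: "fst ` ?F = H" using H(1) by blast
      have "fst ` (W - ?F) = fst ` W - H"
        using inj by (subst inj_on_image_set_diff[of fst W]) (auto simp: e)
      then have "?F \<in> koszul_complex ?U W"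
        using H(2) by (auto simp: koszul_complex_def expanded_nonfaces_def)
      then show "H \<in> (`) fst ` koszul_complex ?U W" using e by blast
    qed
    moreover have "acyclic_at TYPE('k) X (koszul_complex U (fst ` W)) i"
      using less.prems(2) True inj by (intro base[OF fX]) (simp add: card_image)
    ultimately have "acyclic_at TYPE('k) X ((`) fst ` koszul_complex ?U W) i" by simp
    then have "acyclic_at TYPE('k) W (koszul_complex ?U W) i"
      using acyclic_image[OF mono finX fX sub] by blast
    moreover have "acyclic_at TYPE('k::ab_group_add) W (koszul_complex ?U W) i \<longleftrightarrow>
        acyclic_at TYPE('k) V ((`) (\<lambda>x. x) ` koszul_complex ?U W) i"
      using less.prems(1) by (intro acyclic_image[OF _ fin _ sub]) (auto simp: strict_mono_on_def)
    ultimately show ?thesis by simp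
  next
    case False
    then obtain x a b where xab: "a \<noteq> b" "(x, a) \<in> W" "(x, b) \<in> W" by (auto simp: repeated_vertices_def)
    define y where "y = (x, a)"
    have y: "y \<in> W" "y \<in> V" "fst y = x" using xab less.prems(1) by (auto simp: y_def)
    have xm: "x \<in> repeated_vertices W" using xab by (auto simp: repeated_vertices_def)
    have card: "card (W - {y}) < card W" "int (card (W - {y})) = int (card W) - 1"
      using card_Suc_Diff1[OF finW y(1)] by linarith+
    \<comment> \<open>One repeated vertex, namely \<open>x\<close>, is not counted in the bound for the deletion.\<close>
    let ?c = "int (card (repeated_vertices W)) - 1"
    have c0: "0 \<le> ?c" using xm finite_repeated_vertices[OF finW] by (auto simp: Suc_le_eq card_gt_0_iff)
    show ?thesis
    proof (rule acyclic_of_link_deletion[OF fin y(2)])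
      show "down_closed (koszul_complex ?U W)"
        by (rule down_closed_koszul_complex[OF up_closed_expanded_nonfaces[OF up]])
      show "acyclic_at TYPE('k) V (deletion y (koszul_complex ?U W)) i"
      proof (rule acyclic_deletion_multiple[OF fin up R less.prems(1) y(1) _ c0])
        fix W2 i assume W2: "W2 \<subseteq> W" "fst y \<notin> repeated_vertices W2" "int (card W2) - int i > R + ?c"
        have "repeated_vertices W2 \<subseteq> repeated_vertices W - {x}" using W2 y(3) repeated_vertices_mono by blast
        then have "card (repeated_vertices W2) \<le> card (repeated_vertices W - {x})"
          using finite_repeated_vertices[OF finW] by (intro card_mono) auto
        then have "int (card (repeated_vertices W2)) \<le> ?c"
          using card_Suc_Diff1[OF finite_repeated_vertices[OF finW] xm] by linarith
        moreover have "W2 \<noteq> W" using W2(2) xm y(3) by auto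
        then have "card W2 < card W" using W2(1) finW by (simp add: psubset_card_mono psubsetI)
        ultimately show "acyclic_at TYPE('k) V (koszul_complex ?U W2) i"
          using less.hyps[of W2 i] W2(1,3) less.prems(1) by force
      qed (use less.prems(2) in simp)
      fix i' assume i: "i = Suc i'"
      have "card (repeated_vertices (W - {y})) \<le> card (repeated_vertices W)"
        using finite_repeated_vertices[OF finW] repeated_vertices_mono[of "W - {y}" W] by (intro card_mono) auto
      then have "int (card (W - {y})) - int i' > R + int (card (repeated_vertices (W - {y})))"
        using less.prems(2) i card(2) by linarith
      then show "acyclic_at TYPE('k) V (link y (koszul_complex ?U W)) i'"
        unfolding link_koszul_complex[OF y(1)]
        using less.hyps[OF card(1)] less.prems(1) by blast
    qed
  qed
qed

section \<open>Polynomials\<close>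

abbreviation keys :: "('a \<Rightarrow>\<^sub>0 'b::zero) \<Rightarrow> 'a set" where "keys \<equiv> Poly_Mapping.keys"
abbreviation lookup :: "('a \<Rightarrow>\<^sub>0 'b::zero) \<Rightarrow> 'a \<Rightarrow> 'b" where "lookup \<equiv> Poly_Mapping.lookup"
abbreviation single :: "'a \<Rightarrow> 'b::zero \<Rightarrow> ('a \<Rightarrow>\<^sub>0 'b)" where "single \<equiv> Poly_Mapping.single"

definition tdeg :: "('v \<Rightarrow>\<^sub>0 nat) \<Rightarrow> nat" where
  "tdeg m = (\<Sum>v\<in>keys m. lookup m v)"

lemma homogeneous_iff: "homogeneous d p \<longleftrightarrow> (\<forall>m\<in>keys p. int (tdeg m) = d)"
  by (simp add: homogeneous_def tdeg_def)

lemma keys_plus_nat: "keys (m + n :: 'v \<Rightarrow>\<^sub>0 nat) = keys m \<union> keys n"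
  by (auto simp: in_keys_iff lookup_add)

lemma tdeg_plus: "tdeg (m + n) = tdeg m + tdeg n"
  unfolding tdeg_def using setsum_keys_plus_distrib[of "\<lambda>_ x. x" m n] by simp

lemma tdeg_0 [simp]: "tdeg 0 = 0"
  by (simp add: tdeg_def)

lemma tdeg_single [simp]: "tdeg (single v n) = n"
  by (simp add: tdeg_def)

lemma tdeg_eq_0_iff: "tdeg m = 0 \<longleftrightarrow> m = 0"
  by (auto simp: tdeg_def in_keys_iff intro: poly_mapping_eqI)

lemma poly_ring_0 [simp]: "0 \<in> poly_ring V"
  and poly_ring_add: "p \<in> poly_ring V \<Longrightarrow> q \<in> poly_ring V \<Longrightarrow> p + q \<in> poly_ring V"
  and poly_ring_uminus: "p \<in> poly_ring V \<Longrightarrow> - p \<in> poly_ring V"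
  using keys_add[of p q] by (auto simp: poly_ring_def in_keys_iff)

lemma poly_ring_mult:
  assumes "p \<in> poly_ring V" "q \<in> poly_ring V" shows "p * q \<in> poly_ring V"
  unfolding poly_ring_def
proof (intro CollectI ballI)
  fix m assume "m \<in> keys (p * q)"
  then obtain a b where "m = a + b" "a \<in> keys p" "b \<in> keys q" using keys_mult[of p q] by blast
  then show "keys m \<subseteq> V" using assms by (auto simp: poly_ring_def keys_plus_nat)
qed

lemma poly_ring_single: "keys m \<subseteq> V \<Longrightarrow> single m c \<in> poly_ring V"
  by (simp add: poly_ring_def)

lemma poly_ring_var: "v \<in> V \<Longrightarrow> var v \<in> poly_ring V"
  unfolding var_def by (rule poly_ring_single) simp

lemma homogeneous_0 [simp]: "homogeneous d 0"
  by (simp add: homogeneous_def)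

lemma homogeneous_add: "homogeneous d p \<Longrightarrow> homogeneous d q \<Longrightarrow> homogeneous d (p + q)"
  using keys_add[of p q] by (auto simp: homogeneous_iff)

lemma homogeneous_uminus: "homogeneous d p \<Longrightarrow> homogeneous d (- p)"
  by (auto simp: homogeneous_iff in_keys_iff)

lemma homogeneous_mult:
  assumes "homogeneous d p" "homogeneous e q" shows "homogeneous (d + e) (p * q)"
  unfolding homogeneous_iff
proof
  fix m assume "m \<in> keys (p * q)"
  then obtain a b where "m = a + b" "a \<in> keys p" "b \<in> keys q" using keys_mult[of p q] by blast
  then show "int (tdeg m) = d + e" using assms by (simp add: homogeneous_iff tdeg_plus)
qed

lemma homogeneous_single: "int (tdeg m) = d \<Longrightarrow> homogeneous d (single m c)"
  by (simp add: homogeneous_iff)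

lemma homogeneous_var: "homogeneous 1 (var v)"
  unfolding var_def by (rule homogeneous_single) simp

lemma sum_monomials: "p = (\<Sum>m\<in>keys p. single m (lookup p m))"
proof (rule poly_mapping_eqI)
  fix n
  show "lookup p n = lookup (\<Sum>m\<in>keys p. single m (lookup p m)) n"
    by (simp add: lookup_sum lookup_single when_def in_keys_iff)
qed

lemma lookup_single_mult:
  fixes p :: "('v, 'k::field) mpoly"
  shows "lookup (single s c * p) (s + n) = c * lookup p n"
proof -
  have "single s c * p = (\<Sum>m\<in>keys p. single (s + m) (c * lookup p m))"
    by (subst (1) sum_monomials[of p]) (simp add: sum_distrib_left mult_single)
  then show ?thesis
    by (simp add: lookup_sum lookup_single when_def in_keys_iff)
qed

lemma lookup_single_mult_other:
  fixes p :: "('v, 'k::field) mpoly"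
  assumes "\<And>n. m \<noteq> s + n"
  shows "lookup (single s c * p) m = 0"
proof -
  have "m \<notin> keys (single s c * p)"
    using keys_mult[of "single s c" p] assms by (auto split: if_splits)
  then show ?thesis by (simp add: in_keys_iff)
qed

lemma lookup_var_mult:
  "lookup (var v * p) m = (if v \<in> keys m then lookup p (m - single v 1) else 0)"
proof (cases "v \<in> keys m")
  case True
  then have "m = single v 1 + (m - single v 1)"
    by (intro poly_mapping_eqI) (auto simp: lookup_add lookup_minus lookup_single when_def in_keys_iff)
  then show ?thesis using True lookup_single_mult[of "single v 1" 1 p "m - single v 1"]
    by (simp add: var_def)
next
  case False
  then have "m \<noteq> single v 1 + n" for n by (auto simp: keys_plus_nat)
  then show ?thesis using False lookup_single_mult_other[of m "single v 1" 1 p] by (simp add: var_def)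
qed

text \<open>
  Bounded exponents and finitely many variables.
\<close>
lemma finite_monomials:
  assumes "finite V" shows "finite {m :: 'v \<Rightarrow>\<^sub>0 nat. keys m \<subseteq> V \<and> int (tdeg m) = j}"
proof -
  let ?M = "{m :: 'v \<Rightarrow>\<^sub>0 nat. keys m \<subseteq> V \<and> int (tdeg m) = j}"
  have "lookup ` ?M \<subseteq> {f. \<forall>x. (x \<in> V \<longrightarrow> f x \<in> {..nat j}) \<and> (x \<notin> V \<longrightarrow> f x = 0)}"
  proof clarify
    fix m :: "'v \<Rightarrow>\<^sub>0 nat" and x
    assume m: "keys m \<subseteq> V" "j = int (tdeg m)"
    have "lookup m x \<le> tdeg m"
    proof (cases "x \<in> keys m")
      case True
      then show ?thesis unfolding tdeg_def by (intro member_le_sum) auto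
    qed (simp add: in_keys_iff)
    then show "(x \<in> V \<longrightarrow> lookup m x \<in> {..nat (int (tdeg m))}) \<and> (x \<notin> V \<longrightarrow> lookup m x = 0)"
      using m(1) by (auto simp: in_keys_iff)
  qed
  moreover have "finite {f :: 'v \<Rightarrow> nat. \<forall>x. (x \<in> V \<longrightarrow> f x \<in> {..nat j}) \<and> (x \<notin> V \<longrightarrow> f x = 0)}"
    by (rule finite_set_of_finite_funs[OF assms]) simp
  ultimately have "finite (lookup ` ?M)" by (rule finite_subset)
  then show ?thesis by (rule finite_imageD) (simp add: inj_on_def)
qed

section \<open>Squarefree monomial ideals\<close>

text \<open>
  The squarefree monomial ideal whose monomials are those with support in \<open>U\<close>.
\<close>
definition monomial_ideal :: "'v set \<Rightarrow> 'v set set \<Rightarrow> ('v, 'k::field) mpoly set" where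
  "monomial_ideal V U = {p \<in> poly_ring V. \<forall>m\<in>keys p. keys m \<in> U}"

definition ideal_coeff :: "'v set \<Rightarrow> ('v, 'k::field) mpoly set \<Rightarrow> int \<Rightarrow> 'v set \<Rightarrow> ('v, 'k) mpoly set" where
  "ideal_coeff V I j F = {p \<in> I. homogeneous (j - int (card F)) p}"

lemma monomial_ideal_0: "0 \<in> monomial_ideal V U"
  by (simp add: monomial_ideal_def)

lemma monomial_ideal_add: "p \<in> monomial_ideal V U \<Longrightarrow> q \<in> monomial_ideal V U \<Longrightarrow> p + q \<in> monomial_ideal V U"
  using keys_add[of p q] by (auto simp: monomial_ideal_def poly_ring_add)

lemma monomial_ideal_uminus: "p \<in> monomial_ideal V U \<Longrightarrow> - p \<in> monomial_ideal V U"
  by (auto simp: monomial_ideal_def poly_ring_uminus in_keys_iff)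

lemma monomial_ideal_mult:
  assumes up: "up_closed U" and p: "p \<in> poly_ring V" and q: "q \<in> monomial_ideal V U"
  shows "p * q \<in> monomial_ideal V U"
proof -
  have "keys m \<in> U" if "m \<in> keys (p * q)" for m
  proof -
    from that obtain a b where "m = a + b" "a \<in> keys p" "b \<in> keys q" using keys_mult[of p q] by blast
    then show ?thesis using q up_closedD[OF up, of "keys b" "keys m"]
      by (auto simp: monomial_ideal_def keys_plus_nat)
  qed
  then show ?thesis using p q by (auto simp: monomial_ideal_def poly_ring_mult)
qed

lemma card_insert_int:
  assumes "finite V" "F \<subseteq> V" "v \<notin> F"
  shows "int (card (insert v F)) = int (card F) + 1"
  using finite_subset[OF assms(2,1)] assms(3) by simp

abbreviation var_act :: "'v \<Rightarrow> ('v, 'k::field) mpoly \<Rightarrow> ('v, 'k) mpoly" where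
  "var_act v p \<equiv> var v * p"

lemma coeff_system_monomial_ideal:
  assumes "finite V" "up_closed U"
  shows "coeff_system V var_act (ideal_coeff V (monomial_ideal V U) j)"
proof
  fix F v p
  assume F: "F \<subseteq> V" "v \<in> V" "v \<notin> F" and "p \<in> ideal_coeff V (monomial_ideal V U) j (insert v F)"
  then have p: "p \<in> monomial_ideal V U" "homogeneous (j - int (card F) - 1) p"
    using card_insert_int[OF assms(1) F(1,3)] by (auto simp: ideal_coeff_def algebra_simps)
  then show "var_act v p \<in> ideal_coeff V (monomial_ideal V U) j F"
    using homogeneous_mult[OF homogeneous_var p(2)] monomial_ideal_mult[OF assms(2) poly_ring_var[OF F(2)] p(1)]
    by (simp add: ideal_coeff_def)
qed (use assms(1) in \<open>auto simp: ideal_coeff_def monomial_ideal_0 monomial_ideal_add monomial_ideal_uminus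
       homogeneous_add homogeneous_uminus algebra_simps\<close>)

definition squarefree_monomial :: "'v set \<Rightarrow> ('v \<Rightarrow>\<^sub>0 nat)" where
  "squarefree_monomial F = (\<Sum>v\<in>F. single v 1)"

lemma lookup_squarefree_monomial: "finite F \<Longrightarrow> lookup (squarefree_monomial F) u = (if u \<in> F then 1 else 0)"
  by (simp add: squarefree_monomial_def lookup_sum lookup_single when_def)

lemma keys_squarefree_monomial: "finite F \<Longrightarrow> keys (squarefree_monomial F) = F"
  by (auto simp: in_keys_iff lookup_squarefree_monomial split: if_splits)

lemma tdeg_squarefree_monomial: "finite F \<Longrightarrow> tdeg (squarefree_monomial F) = card F"
  by (simp add: tdeg_def keys_squarefree_monomial lookup_squarefree_monomial)

lemma squarefree_monomial_diff:
  assumes "finite F" "F \<subseteq> keys a"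
  shows "a - squarefree_monomial F + squarefree_monomial F = a"
  using assms
  by (intro poly_mapping_eqI)
    (auto simp: lookup_add lookup_minus lookup_squarefree_monomial in_keys_iff subset_eq Suc_le_eq)

text \<open>
  In multidegree \<open>a\<close> the coefficient at \<open>F\<close> is a scalar multiple of the monomial $x^a/\prod_{v\in F}v$, so a
  Koszul chain becomes a simplicial chain.
\<close>
definition multidegree_slice ::
  "('v \<Rightarrow>\<^sub>0 nat) \<Rightarrow> ('v set \<Rightarrow> ('v, 'k::field) mpoly) \<Rightarrow> 'v set \<Rightarrow> 'k" where
  "multidegree_slice a c F = (if F \<subseteq> keys a then lookup (c F) (a - squarefree_monomial F) else 0)"

lemma lookup_osign: "lookup (osign v F p) m = osign v F (lookup p m)"
  by (simp add: osign_def)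

text \<open>
  Multiplication by a variable \<open>v\<close> and the removal of \<open>v\<close> from a face cancel in the exponent, so the
  Koszul differential restricts to the simplicial boundary on each multidegree.
\<close>
lemma slice_bd:
  fixes c :: "'v::linorder set \<Rightarrow> ('v, 'k::field) mpoly"
  assumes fin: "finite V" and a: "keys a \<subseteq> V"
  shows "simplicial_bd V (multidegree_slice a c) F = multidegree_slice a (koszul_bd V var_act c) F"
proof (cases "F \<subseteq> keys a")
  case True
  then have F: "F \<subseteq> V" "finite F" using a finite_subset[OF True] by auto
  have *: "multidegree_slice a c (insert v F) = lookup (var v * c (insert v F)) (a - squarefree_monomial F)"
    if v: "v \<in> V - F" for v
  proof -
    have "v \<in> keys (a - squarefree_monomial F) \<longleftrightarrow> v \<in> keys a"
      using v F(2) by (simp add: in_keys_iff lookup_minus lookup_squarefree_monomial)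
    moreover have "a - squarefree_monomial F - single v 1 = a - squarefree_monomial (insert v F)"
      using v F(2) by (intro poly_mapping_eqI)
        (auto simp: lookup_minus lookup_squarefree_monomial lookup_single when_def)
    ultimately show ?thesis using True by (auto simp: multidegree_slice_def lookup_var_mult)
  qed
  then show ?thesis
    using True F by (simp add: koszul_bd_def multidegree_slice_def lookup_sum lookup_osign)
next
  case False
  then show ?thesis by (auto simp: koszul_bd_def multidegree_slice_def)
qed

text \<open>
  The strand of multidegree \<open>a\<close> of the Koszul complex of a monomial ideal has basis this simplicial complex, known as
  the upper Koszul complex of the ideal at \<open>a\<close>.
\<close>
definition upper_koszul_complex :: "'v set set \<Rightarrow> ('v \<Rightarrow>\<^sub>0 nat) \<Rightarrow> 'v set set" where
  "upper_koszul_complex U a = {F. F \<subseteq> keys a \<and> keys (a - squarefree_monomial F) \<in> U}"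

lemma upper_koszul_complex_squarefree:
  assumes "\<And>v. lookup a v \<le> 1"
  shows "upper_koszul_complex U a = koszul_complex U (keys a)" and "tdeg a = card (keys a)"
proof -
  have *: "lookup a v = 1" if "v \<in> keys a" for v
    using assms[of v] that by (simp add: in_keys_iff)
  have "keys (a - squarefree_monomial F) = keys a - F" if "F \<subseteq> keys a" for F
    using that finite_subset[OF that] * assms
    by (auto simp: in_keys_iff lookup_minus lookup_squarefree_monomial)
  then show "upper_koszul_complex U a = koszul_complex U (keys a)"
    by (auto simp: upper_koszul_complex_def koszul_complex_def)
  show "tdeg a = card (keys a)" by (simp add: tdeg_def *)
qed

text \<open>
  If an exponent is at least 2, dividing by that variable once does not change the support, hence the complex is a
  cone over it.
\<close>
lemma acyclic_upper_koszul_complex: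
  assumes fin: "finite V" and "keys a \<subseteq> V"
    and "\<And>W. W \<subseteq> V \<Longrightarrow> int (card W) = int (tdeg a) \<Longrightarrow> acyclic_at TYPE('k::ab_group_add) V (koszul_complex U W) i"
  shows "acyclic_at TYPE('k) V (upper_koszul_complex U a) i"
proof (cases "\<forall>v. lookup a v \<le> 1")
  case True
  then have *: "\<And>v. lookup a v \<le> 1" by blast
  show ?thesis using assms(2,3) upper_koszul_complex_squarefree[OF *] by simp
next
  case False
  then obtain v where v: "lookup a v > 1" by (auto simp: not_le)
  then have vk: "v \<in> keys a" by (simp add: in_keys_iff)
  show ?thesis
  proof (rule acyclic_cone[OF fin])
    show "v \<in> V" using vk assms(2) by blast
    fix F assume F: "F \<in> upper_koszul_complex U a"
    then have "finite F" by (auto simp: upper_koszul_complex_def intro: finite_subset)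
    then have "keys (a - squarefree_monomial (insert v F)) = keys (a - squarefree_monomial F)"
      using v by (auto simp: in_keys_iff lookup_minus lookup_squarefree_monomial split: if_splits)
    then show "insert v F \<in> upper_koszul_complex U a"
      using F vk by (simp add: upper_koszul_complex_def)
  qed
qed

text \<open>
  A Koszul cycle is filled in one multidegree at a time. Only finitely many multidegrees of total
  degree \<open>j\<close> exist, so the fillings can be summed up to polynomials.
\<close>
lemma exact_monomial_ideal:
  fixes V :: "'v::linorder set"
  assumes fin: "finite V" and up: "up_closed U"
    and ac: "\<And>W. W \<subseteq> V \<Longrightarrow> int (card W) = j \<Longrightarrow> acyclic_at TYPE('k::field) V (koszul_complex U W) i"
  shows "exact_at V var_act (ideal_coeff V (monomial_ideal V U :: ('v, 'k) mpoly set) j) i"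
  unfolding exact_at_def
proof (intro ballI impI)
  let ?C = "ideal_coeff V (monomial_ideal V U :: ('v, 'k) mpoly set) j"
  interpret coeff_system V var_act ?C by (rule coeff_system_monomial_ideal[OF fin up])
  fix c assume c: "c \<in> chains V ?C i" and cyc: "koszul_bd V var_act c = (\<lambda>_. 0)"
  define A where "A = {a :: 'v \<Rightarrow>\<^sub>0 nat. keys a \<subseteq> V \<and> int (tdeg a) = j}"
  have finA: "finite A" unfolding A_def by (rule finite_monomials[OF fin])
  have ex: "\<exists>w :: 'v set \<Rightarrow> 'k. (\<forall>F. w F \<noteq> 0 \<longrightarrow> F \<in> upper_koszul_complex U a \<and> F \<subseteq> V \<and> card F = Suc i) \<and>
        (\<forall>F. simplicial_bd V w F = multidegree_slice a c F)" if a: "a \<in> A" for a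
  proof -
    have ac_a: "acyclic_at TYPE('k) V (upper_koszul_complex U a) i"
      using a ac by (intro acyclic_upper_koszul_complex[OF fin]) (auto simp: A_def)
    have ch: "F \<in> upper_koszul_complex U a \<and> F \<subseteq> V \<and> card F = i"
      if nz: "multidegree_slice a c F \<noteq> 0" for F
    proof -
      have F: "F \<subseteq> keys a" "lookup (c F) (a - squarefree_monomial F) \<noteq> 0"
        using nz by (auto simp: multidegree_slice_def split: if_splits)
      then have "keys (a - squarefree_monomial F) \<in> U"
        using chains_mem[OF c, of F] by (auto simp: ideal_coeff_def monomial_ideal_def in_keys_iff)
      moreover have "c F \<noteq> 0" using F(2) by auto
      ultimately show ?thesis using chains_supp[OF c] F(1) by (auto simp: upper_koszul_complex_def)
    qed
    have bd0: "simplicial_bd V (multidegree_slice a c) F = 0" for F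
      using slice_bd[OF fin, of a c F] a cyc by (simp add: A_def multidegree_slice_def)
    obtain w :: "'v set \<Rightarrow> 'k" where
      "\<And>F. w F \<noteq> 0 \<Longrightarrow> F \<in> upper_koszul_complex U a \<and> F \<subseteq> V \<and> card F = Suc i"
      "\<And>F. simplicial_bd V w F = multidegree_slice a c F"
      using acyclic_atD[OF ac_a ch bd0] by metis
    then show ?thesis by (intro exI[of _ w]) simp
  qed
  from ex have "\<forall>a\<in>A. \<exists>w :: 'v set \<Rightarrow> 'k. (\<forall>F. w F \<noteq> 0 \<longrightarrow> F \<in> upper_koszul_complex U a \<and> F \<subseteq> V \<and> card F = Suc i) \<and>
        (\<forall>F. simplicial_bd V w F = multidegree_slice a c F)" ..
  from bchoice[OF this] obtain w :: "('v \<Rightarrow>\<^sub>0 nat) \<Rightarrow> 'v set \<Rightarrow> 'k" where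
    w': "\<forall>a\<in>A. (\<forall>F. w a F \<noteq> 0 \<longrightarrow> F \<in> upper_koszul_complex U a \<and> F \<subseteq> V \<and> card F = Suc i) \<and>
        (\<forall>F. simplicial_bd V (w a) F = multidegree_slice a c F)" ..
  have w: "\<And>a F. a \<in> A \<Longrightarrow> w a F \<noteq> 0 \<Longrightarrow> F \<in> upper_koszul_complex U a \<and> F \<subseteq> V \<and> card F = Suc i"
      "\<And>a F. a \<in> A \<Longrightarrow> simplicial_bd V (w a) F = multidegree_slice a c F"
    using w' by simp_all
  define e where "e F = (\<Sum>a\<in>A. single (a - squarefree_monomial F) (w a F))" for F
  have e_chain: "e \<in> chains V ?C (Suc i)"
  proof (rule chainsI)
    fix F
    have "single (a - squarefree_monomial F) (w a F) \<in> ?C F" if a: "a \<in> A" for a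
    proof (cases "w a F = 0")
      case False
      from w(1)[OF a False] have F: "F \<subseteq> keys a" "keys (a - squarefree_monomial F) \<in> U" "F \<subseteq> V"
        by (auto simp: upper_koszul_complex_def)
      have finF: "finite F" using F(3) fin finite_subset by blast
      have eq: "a - squarefree_monomial F + squarefree_monomial F = a"
        by (rule squarefree_monomial_diff[OF finF F(1)])
      from arg_cong[OF eq, of tdeg] have "tdeg (a - squarefree_monomial F) + card F = tdeg a"
        by (simp add: tdeg_plus tdeg_squarefree_monomial finF)
      moreover from arg_cong[OF eq, of keys] have "keys (a - squarefree_monomial F) \<subseteq> keys a"
        by (auto simp: keys_plus_nat)
      ultimately show ?thesis
        using a F(2) by (auto simp: ideal_coeff_def monomial_ideal_def A_def poly_ring_def homogeneous_iff)
    qed (simp add: C_0)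
    then show "e F \<in> ?C F" unfolding e_def by (rule C_sum)
    assume "e F \<noteq> 0"
    then obtain a where "a \<in> A" "single (a - squarefree_monomial F) (w a F) \<noteq> 0"
      unfolding e_def by (meson sum.neutral)
    then show "F \<subseteq> V \<and> card F = Suc i" using w(1)[of a F] by (cases "w a F = 0") auto
  qed
  have slice_e: "multidegree_slice b e F = w b F" if b: "b \<in> A" for b F
  proof (cases "F \<subseteq> keys b")
    case True
    then have finF: "finite F" by (rule finite_subset) simp
    have "multidegree_slice b e F = (\<Sum>a\<in>A. lookup (single (a - squarefree_monomial F) (w a F)) (b - squarefree_monomial F))"
      using True by (simp add: multidegree_slice_def e_def lookup_sum)
    also have "\<dots> = (\<Sum>a\<in>A. if a = b then w b F else 0)"
    proof (intro sum.cong refl)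
      fix a assume a: "a \<in> A"
      show "lookup (single (a - squarefree_monomial F) (w a F)) (b - squarefree_monomial F) = (if a = b then w b F else 0)"
      proof (cases "a = b \<or> w a F = 0")
        case False
        then have "F \<subseteq> keys a" using w(1)[OF a, of F] by (auto simp: upper_koszul_complex_def)
        then have "a - squarefree_monomial F \<noteq> b - squarefree_monomial F"
          using squarefree_monomial_diff[OF finF True] squarefree_monomial_diff[OF finF, of a] False by metis
        then show ?thesis using False by (simp add: lookup_single when_def)
      qed auto
    qed
    finally show ?thesis using b finA by simp
  next
    case False
    then have "w b F = 0" using w(1)[OF b, of F] by (auto simp: upper_koszul_complex_def)
    then show ?thesis using False by (simp add: multidegree_slice_def)
  qed
  have "koszul_bd V var_act e F = c F" for F
  proof (rule poly_mapping_eqI)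
    fix m
    show "lookup (koszul_bd V var_act e F) m = lookup (c F) m"
    proof (cases "F \<subseteq> V \<and> keys m \<subseteq> V \<and> int (tdeg m) = j - int (card F)")
      case True
      then have finF: "finite F" using fin finite_subset by blast
      let ?a = "m + squarefree_monomial F"
      have a: "?a \<in> A" "F \<subseteq> keys ?a"
        using True finF by (auto simp: A_def keys_plus_nat keys_squarefree_monomial tdeg_plus tdeg_squarefree_monomial)
      have "multidegree_slice ?a (koszul_bd V var_act e) F = simplicial_bd V (multidegree_slice ?a e) F"
        by (rule slice_bd[OF fin, symmetric]) (use a(1) in \<open>simp add: A_def\<close>)
      also have "multidegree_slice ?a e = w ?a" using slice_e[OF a(1)] by blast
      also have "simplicial_bd V (w ?a) F = multidegree_slice ?a c F" by (rule w(2)[OF a(1)])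
      finally show ?thesis using a(2) by (simp add: multidegree_slice_def)
    next
      case False
      have "lookup (x F) m = 0" if "x \<in> chains V ?C i" for x
        using False chains_mem[OF that, of F] chains_supp[OF that, of F]
        by (cases "x F = 0") (auto simp: ideal_coeff_def monomial_ideal_def poly_ring_def homogeneous_iff in_keys_iff)
      then show ?thesis using c bd_chain[OF e_chain] by simp
    qed
  qed
  then show "\<exists>w\<in>chains V ?C (Suc i). koszul_bd V var_act w = c"
    using e_chain by blast
qed

text \<open>
  A simplicial cycle is turned into a Koszul cycle of multidegree \<open>W\<close> by multiplying the coefficient at \<open>F\<close> by the
  monomial of $W\setminus F$; the slice in multidegree \<open>W\<close> of a filling of the latter fills the former.
\<close>
lemma acyclic_of_exact_monomial_ideal:
  fixes V :: "'v::linorder set"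
  assumes fin: "finite V" and up: "up_closed U"
    and ex: "exact_at V var_act (ideal_coeff V (monomial_ideal V U :: ('v, 'k::field) mpoly set) (int (card W))) i"
    and W: "W \<subseteq> V"
  shows "acyclic_at TYPE('k) V (koszul_complex U W) i"
proof (rule acyclic_atI)
  let ?C = "ideal_coeff V (monomial_ideal V U :: ('v, 'k) mpoly set) (int (card W))"
  let ?a = "squarefree_monomial W"
  have finW: "finite W" using W fin finite_subset by blast
  have keysW: "keys ?a = W" by (rule keys_squarefree_monomial[OF finW])
  have diff: "?a - squarefree_monomial F = squarefree_monomial (W - F)" if "F \<subseteq> W" for F
    using that finW finite_subset[OF that finW]
    by (intro poly_mapping_eqI) (auto simp: lookup_minus lookup_squarefree_monomial)
  fix c :: "'v set \<Rightarrow> 'k"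
  assume c: "\<And>F. c F \<noteq> 0 \<Longrightarrow> F \<in> koszul_complex U W \<and> F \<subseteq> V \<and> card F = i" and cyc: "\<And>F. simplicial_bd V c F = 0"
  define e where "e F = single (squarefree_monomial (W - F)) (c F)" for F
  have e_chain: "e \<in> chains V ?C i"
  proof (rule chainsI)
    fix F
    show "e F \<in> ?C F"
    proof (cases "c F = 0")
      case False
      then have F: "F \<subseteq> W" "W - F \<in> U" using c[OF False] by (auto simp: koszul_complex_def)
      have "int (card (W - F)) = int (card W) - int (card F)"
        using F(1) finW by (metis card_Diff_subset card_mono finite_subset of_nat_diff)
      then show ?thesis
        using F finW W
        by (auto simp: e_def ideal_coeff_def monomial_ideal_def poly_ring_def homogeneous_iff
            keys_squarefree_monomial tdeg_squarefree_monomial)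
    qed (simp add: e_def ideal_coeff_def monomial_ideal_0)
    show "F \<subseteq> V \<and> card F = i" if "e F \<noteq> 0"
      using that c[of F] by (cases "c F = 0") (auto simp: e_def)
  qed
  have "koszul_bd V var_act e F = single (squarefree_monomial (W - F)) (simplicial_bd V c F)" for F
  proof (cases "F \<subseteq> V")
    case True
    have "var v * e (insert v F) = single (squarefree_monomial (W - F)) (c (insert v F))" if v: "v \<in> V - F" for v
    proof (cases "c (insert v F) = 0")
      case False
      then have "insert v F \<subseteq> W" using c[OF False] by (auto simp: koszul_complex_def)
      then have *: "W - F = insert v (W - insert v F)" using v by auto
      have "squarefree_monomial (W - F) = single v 1 + squarefree_monomial (W - insert v F)"
        unfolding squarefree_monomial_def by (subst *) (simp add: finW)
      then show ?thesis by (simp add: e_def var_def mult_single)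
    qed (simp add: e_def)
    moreover have "osign v F (single m x) = single m (osign v F x)" for v and m :: "'v \<Rightarrow>\<^sub>0 nat" and x :: 'k
      by (simp add: osign_def single_uminus)
    moreover have "(\<Sum>x\<in>B. single m (g x)) = single m (\<Sum>x\<in>B. g x)" for B and m :: "'v \<Rightarrow>\<^sub>0 nat" and g :: "'v \<Rightarrow> 'k"
      by (induction B rule: infinite_finite_induct) (auto simp: single_add)
    ultimately show ?thesis using True by (simp add: koszul_bd_def)
  qed (simp add: koszul_bd_def)
  then have "koszul_bd V var_act e = (\<lambda>_. 0)" using cyc by (simp add: fun_eq_iff)
  from exact_atD[OF ex e_chain this] obtain w where
    w: "w \<in> chains V ?C (Suc i)" "koszul_bd V var_act w = e" .
  have "F \<in> koszul_complex U W \<and> F \<subseteq> V \<and> card F = Suc i" if nz: "multidegree_slice ?a w F \<noteq> 0" for F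
  proof -
    have F: "F \<subseteq> W" "lookup (w F) (squarefree_monomial (W - F)) \<noteq> 0"
      using nz diff[of F] by (auto simp: multidegree_slice_def keysW split: if_splits)
    then have "keys (squarefree_monomial (W - F)) \<in> U"
      using chains_mem[OF w(1), of F] by (auto simp: ideal_coeff_def monomial_ideal_def in_keys_iff)
    moreover have "w F \<noteq> 0" using F(2) by auto
    ultimately show ?thesis
      using chains_supp[OF w(1)] F(1) finW by (auto simp: koszul_complex_def keys_squarefree_monomial)
  qed
  moreover have "simplicial_bd V (multidegree_slice ?a w) F = c F" for F
  proof -
    have "simplicial_bd V (multidegree_slice ?a w) F = multidegree_slice ?a e F"
      using slice_bd[OF fin, of ?a w F] W by (simp add: keysW w(2))
    also have "\<dots> = c F"
      using c[of F] diff[of F] by (auto simp: multidegree_slice_def keysW e_def koszul_complex_def)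
    finally show ?thesis .
  qed
  ultimately show "\<exists>w. (\<forall>F. w F \<noteq> 0 \<longrightarrow> F \<in> koszul_complex U W \<and> F \<subseteq> V \<and> card F = Suc i) \<and> (\<forall>F. simplicial_bd V w F = c F)"
    by (intro exI[of _ "multidegree_slice ?a w"]) blast
qed

section \<open>Graded submodules of free modules\<close>

definition hcomp :: "int \<Rightarrow> ('v, 'k::field) mpoly \<Rightarrow> ('v, 'k) mpoly" where
  "hcomp e p = (\<Sum>m\<in>{m \<in> keys p. int (tdeg m) = e}. single m (lookup p m))"

lemma lookup_hcomp: "lookup (hcomp e p) m = (if int (tdeg m) = e then lookup p m else 0)"
  by (auto simp: hcomp_def lookup_sum lookup_single when_def in_keys_iff)

lemma keys_hcomp: "keys (hcomp e p) = {m \<in> keys p. int (tdeg m) = e}"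
  by (auto simp: in_keys_iff lookup_hcomp split: if_splits)

lemma hcomp_add: "hcomp e (p + q) = hcomp e p + hcomp e q"
  by (intro poly_mapping_eqI) (simp add: lookup_hcomp lookup_add)

lemma hcomp_0 [simp]: "hcomp e 0 = 0"
  by (simp add: hcomp_def)

lemma hcomp_sum: "hcomp e (sum f A) = (\<Sum>a\<in>A. hcomp e (f a))"
  by (induction A rule: infinite_finite_induct) (auto simp: hcomp_add)

lemma homogeneous_hcomp: "homogeneous e (hcomp e p)"
  by (auto simp: homogeneous_iff keys_hcomp)

lemma hcomp_homogeneous: "homogeneous e p \<Longrightarrow> hcomp e p = p"
  by (intro poly_mapping_eqI) (auto simp: lookup_hcomp homogeneous_iff in_keys_iff)

lemma poly_ring_hcomp: "p \<in> poly_ring V \<Longrightarrow> hcomp e p \<in> poly_ring V"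
  by (auto simp: poly_ring_def keys_hcomp)

lemma hcomp_mult:
  assumes q: "homogeneous d q"
  shows "hcomp e (q * p) = q * hcomp (e - d) p"
proof -
  have "hcomp e (q * hcomp (e - d) p) = q * hcomp (e - d) p"
    using homogeneous_mult[OF q homogeneous_hcomp[of "e - d" p]] by (intro hcomp_homogeneous) simp
  moreover have "hcomp e (q * (p - hcomp (e - d) p)) = 0"
  proof -
    have nk: "int (tdeg m) \<noteq> e" if "m \<in> keys (q * (p - hcomp (e - d) p))" for m
    proof -
      from that obtain a b where ab: "m = a + b" "a \<in> keys q" "b \<in> keys (p - hcomp (e - d) p)"
        using keys_mult[of q "p - hcomp (e - d) p"] by blast
      then have "int (tdeg b) \<noteq> e - d" by (auto simp: in_keys_iff lookup_minus lookup_hcomp)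
      moreover have "int (tdeg a) = d" using q ab(2) by (simp add: homogeneous_iff)
      ultimately show ?thesis using ab(1) by (simp add: tdeg_plus)
    qed
    show ?thesis
    proof (rule poly_mapping_eqI)
      fix m
      show "lookup (hcomp e (q * (p - hcomp (e - d) p))) m = lookup 0 m"
        using nk[of m] unfolding lookup_hcomp[of e] by (auto simp: in_keys_iff)
    qed
  qed
  ultimately show ?thesis
    using hcomp_add[of e "q * hcomp (e - d) p" "q * (p - hcomp (e - d) p)"]
    by (simp add: algebra_simps)
qed

lemma homogeneous_degree_0: "homogeneous 0 p \<Longrightarrow> p = single 0 (lookup p 0)"
  by (intro poly_mapping_eqI) (auto simp: homogeneous_iff in_keys_iff lookup_single when_def tdeg_eq_0_iff)

lemma sum_fun_apply: "(sum f A) k = (\<Sum>a\<in>A. f a k)"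
  by (induction A rule: infinite_finite_induct) auto

definition vec_scale :: "('v, 'k::field) mpoly \<Rightarrow> (nat \<Rightarrow> ('v, 'k) mpoly) \<Rightarrow> nat \<Rightarrow> ('v, 'k) mpoly" where
  "vec_scale p f = (\<lambda>k. p * f k)"

abbreviation vec_act :: "'v \<Rightarrow> (nat \<Rightarrow> ('v, 'k::field) mpoly) \<Rightarrow> nat \<Rightarrow> ('v, 'k) mpoly" where
  "vec_act v \<equiv> vec_scale (var v)"

definition vec_hcomp :: "(nat \<Rightarrow> int) \<Rightarrow> int \<Rightarrow> (nat \<Rightarrow> ('v, 'k::field) mpoly) \<Rightarrow> nat \<Rightarrow> ('v, 'k) mpoly" where
  "vec_hcomp d j f = (\<lambda>k. hcomp (j - d k) (f k))"

definition vec_homogeneous :: "nat \<Rightarrow> (nat \<Rightarrow> int) \<Rightarrow> int \<Rightarrow> (nat \<Rightarrow> ('v, 'k::field) mpoly) \<Rightarrow> bool" where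
  "vec_homogeneous r d j f \<longleftrightarrow> (\<forall>k<r. homogeneous (j - d k) (f k))"

definition graded_submodule :: "'v set \<Rightarrow> nat \<Rightarrow> (nat \<Rightarrow> int) \<Rightarrow> (nat \<Rightarrow> ('v, 'k::field) mpoly) set \<Rightarrow> bool" where
  "graded_submodule V r d Z \<longleftrightarrow>
     Z \<subseteq> free_module V r \<and> 0 \<in> Z \<and> (\<forall>f\<in>Z. \<forall>g\<in>Z. f + g \<in> Z) \<and>
     (\<forall>p\<in>poly_ring V. \<forall>f\<in>Z. vec_scale p f \<in> Z) \<and> (\<forall>f\<in>Z. \<forall>j. vec_hcomp d j f \<in> Z)"

lemma graded_submoduleD:
  assumes "graded_submodule V r d Z"
  shows "f \<in> Z \<Longrightarrow> f \<in> free_module V r" "0 \<in> Z" "f \<in> Z \<Longrightarrow> g \<in> Z \<Longrightarrow> f + g \<in> Z"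
    "p \<in> poly_ring V \<Longrightarrow> f \<in> Z \<Longrightarrow> vec_scale p f \<in> Z" "f \<in> Z \<Longrightarrow> vec_hcomp d j f \<in> Z"
  using assms by (auto simp: graded_submodule_def)

lemma poly_ring_1: "1 \<in> poly_ring V"
  by (simp add: poly_ring_def)

lemma graded_submodule_uminus:
  assumes "graded_submodule V r d Z" "f \<in> Z" shows "- f \<in> Z"
  using graded_submoduleD(4)[OF assms(1) poly_ring_uminus[OF poly_ring_1] assms(2)]
  by (simp add: vec_scale_def fun_Compl_def)

lemma graded_submodule_sum:
  assumes "graded_submodule V r d Z" "\<And>a. a \<in> A \<Longrightarrow> f a \<in> Z" shows "sum f A \<in> Z"
  using assms(2)
  by (induction A rule: infinite_finite_induct) (auto intro: graded_submoduleD[OF assms(1)])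

lemma free_moduleI: "(\<And>k. k < r \<Longrightarrow> f k \<in> poly_ring V) \<Longrightarrow> (\<And>k. k \<ge> r \<Longrightarrow> f k = 0) \<Longrightarrow> f \<in> free_module V r"
  by (simp add: free_module_def)

lemma free_moduleD: "f \<in> free_module V r \<Longrightarrow> f k \<in> poly_ring V" "f \<in> free_module V r \<Longrightarrow> k \<ge> r \<Longrightarrow> f k = 0"
  by (cases "k < r") (auto simp: free_module_def)

lemma graded_submodule_free: "graded_submodule V r d (free_module V r)"
  unfolding graded_submodule_def
  by (auto intro!: free_moduleI poly_ring_add poly_ring_mult poly_ring_hcomp
      simp: vec_scale_def vec_hcomp_def free_moduleD)

definition vec_coeff ::
  "nat \<Rightarrow> (nat \<Rightarrow> int) \<Rightarrow> (nat \<Rightarrow> ('v, 'k::field) mpoly) set \<Rightarrow> int \<Rightarrow> 'v set \<Rightarrow> (nat \<Rightarrow> ('v, 'k) mpoly) set" where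
  "vec_coeff r d Z j F = {f \<in> Z. vec_homogeneous r d (j - int (card F)) f}"

text \<open>
  The \<open>i\<close>-th Koszul homology of \<open>Z\<close>, which is $\mathrm{Tor}_i(Z,K)$, vanishes in degree \<open>j\<close>.
\<close>
definition tor_vanishes ::
  "'v::linorder set \<Rightarrow> nat \<Rightarrow> (nat \<Rightarrow> int) \<Rightarrow> (nat \<Rightarrow> ('v, 'k::field) mpoly) set \<Rightarrow> nat \<Rightarrow> int \<Rightarrow> bool" where
  "tor_vanishes V r d Z i j \<longleftrightarrow> exact_at V vec_act (vec_coeff r d Z j) i"

lemma vec_homogeneous_scale:
  assumes "homogeneous e p" "vec_homogeneous r d j f"
  shows "vec_homogeneous r d (e + j) (vec_scale p f)"
proof -
  have "homogeneous (e + (j - d k)) (p * f k)" if "k < r" for k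
    using assms that by (intro homogeneous_mult) (auto simp: vec_homogeneous_def)
  then show ?thesis by (simp add: vec_homogeneous_def vec_scale_def add_diff_eq)
qed

lemma coeff_system_vec:
  assumes fin: "finite V" and Z: "graded_submodule V r d Z"
  shows "coeff_system V vec_act (vec_coeff r d Z j)"
proof
  fix F v f assume F: "F \<subseteq> V" "v \<in> V" "v \<notin> F" and "f \<in> vec_coeff r d Z j (insert v F)"
  then have f: "f \<in> Z" "vec_homogeneous r d (j - int (card F) - 1) f"
    using card_insert_int[OF fin F(1,3)] by (auto simp: vec_coeff_def algebra_simps)
  show "vec_act v f \<in> vec_coeff r d Z j F"
    using vec_homogeneous_scale[OF homogeneous_var f(2)] graded_submoduleD(4)[OF Z poly_ring_var[OF F(2)] f(1)]
    by (simp add: vec_coeff_def)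
next
  fix v and x y :: "nat \<Rightarrow> ('a, 'b) mpoly"
  show "vec_act v (x + y) = vec_act v x + vec_act v y"
    by (simp add: vec_scale_def fun_eq_iff algebra_simps)
next
  fix u v and x :: "nat \<Rightarrow> ('a, 'b) mpoly"
  show "vec_act u (vec_act v x) = vec_act v (vec_act u x)"
    by (simp add: vec_scale_def fun_eq_iff algebra_simps)
next
  fix F show "0 \<in> vec_coeff r d Z j F"
    using graded_submoduleD(2)[OF Z] by (simp add: vec_coeff_def vec_homogeneous_def)
next
  fix F f g assume "f \<in> vec_coeff r d Z j F" "g \<in> vec_coeff r d Z j F"
  then show "f + g \<in> vec_coeff r d Z j F"
    using graded_submoduleD(3)[OF Z] by (auto simp: vec_coeff_def vec_homogeneous_def homogeneous_add)
next
  fix F f assume "f \<in> vec_coeff r d Z j F"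
  then show "- f \<in> vec_coeff r d Z j F"
    using graded_submodule_uminus[OF Z] by (auto simp: vec_coeff_def vec_homogeneous_def homogeneous_uminus)
qed (rule fin)

text \<open>
  The direct sum of \<open>r\<close> copies of \<open>I\<close>. For \<open>r = 1\<close> it is the ideal itself, seen as a submodule of a
  free module; for \<open>I = S\<close> it is the free module.
\<close>
definition ideal_power :: "('v, 'k::field) mpoly set \<Rightarrow> nat \<Rightarrow> (nat \<Rightarrow> ('v, 'k) mpoly) set" where
  "ideal_power I r = {f. (\<forall>k<r. f k \<in> I) \<and> (\<forall>k\<ge>r. f k = 0)}"

lemma free_module_eq_ideal_power: "free_module V r = ideal_power (poly_ring V) r"
  by (simp add: free_module_def ideal_power_def)

lemma graded_submodule_ideal_power:
  assumes up: "up_closed U"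
  shows "graded_submodule V r d (ideal_power (monomial_ideal V U) r)"
proof -
  have "hcomp e p \<in> monomial_ideal V U" if "p \<in> monomial_ideal V U" for e p
    using that by (auto simp: monomial_ideal_def poly_ring_hcomp keys_hcomp)
  then show ?thesis
    unfolding graded_submodule_def
    by (auto simp: ideal_power_def free_module_def vec_scale_def vec_hcomp_def monomial_ideal_0
        monomial_ideal_add monomial_ideal_mult[OF up]) (auto simp: monomial_ideal_def)
qed

lemma bd_component: "koszul_bd V vec_act c F k = koszul_bd V var_act (\<lambda>F. c F k) F"
proof -
  have "osign v F f k = osign v F (f k)" for v and f :: "nat \<Rightarrow> ('a, 'b) mpoly"
    by (simp add: osign_def)
  then show ?thesis by (simp add: koszul_bd_def sum_fun_apply vec_scale_def)
qed

text \<open>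
  Vectors are filled componentwise. This is stated for a single chain because a free module need not be exact in
  homological degree 0.
\<close>
lemma boundary_of_components:
  assumes c: "c \<in> chains V (vec_coeff r d (ideal_power I r) j) i"
    and w: "\<And>k. k < r \<Longrightarrow> \<exists>w\<in>chains V (ideal_coeff V I (j - d k)) (Suc i). koszul_bd V var_act w = (\<lambda>F. c F k)"
  shows "\<exists>w\<in>chains V (vec_coeff r d (ideal_power I r) j) (Suc i). koszul_bd V vec_act w = c"
proof -
  from w have "\<forall>k. \<exists>w. k < r \<longrightarrow> w \<in> chains V (ideal_coeff V I (j - d k)) (Suc i) \<and>
      koszul_bd V var_act w = (\<lambda>F. c F k)" by blast
  from choice[OF this] obtain w' where w': "\<And>k. k < r \<Longrightarrow> w' k \<in> chains V (ideal_coeff V I (j - d k)) (Suc i)"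
      "\<And>k. k < r \<Longrightarrow> koszul_bd V var_act (w' k) = (\<lambda>F. c F k)" by blast
  define e where "e F k = (if k < r then w' k F else 0)" for F k
  have "e \<in> chains V (vec_coeff r d (ideal_power I r) j) (Suc i)"
  proof (rule chainsI)
    fix F
    show "e F \<in> vec_coeff r d (ideal_power I r) j F"
      using chains_mem[OF w'(1), of _ F]
      by (auto simp: e_def vec_coeff_def vec_homogeneous_def ideal_power_def ideal_coeff_def algebra_simps)
    assume "e F \<noteq> 0"
    then obtain k where "k < r" "w' k F \<noteq> 0" by (auto simp: e_def fun_eq_iff split: if_splits)
    then show "F \<subseteq> V \<and> card F = Suc i" using chains_supp[OF w'(1)] by blast
  qed
  moreover have "koszul_bd V vec_act e F k = c F k" for F k
  proof (cases "k < r")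
    case True
    then show ?thesis using w'(2) by (simp add: bd_component e_def)
  next
    case False
    then have "c F k = 0" using chains_mem[OF c, of F] by (auto simp: vec_coeff_def ideal_power_def)
    moreover have "koszul_bd V var_act (\<lambda>F. e F k) F = 0" using False by (simp add: e_def koszul_bd_def)
    ultimately show ?thesis by (simp add: bd_component)
  qed
  ultimately show ?thesis by blast
qed

lemma chains_component:
  assumes c: "c \<in> chains V (vec_coeff r d (ideal_power I r) j) i" and k: "k < r"
  shows "(\<lambda>F. c F k) \<in> chains V (ideal_coeff V I (j - d k)) i"
proof (rule chainsI)
  fix F
  show "c F k \<in> ideal_coeff V I (j - d k) F"
    using chains_mem[OF c, of F] k
    by (auto simp: vec_coeff_def vec_homogeneous_def ideal_power_def ideal_coeff_def algebra_simps)
  show "F \<subseteq> V \<and> card F = i" if "c F k \<noteq> 0"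
    using chains_supp[OF c, of F] that by (cases "c F = 0") auto
qed

lemma tor_vanishes_ideal_power:
  assumes "\<And>k. k < r \<Longrightarrow> exact_at V var_act (ideal_coeff V I (j - d k)) i"
  shows "tor_vanishes V r d (ideal_power I r) i j"
  unfolding tor_vanishes_def exact_at_def
proof (intro ballI impI)
  fix c assume c: "c \<in> chains V (vec_coeff r d (ideal_power I r) j) i" and cyc: "koszul_bd V vec_act c = (\<lambda>_. 0)"
  show "\<exists>w\<in>chains V (vec_coeff r d (ideal_power I r) j) (Suc i). koszul_bd V vec_act w = c"
  proof (rule boundary_of_components[OF c])
    fix k assume k: "k < r"
    have "koszul_bd V var_act (\<lambda>F. c F k) = (\<lambda>_. 0)"
      using cyc by (simp add: fun_eq_iff bd_component[symmetric])
    from exact_atD[OF assms[OF k] chains_component[OF c k] this]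
    show "\<exists>w\<in>chains V (ideal_coeff V I (j - d k)) (Suc i). koszul_bd V var_act w = (\<lambda>F. c F k)" by blast
  qed
qed

lemma exact_ideal_of_tor_vanishes:
  assumes T: "tor_vanishes V 1 (\<lambda>_. 0) (ideal_power I 1) i j" and I0: "0 \<in> I"
  shows "exact_at V var_act (ideal_coeff V I j) i"
  unfolding exact_at_def
proof (intro ballI impI)
  fix c assume c: "c \<in> chains V (ideal_coeff V I j) i" and cyc: "koszul_bd V var_act c = (\<lambda>_. 0)"
  define e where "e F k = (if k = 0 then c F else 0)" for F and k :: nat
  have "e \<in> chains V (vec_coeff 1 (\<lambda>_. 0) (ideal_power I 1) j) i"
  proof (rule chainsI)
    fix F
    show "e F \<in> vec_coeff 1 (\<lambda>_. 0) (ideal_power I 1) j F"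
      using chains_mem[OF c, of F]
      by (auto simp: e_def vec_coeff_def vec_homogeneous_def ideal_power_def ideal_coeff_def)
    assume "e F \<noteq> 0"
    then have "c F \<noteq> 0" by (auto simp: e_def fun_eq_iff split: if_splits)
    then show "F \<subseteq> V \<and> card F = i" by (rule chains_supp[OF c])
  qed
  moreover have "koszul_bd V vec_act e = (\<lambda>_. 0)"
  proof (intro ext)
    fix F k show "koszul_bd V vec_act e F k = 0 k"
      using cyc by (cases "k = 0") (simp_all add: bd_component e_def, simp add: koszul_bd_def)
  qed
  ultimately obtain w where w: "w \<in> chains V (vec_coeff 1 (\<lambda>_. 0) (ideal_power I 1) j) (Suc i)"
      "koszul_bd V vec_act w = e"
    using T unfolding tor_vanishes_def by (rule_tac exact_atD)
  have "koszul_bd V var_act (\<lambda>F. w F 0) = c"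
    using w(2) by (simp add: fun_eq_iff bd_component[symmetric] e_def)
  moreover have "(\<lambda>F. w F 0) \<in> chains V (ideal_coeff V I j) (Suc i)"
    using chains_component[OF w(1), of 0] by simp
  ultimately show "\<exists>w\<in>chains V (ideal_coeff V I j) (Suc i). koszul_bd V var_act w = c" by blast
qed

text \<open>
  The polynomial ring is the monomial ideal of all supports; its strands are full simplices, which
  have homology only for the empty vertex set.
\<close>
lemma exact_poly_ring:
  fixes V :: "'v::linorder set"
  assumes fin: "finite V" and "i > 0 \<or> j \<noteq> 0"
  shows "exact_at V var_act (ideal_coeff V (poly_ring V :: ('v, 'k::field) mpoly set) j) i"
proof -
  have "poly_ring V = (monomial_ideal V UNIV :: ('v, 'k) mpoly set)" by (simp add: monomial_ideal_def)
  moreover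
  have "acyclic_at TYPE('k) V (koszul_complex UNIV W) i" if "W \<subseteq> V" "int (card W) = j" for W
  proof -
    have "koszul_complex UNIV W = Pow W" by (auto simp: koszul_complex_def)
    moreover have "W \<noteq> {}" if "i = 0" using that assms(2) \<open>int (card W) = j\<close> by auto
    ultimately show ?thesis using acyclic_Pow[OF fin that(1), of i] by auto
  qed
  then have "exact_at V var_act (ideal_coeff V (monomial_ideal V UNIV :: ('v, 'k) mpoly set) j) i"
    by (intro exact_monomial_ideal[OF fin]) (simp_all add: up_closed_def)
  ultimately show ?thesis by simp
qed

section \<open>Minimal covers and dimension shift\<close>

definition syzygies :: "'v set \<Rightarrow> nat \<Rightarrow> nat \<Rightarrow> (nat \<Rightarrow> nat \<Rightarrow> ('v, 'k::field) mpoly) \<Rightarrow> (nat \<Rightarrow> ('v, 'k) mpoly) set" where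
  "syzygies V r b A = {f \<in> free_module V b. mat_map r b A f = (\<lambda>_. 0)}"

text \<open>
  A degree-preserving surjection from a free module with shifts \<open>e\<close>. Minimality is imposed on
  the syzygies: their entries have zero constant term.
\<close>
definition minimal_cover ::
  "'v set \<Rightarrow> nat \<Rightarrow> (nat \<Rightarrow> int) \<Rightarrow> (nat \<Rightarrow> ('v, 'k::field) mpoly) set \<Rightarrow> nat \<Rightarrow> (nat \<Rightarrow> int) \<Rightarrow>
     (nat \<Rightarrow> nat \<Rightarrow> ('v, 'k) mpoly) \<Rightarrow> bool" where
  "minimal_cover V r d Z b e A \<longleftrightarrow>
     (\<forall>k<r. \<forall>l<b. A k l \<in> poly_ring V \<and> homogeneous (e l - d k) (A k l)) \<and>
     mat_map r b A ` free_module V b = Z \<and>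
     (\<forall>f\<in>syzygies V r b A. \<forall>l<b. lookup (f l) 0 = 0)"

lemma mat_map_add: "mat_map r b A (f + g) = mat_map r b A f + mat_map r b A g"
  by (auto simp: mat_map_def fun_eq_iff sum.distrib algebra_simps)

lemma mat_map_scale: "mat_map r b A (vec_scale p f) = vec_scale p (mat_map r b A f)"
  by (auto simp: mat_map_def vec_scale_def fun_eq_iff sum_distrib_left algebra_simps)

lemma mat_map_hcomp:
  assumes "\<And>k l. k < r \<Longrightarrow> l < b \<Longrightarrow> homogeneous (e l - d k) (A k l)"
  shows "mat_map r b A (vec_hcomp e j f) = vec_hcomp d j (mat_map r b A f)"
proof
  fix k
  show "mat_map r b A (vec_hcomp e j f) k = vec_hcomp d j (mat_map r b A f) k"
  proof (cases "k < r")
    case True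
    have "hcomp (j - d k) (A k l * f l) = A k l * hcomp (j - e l) (f l)" if "l < b" for l
      using hcomp_mult[OF assms[OF True that], of "j - d k" "f l"] by simp
    then show ?thesis using True by (simp add: mat_map_def vec_hcomp_def hcomp_sum)
  qed (simp add: mat_map_def vec_hcomp_def)
qed

lemma vec_homogeneous_hcomp: "vec_homogeneous r d j (vec_hcomp d j f)"
  by (simp add: vec_homogeneous_def vec_hcomp_def homogeneous_hcomp)

lemma vec_hcomp_homogeneous:
  "f \<in> free_module V r \<Longrightarrow> vec_homogeneous r d j f \<Longrightarrow> vec_hcomp d j f = f"
  by (auto simp: vec_homogeneous_def vec_hcomp_def fun_eq_iff free_module_def)
    (metis hcomp_0 hcomp_homogeneous not_le)

lemma graded_submodule_syzygies:
  assumes "\<And>k l. k < r \<Longrightarrow> l < b \<Longrightarrow> homogeneous (e l - d k) (A k l)"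
  shows "graded_submodule V b e (syzygies V r b A)"
proof -
  note F = graded_submoduleD[OF graded_submodule_free[of V b e]]
  have "mat_map r b A 0 = (\<lambda>_. 0)" by (simp add: mat_map_def fun_eq_iff)
  moreover have "vec_scale p g k = 0" if "\<forall>k. g k = 0" for p :: "('a, 'b) mpoly" and g k
    using that by (simp add: vec_scale_def)
  moreover have "vec_hcomp d j g k = 0" if "\<forall>k. g k = 0" for j k and g :: "nat \<Rightarrow> ('a, 'b) mpoly"
    using that by (simp add: vec_hcomp_def)
  ultimately show ?thesis
    unfolding graded_submodule_def syzygies_def
    using F by (auto simp: mat_map_add mat_map_scale mat_map_hcomp[of r b e d A, OF assms] fun_eq_iff)
qed

locale cover =
  fixes V :: "'v::linorder set" and r d Z b e and A :: "nat \<Rightarrow> nat \<Rightarrow> ('v, 'k::field) mpoly"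
  assumes fin: "finite V" and Z: "graded_submodule V r d Z" and cov: "minimal_cover V r d Z b e A"
begin

lemma A_hom: "k < r \<Longrightarrow> l < b \<Longrightarrow> homogeneous (e l - d k) (A k l)"
  and A_ring: "k < r \<Longrightarrow> l < b \<Longrightarrow> A k l \<in> poly_ring V"
  and image: "mat_map r b A ` free_module V b = Z"
  and ker0: "f \<in> syzygies V r b A \<Longrightarrow> l < b \<Longrightarrow> lookup (f l) 0 = 0"
  using cov by (auto simp: minimal_cover_def)

lemma syzygies_graded: "graded_submodule V b e (syzygies V r b A)"
  by (rule graded_submodule_syzygies[OF A_hom])

text \<open>
  Surjectivity holds in each degree, because taking homogeneous components commutes with a
  matrix of homogeneous entries of the right degrees.
\<close>
lemma sequence:
  "coeff_sequence V vec_act (vec_coeff b e (free_module V b) j) vec_act (vec_coeff r d Z j)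
     (mat_map r b A) (vec_coeff b e (syzygies V r b A) j)"
proof -
  interpret F: coeff_system V vec_act "vec_coeff b e (free_module V b :: (nat \<Rightarrow> ('v, 'k) mpoly) set) j"
    by (rule coeff_system_vec[OF fin graded_submodule_free])
  interpret M: coeff_system V vec_act "vec_coeff r d Z j"
    by (rule coeff_system_vec[OF fin Z])
  show ?thesis
  proof
    fix F :: "'v set"
    let ?j = "j - int (card F)"
    show "mat_map r b A ` vec_coeff b e (free_module V b) j F = vec_coeff r d Z j F"
    proof (intro equalityI subsetI)
      fix z assume "z \<in> mat_map r b A ` vec_coeff b e (free_module V b) j F"
      then obtain f where f: "z = mat_map r b A f" "f \<in> free_module V b" "vec_homogeneous b e ?j f"
        by (auto simp: vec_coeff_def)
      have "mat_map r b A (vec_hcomp e ?j f) = vec_hcomp d ?j z"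
        unfolding f(1) by (rule mat_map_hcomp[OF A_hom])
      then have "vec_hcomp d ?j z = z"
        using vec_hcomp_homogeneous[OF f(2,3)] f(1) by simp
      then have "vec_homogeneous r d ?j z" by (metis vec_homogeneous_hcomp)
      then show "z \<in> vec_coeff r d Z j F" using f image by (auto simp: vec_coeff_def)
    next
      fix z assume "z \<in> vec_coeff r d Z j F"
      then have z: "z \<in> Z" "vec_homogeneous r d ?j z" by (auto simp: vec_coeff_def)
      then obtain f where f: "f \<in> free_module V b" "z = mat_map r b A f" using image by blast
      have "mat_map r b A (vec_hcomp e ?j f) = vec_hcomp d ?j z"
        unfolding f(2) by (rule mat_map_hcomp[OF A_hom])
      also have "\<dots> = z"
        by (rule vec_hcomp_homogeneous[OF graded_submoduleD(1)[OF Z z(1)] z(2)])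
      finally have "mat_map r b A (vec_hcomp e ?j f) = z" .
      moreover have "vec_hcomp e ?j f \<in> vec_coeff b e (free_module V b) j F"
        using graded_submoduleD(5)[OF graded_submodule_free f(1)] by (simp add: vec_coeff_def vec_homogeneous_hcomp)
      ultimately show "z \<in> mat_map r b A ` vec_coeff b e (free_module V b) j F" by blast
    qed
    show "vec_coeff b e (syzygies V r b A) j F = {x \<in> vec_coeff b e (free_module V b) j F. mat_map r b A x = 0}"
      by (auto simp: vec_coeff_def syzygies_def zero_fun_def)
  qed (rule mat_map_add mat_map_scale)+
qed

lemma free_tor_vanishes: "tor_vanishes V b e (free_module V b :: (nat \<Rightarrow> ('v, 'k) mpoly) set) (Suc i) j"
  unfolding free_module_eq_ideal_power by (intro tor_vanishes_ideal_power exact_poly_ring[OF fin]) simp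

text \<open>
  Dimension shift. Above homological degree 0 this is the acyclicity of free modules. In degree 0 the map
  from $\mathrm{Tor}_0$ of the syzygies to $\mathrm{Tor}_0$ of the free module is zero, since the entries of a
  syzygy have no constant term.
\<close>
lemma tor_vanishes_Suc:
  "tor_vanishes V r d Z (Suc i) j \<longleftrightarrow> tor_vanishes V b e (syzygies V r b A) i j"
proof -
  interpret S: coeff_sequence V vec_act "vec_coeff b e (free_module V b) j" vec_act "vec_coeff r d Z j"
    "mat_map r b A" "vec_coeff b e (syzygies V r b A) j"
    by (rule sequence)
  show ?thesis
  proof
    assume "tor_vanishes V b e (syzygies V r b A) i j"
    then show "tor_vanishes V r d Z (Suc i) j"
      using S.exact_quotient free_tor_vanishes unfolding tor_vanishes_def by blast
  next
    assume T: "tor_vanishes V r d Z (Suc i) j"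
    show "tor_vanishes V b e (syzygies V r b A) i j"
      unfolding tor_vanishes_def
    proof (rule S.exact_kernel)
      show "exact_at V vec_act (vec_coeff r d Z j) (Suc i)" using T by (simp add: tor_vanishes_def)
      fix c assume c: "c \<in> chains V (vec_coeff b e (syzygies V r b A) j) i" and cyc: "koszul_bd V vec_act c = (\<lambda>_. 0)"
      have cF: "c \<in> chains V (vec_coeff b e (ideal_power (poly_ring V) b) j) i"
        using c by (simp add: S.chains_CZ_iff free_module_eq_ideal_power)
      show "\<exists>w\<in>chains V (vec_coeff b e (free_module V b) j) (Suc i). koszul_bd V vec_act w = c"
        unfolding free_module_eq_ideal_power
      proof (rule boundary_of_components[OF cF])
        fix l assume l: "l < b"
        note cl = chains_component[OF cF l]
        have cyc_l: "koszul_bd V var_act (\<lambda>F. c F l) = (\<lambda>_. 0)"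
          using cyc by (simp add: fun_eq_iff bd_component[symmetric])
        show "\<exists>w\<in>chains V (ideal_coeff V (poly_ring V) (j - e l)) (Suc i). koszul_bd V var_act w = (\<lambda>F. c F l)"
        proof (cases "i > 0 \<or> j - e l \<noteq> 0")
          case True
          from exact_atD[OF exact_poly_ring[OF fin True] cl cyc_l] show ?thesis by blast
        next
          case False
          have "c F l = 0" for F
          proof (rule ccontr)
            assume nz: "c F l \<noteq> 0"
            have "card F = 0" using chains_supp[OF cl nz] False by simp
            moreover have "c F l \<in> ideal_coeff V (poly_ring V) (j - e l) F" by (rule chains_mem[OF cl])
            ultimately have "homogeneous 0 (c F l)" using False by (simp add: ideal_coeff_def)
            moreover have "c F \<in> syzygies V r b A" using chains_mem[OF c, of F] by (simp add: vec_coeff_def)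
            then have "lookup (c F l) 0 = 0" by (rule ker0[OF _ l])
            ultimately show False using homogeneous_degree_0[of "c F l"] nz by simp
          qed
          moreover have "(\<lambda>_. 0) \<in> chains V (ideal_coeff V (poly_ring V) (j - e l)) (Suc i)"
            by (rule chainsI) (auto simp: ideal_coeff_def)
          ultimately show ?thesis by (intro bexI[of _ "\<lambda>_. 0"]) (auto simp: koszul_bd_def)
        qed
      qed
    qed
  qed
qed

text \<open>
  If a basis vector has degree \<open>j\<close> and its image is a combination of multiples of variables, then the difference is
  a syzygy with constant term 1, against minimality.
\<close>
lemma tor_vanishes_0: "tor_vanishes V r d Z 0 j \<longleftrightarrow> (\<forall>l<b. e l \<noteq> j)"
proof -
  interpret S: coeff_sequence V vec_act "vec_coeff b e (free_module V b) j" vec_act "vec_coeff r d Z j"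
    "mat_map r b A" "vec_coeff b e (syzygies V r b A) j"
    by (rule sequence)
  show ?thesis
  proof
    assume *: "\<forall>l<b. e l \<noteq> j"
    have "tor_vanishes V b e (free_module V b :: (nat \<Rightarrow> ('v, 'k) mpoly) set) 0 j"
      unfolding free_module_eq_ideal_power using * by (intro tor_vanishes_ideal_power exact_poly_ring[OF fin]) auto
    then show "tor_vanishes V r d Z 0 j" using S.exact_quotient_0 by (simp add: tor_vanishes_def)
  next
    assume T: "tor_vanishes V r d Z 0 j"
    show "\<forall>l<b. e l \<noteq> j"
    proof (intro allI impI notI)
      fix l assume l: "l < b" "e l = j"
      \<comment> \<open>The basis vector of degree \<open>j\<close>, as a 0-chain.\<close>
      define u where "u k = (if k = l then 1 else 0 :: ('v, 'k) mpoly)" for k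
      define c where "c F = (if F = {} then u else 0)" for F :: "'v set"
      have "homogeneous 0 (1 :: ('v, 'k) mpoly)" by (simp add: homogeneous_iff)
      then have c: "c \<in> chains V (vec_coeff b e (free_module V b) j) 0"
        using l by (intro chainsI) (auto simp: c_def u_def vec_coeff_def vec_homogeneous_def
            free_module_def poly_ring_1 fun_eq_iff split: if_splits)
      have "vec_act v 0 = (0 :: nat \<Rightarrow> ('v, 'k) mpoly)" for v by (simp add: vec_scale_def zero_fun_def)
      then have "koszul_bd V vec_act c F = 0" for F by (simp add: koszul_bd_def c_def)
      then have "koszul_bd V vec_act c = (\<lambda>_. 0)" by (rule ext)
      then have "koszul_bd V vec_act (\<lambda>F. mat_map r b A (c F)) = (\<lambda>_. 0)"
        unfolding S.phi_bd using S.phi_0 by simp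
      from exact_atD[OF T[unfolded tor_vanishes_def] S.phi_chain[OF c] this]
      obtain w where w: "w \<in> chains V (vec_coeff r d Z j) (Suc 0)"
        "koszul_bd V vec_act w = (\<lambda>F. mat_map r b A (c F))" .
      from S.lift_chain[OF w(1)] obtain w' where w': "w' \<in> chains V (vec_coeff b e (free_module V b) j) (Suc 0)"
        "w = (\<lambda>F. mat_map r b A (w' F))" .
      let ?f = "c {} - koszul_bd V vec_act w' {}"
      have "?f \<in> free_module V b"
        using S.F.chains_diff[OF c S.F.bd_chain[OF w'(1)], THEN chains_mem, of "{}"] by (simp add: vec_coeff_def)
      moreover have "mat_map r b A ?f = (\<lambda>_. 0)"
        using fun_cong[OF w(2), of "{}"] unfolding w'(2) S.phi_bd by (simp add: S.phi_diff fun_eq_iff)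
      ultimately have "?f \<in> syzygies V r b A" by (simp add: syzygies_def)
      then have "lookup (?f l) 0 = 0" using l(1) by (rule ker0)
      moreover have "lookup (koszul_bd V vec_act w' {} l) 0 = 0"
        unfolding bd_component by (simp add: koszul_bd_def lookup_sum lookup_osign lookup_var_mult)
      ultimately show False by (simp add: c_def u_def lookup_minus)
    qed
  qed
qed

end

section \<open>Existence of minimal covers\<close>

lemma vec_scale_simps:
  "vec_scale p (f + g) = vec_scale p f + vec_scale p g"
  "vec_scale (p + q) f = vec_scale p f + vec_scale q f"
  "vec_scale p (vec_scale q f) = vec_scale (p * q) f"
  "vec_scale 1 f = f"
  "vec_scale 0 f = 0" "vec_scale p 0 = 0"
  by (auto simp: vec_scale_def fun_eq_iff algebra_simps)

lemma vector_space_vec: "vector_space (\<lambda>c. vec_scale (single 0 c :: ('v, 'k::field) mpoly))"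
  by unfold_locales (simp_all add: vec_scale_simps single_add mult_single)

text \<open>
  The component consists of combinations of finitely many monomial vectors, so it has a finite
  basis by the exchange lemma.
\<close>
lemma finite_spanning_component:
  fixes Z :: "(nat \<Rightarrow> ('v, 'k::field) mpoly) set"
  assumes fin: "finite V" and Z: "Z \<subseteq> free_module V r"
  obtains B where "finite B" "B \<subseteq> {f \<in> Z. vec_homogeneous r d j f}"
    "{f \<in> Z. vec_homogeneous r d j f} \<subseteq> module.span (\<lambda>c. vec_scale (single 0 c)) B"
proof -
  interpret vs: vector_space "\<lambda>c. vec_scale (single 0 c :: ('v, 'k) mpoly)" by (rule vector_space_vec)
  let ?Zj = "{f \<in> Z. vec_homogeneous r d j f}"
  define unit where "unit k m i = (if i = k then single m 1 else 0 :: ('v, 'k) mpoly)" for k i :: nat and m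
  define M where "M = (\<lambda>(k, m). unit k m) ` (SIGMA k:{..<r}. {m. keys m \<subseteq> V \<and> int (tdeg m) = j - d k})"
  have finM: "finite M" unfolding M_def by (intro finite_imageI finite_SigmaI finite_monomials[OF fin]) simp
  have "?Zj \<subseteq> vs.span M"
  proof
    fix f assume f: "f \<in> ?Zj"
    have "f = (\<Sum>k<r. \<Sum>m\<in>keys (f k). vec_scale (single 0 (lookup (f k) m)) (unit k m))"
    proof
      fix i
      have "(\<Sum>k<r. \<Sum>m\<in>keys (f k). vec_scale (single 0 (lookup (f k) m)) (unit k m)) i =
          (\<Sum>k<r. if k = i then (\<Sum>m\<in>keys (f k). single m (lookup (f k) m)) else 0)"
        unfolding sum_fun_apply by (intro sum.cong refl) (auto simp: vec_scale_def unit_def mult_single intro!: sum.neutral)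
      also have "\<dots> = (if i < r then f i else 0)"
        by (simp add: sum_monomials[symmetric])
      also have "\<dots> = f i" using f Z by (auto simp: free_module_def)
      finally show "f i = (\<Sum>k<r. \<Sum>m\<in>keys (f k). vec_scale (single 0 (lookup (f k) m)) (unit k m)) i" by simp
    qed
    moreover have "vec_scale (single 0 (lookup (f k) m)) (unit k m) \<in> vs.span M" if "k < r" "m \<in> keys (f k)" for k m
    proof -
      have "keys m \<subseteq> V" using f Z that by (auto simp: free_module_def poly_ring_def)
      moreover have "int (tdeg m) = j - d k" using f that by (auto simp: vec_homogeneous_def homogeneous_iff)
      ultimately have "unit k m \<in> M" using that(1) by (force simp: M_def)
      then show ?thesis by (intro vs.span_scale vs.span_base)
    qed
    ultimately show "f \<in> vs.span M" by (metis (no_types, lifting) vs.span_sum lessThan_iff)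
  qed
  moreover obtain B where B: "B \<subseteq> ?Zj" "vs.independent B" "?Zj \<subseteq> vs.span B"
    using vs.maximal_independent_subset[of ?Zj] by blast
  ultimately have "finite B" using vs.independent_span_bound[OF finM B(2)] by blast
  then show ?thesis using that B by blast
qed

definition generated :: "'v set \<Rightarrow> (nat \<Rightarrow> ('v, 'k::field) mpoly) set \<Rightarrow> (nat \<Rightarrow> ('v, 'k) mpoly) set" where
  "generated V B = {\<Sum>b\<in>B. vec_scale (q b) b | q. \<forall>b\<in>B. q b \<in> poly_ring V}"

lemma generated_0: "0 \<in> generated V B"
  unfolding generated_def
  by (intro CollectI exI[of _ "\<lambda>_. 0"]) (simp add: vec_scale_simps)

lemma generated_add: "x \<in> generated V B \<Longrightarrow> y \<in> generated V B \<Longrightarrow> x + y \<in> generated V B"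
proof -
  assume "x \<in> generated V B" "y \<in> generated V B"
  then obtain p q where "x = (\<Sum>b\<in>B. vec_scale (p b) b)" "\<forall>b\<in>B. p b \<in> poly_ring V"
    "y = (\<Sum>b\<in>B. vec_scale (q b) b)" "\<forall>b\<in>B. q b \<in> poly_ring V" by (auto simp: generated_def)
  then show ?thesis unfolding generated_def
    by (intro CollectI exI[of _ "\<lambda>b. p b + q b"]) (simp add: vec_scale_simps sum.distrib poly_ring_add)
qed

lemma vec_scale_sum: "vec_scale p (sum f A) = (\<Sum>a\<in>A. vec_scale p (f a))"
  by (simp add: vec_scale_def fun_eq_iff sum_fun_apply sum_distrib_left)

lemma generated_scale: "p \<in> poly_ring V \<Longrightarrow> x \<in> generated V B \<Longrightarrow> vec_scale p x \<in> generated V B"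
proof -
  assume p: "p \<in> poly_ring V" and "x \<in> generated V B"
  then obtain q where "x = (\<Sum>b\<in>B. vec_scale (q b) b)" "\<forall>b\<in>B. q b \<in> poly_ring V" by (auto simp: generated_def)
  then show ?thesis unfolding generated_def using p
    by (intro CollectI exI[of _ "\<lambda>b. p * q b"]) (simp add: vec_scale_simps vec_scale_sum poly_ring_mult)
qed

lemma generated_base: "finite B \<Longrightarrow> x \<in> B \<Longrightarrow> x \<in> generated V B"
proof -
  assume B: "finite B" "x \<in> B"
  have "(\<Sum>b\<in>B. vec_scale (if b = x then 1 else 0) b) = (\<Sum>b\<in>B. if b = x then x else 0)"
    by (intro sum.cong refl) (auto simp: vec_scale_simps)
  also have "\<dots> = x" using B by simp
  finally show ?thesis unfolding generated_def
    by (intro CollectI exI[of _ "\<lambda>b. if b = x then 1 else 0"]) (simp add: poly_ring_1)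
qed

lemma generated_sum: "(\<And>a. a \<in> A \<Longrightarrow> f a \<in> generated V B) \<Longrightarrow> sum f A \<in> generated V B"
  by (induction A rule: infinite_finite_induct) (auto simp: generated_0 generated_add)

lemma generated_osign: "x \<in> generated V B \<Longrightarrow> osign v F x \<in> generated V B"
proof -
  assume x: "x \<in> generated V B"
  have "- x = vec_scale (- 1) x" by (simp add: vec_scale_def fun_eq_iff)
  then show ?thesis using x generated_scale[OF poly_ring_uminus[OF poly_ring_1] x] by (simp add: osign_def)
qed

lemma homogeneous_negative: "homogeneous d p \<Longrightarrow> d < 0 \<Longrightarrow> p = 0"
proof -
  assume "homogeneous d p" "d < 0"
  then have "keys p = {}" by (force simp: homogeneous_iff)
  then show "p = 0" by (intro poly_mapping_eqI) (auto simp: in_keys_iff)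
qed

text \<open>
  Above degree \<open>N\<close> the vanishing of
  $\mathrm{Tor}_0$ writes each element through elements of one degree less, the components up to degree \<open>N\<close> are
  finite-dimensional, and the components of very negative degree are zero.
\<close>
lemma finitely_generated:
  fixes V :: "'v::linorder set" and Z :: "(nat \<Rightarrow> ('v, 'k::field) mpoly) set"
  assumes fin: "finite V" and Z: "graded_submodule V r d Z"
    and T: "\<And>j. j > N \<Longrightarrow> tor_vanishes V r d Z 0 j"
  obtains B where "finite B" "B \<subseteq> Z" "\<And>b. b \<in> B \<Longrightarrow> \<exists>j. vec_homogeneous r d j b" "Z \<subseteq> generated V B"
proof -
  interpret vs: vector_space "\<lambda>c. vec_scale (single 0 c :: ('v, 'k) mpoly)" by (rule vector_space_vec)
  note ZF = graded_submoduleD[OF Z]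
  let ?Zj = "\<lambda>j. {f \<in> Z. vec_homogeneous r d j f}"
  have Zsub: "Z \<subseteq> free_module V r" using ZF(1) by (rule subsetI)
  have "\<exists>B. finite B \<and> B \<subseteq> ?Zj j \<and> ?Zj j \<subseteq> vs.span B" for j
    by (rule finite_spanning_component[OF fin Zsub, of d j]) (intro exI conjI)
  then have "\<forall>j. \<exists>B. finite B \<and> B \<subseteq> ?Zj j \<and> ?Zj j \<subseteq> vs.span B" ..
  from choice[OF this] obtain C where "\<forall>j. finite (C j) \<and> C j \<subseteq> ?Zj j \<and> ?Zj j \<subseteq> vs.span (C j)" ..
  then have C: "finite (C j)" "C j \<subseteq> ?Zj j" "?Zj j \<subseteq> vs.span (C j)" for j by simp_all
  \<comment> \<open>The components of degree below \<open>lo\<close> are zero, so the induction on degrees can start there. Inserting 0 avoids an empty minimum.\<close>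
  define lo where "lo = Min (insert 0 (d ` {..<r}))"
  have lo: "lo \<le> d k" if "k < r" for k unfolding lo_def using that by (intro Min_le) auto
  define B where "B = (\<Union>j\<in>{lo..N}. C j)"
  have finB: "finite B" using C(1) by (simp add: B_def)
  have sub: "vs.subspace (generated V B)"
    unfolding vs.subspace_def by (auto simp: generated_0 generated_add generated_scale poly_ring_single)
  have hom: "z \<in> generated V B" if "z \<in> ?Zj j" for z j
    using that
  proof (induction "nat (j - lo + 1)" arbitrary: z j rule: less_induct)
    case less
    consider "j < lo" | "lo \<le> j" "j \<le> N" | "lo \<le> j" "j > N" by linarith
    then show ?case
    proof cases
      case 1
      have "z k = 0" for k
      proof (cases "k < r")
        case True
        then have "homogeneous (j - d k) (z k)" using less.prems by (auto simp: vec_homogeneous_def)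
        then show ?thesis using 1 lo[OF True] by (intro homogeneous_negative[of "j - d k"]) auto
      next
        case False
        then show ?thesis using less.prems ZF(1)[of z] by (auto intro: free_moduleD)
      qed
      then have "z = 0" by (simp add: fun_eq_iff)
      then show ?thesis by (simp add: generated_0)
    next
      case 2
      then have "C j \<subseteq> B" by (auto simp: B_def)
      then have "C j \<subseteq> generated V B" using generated_base[OF finB] by blast
      then have "vs.span (C j) \<subseteq> generated V B" by (rule vs.span_minimal[OF _ sub])
      then show ?thesis using C(3) less.prems by blast
    next
      case 3
      \<comment> \<open>As a 0-chain \<open>z\<close> is a cycle, hence a boundary: a combination of multiples of variables.\<close>
      define c where "c F = (if F = {} then z else 0)" for F :: "'v set"
      have c: "c \<in> chains V (vec_coeff r d Z j) 0"
        using less.prems ZF(2) by (intro chainsI) (auto simp: c_def vec_coeff_def vec_homogeneous_def split: if_splits)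
      have "koszul_bd V vec_act c F = 0" for F by (simp add: koszul_bd_def c_def vec_scale_simps)
      then have "koszul_bd V vec_act c = (\<lambda>_. 0)" by (rule ext)
      from exact_atD[OF T[OF 3(2), unfolded tor_vanishes_def] c this]
      obtain w where w: "w \<in> chains V (vec_coeff r d Z j) (Suc 0)" "koszul_bd V vec_act w = c" .
      have "w {v} \<in> generated V B" for v
      proof (rule less.hyps)
        show "nat ((j - 1) - lo + 1) < nat (j - lo + 1)" using 3 by linarith
        show "w {v} \<in> ?Zj (j - 1)" using chains_mem[OF w(1), of "{v}"] by (simp add: vec_coeff_def)
      qed
      then have "koszul_bd V vec_act w {} \<in> generated V B"
        by (simp add: koszul_bd_def) (intro generated_sum generated_osign generated_scale poly_ring_var; simp)
      then show ?thesis using w(2) by (simp add: c_def)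
    qed
  qed
  show ?thesis
  proof
    show "finite B" "B \<subseteq> Z" "\<And>b. b \<in> B \<Longrightarrow> \<exists>j. vec_homogeneous r d j b"
      using finB C(2) by (auto simp: B_def)
    show "Z \<subseteq> generated V B"
    proof
      fix z assume z: "z \<in> Z"
      define J where "J = (\<Union>k<r. (\<lambda>m. int (tdeg m) + d k) ` keys (z k))"
      have finJ: "finite J" by (simp add: J_def)
      have "z = (\<Sum>j\<in>J. vec_hcomp d j z)"
      proof
        fix k
        show "z k = (\<Sum>j\<in>J. vec_hcomp d j z) k"
        proof (cases "k < r")
          case True
          show ?thesis
          proof (rule poly_mapping_eqI)
            fix m
            have "lookup ((\<Sum>j\<in>J. vec_hcomp d j z) k) m = (\<Sum>j\<in>J. if j = int (tdeg m) + d k then lookup (z k) m else 0)"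
              by (auto simp: sum_fun_apply vec_hcomp_def lookup_sum lookup_hcomp intro!: sum.cong)
            also have "\<dots> = lookup (z k) m"
            proof (cases "lookup (z k) m = 0")
              case False
              then have "m \<in> keys (z k)" by (simp add: in_keys_iff)
              then have "int (tdeg m) + d k \<in> J" unfolding J_def using \<open>k < r\<close> by blast
              then show ?thesis using finJ by simp
            next
              case True
              then show ?thesis by (intro trans[OF sum.neutral]) auto
            qed
            finally show "lookup (z k) m = lookup ((\<Sum>j\<in>J. vec_hcomp d j z) k) m" by simp
          qed
        next
          case False
          then show ?thesis using ZF(1)[OF z] by (simp add: sum_fun_apply vec_hcomp_def free_moduleD)
        qed
      qed
      moreover have "(\<Sum>j\<in>J. vec_hcomp d j z) \<in> generated V B"
        using ZF(5)[OF z] vec_homogeneous_hcomp by (intro generated_sum hom) auto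
      ultimately show "z \<in> generated V B" by simp
    qed
  qed
qed

definition generating_family ::
  "'v set \<Rightarrow> nat \<Rightarrow> (nat \<Rightarrow> int) \<Rightarrow> (nat \<Rightarrow> ('v, 'k::field) mpoly) set \<Rightarrow> nat \<Rightarrow> (nat \<Rightarrow> int) \<Rightarrow>
     (nat \<Rightarrow> nat \<Rightarrow> ('v, 'k) mpoly) \<Rightarrow> bool" where
  "generating_family V r d Z b e a \<longleftrightarrow>
     (\<forall>l<b. a l \<in> Z \<and> vec_homogeneous r d (e l) (a l)) \<and>
     (\<forall>z\<in>Z. \<exists>q\<in>free_module V b. z = (\<Sum>l<b. vec_scale (q l) (a l)))"

lemma generating_family_exists:
  fixes V :: "'v::linorder set" and Z :: "(nat \<Rightarrow> ('v, 'k::field) mpoly) set"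
  assumes fin: "finite V" and Z: "graded_submodule V r d Z"
    and T: "\<And>j. j > N \<Longrightarrow> tor_vanishes V r d Z 0 j"
  shows "\<exists>b e a. generating_family V r d Z b e a"
proof -
  obtain B where B: "finite B" "B \<subseteq> Z" "\<And>b. b \<in> B \<Longrightarrow> \<exists>j. vec_homogeneous r d j b" "Z \<subseteq> generated V B"
    using finitely_generated[OF fin Z T] by metis
  obtain h where h: "bij_betw h {..<card B} B"
    using ex_bij_betw_nat_finite[OF B(1)] by (auto simp: atLeast0LessThan)
  then have hB: "h l \<in> B" if "l < card B" for l using that by (auto simp: bij_betw_def)
  have "\<forall>l. \<exists>j. l < card B \<longrightarrow> vec_homogeneous r d j (h l)" using B(3) hB by blast
  then obtain e where e: "\<And>l. l < card B \<Longrightarrow> vec_homogeneous r d (e l) (h l)" by metis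
  have "generating_family V r d Z (card B) e h"
    unfolding generating_family_def
  proof (intro conjI allI impI ballI)
    fix z assume "z \<in> Z"
    then obtain q where q: "z = (\<Sum>b\<in>B. vec_scale (q b) b)" "\<forall>b\<in>B. q b \<in> poly_ring V"
      using B(4) by (auto simp: generated_def)
    let ?q = "\<lambda>l. if l < card B then q (h l) else 0"
    have "z = (\<Sum>l<card B. vec_scale (q (h l)) (h l))"
      unfolding q(1) by (rule sum.reindex_bij_betw[OF h, symmetric])
    also have "\<dots> = (\<Sum>l<card B. vec_scale (?q l) (h l))" by (intro sum.cong) auto
    finally have "z = (\<Sum>l<card B. vec_scale (?q l) (h l))" .
    moreover have "?q \<in> free_module V (card B)" using q(2) hB by (intro free_moduleI) auto
    ultimately show "\<exists>q\<in>free_module V (card B). z = (\<Sum>l<card B. vec_scale (q l) (h l))"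
      by (rule_tac bexI[of _ ?q])
  qed (use hB B(2) e in auto)
  then show ?thesis by blast
qed

text \<open>
  A relation with coefficient 1 at \<open>l\<close> expresses the \<open>l\<close>-th generator through the others.
\<close>
lemma generating_family_remove:
  fixes a :: "nat \<Rightarrow> nat \<Rightarrow> ('v, 'k::field) mpoly"
  assumes g: "generating_family V r d Z b e a" and l: "l < b"
    and f: "f \<in> free_module V b" "f l = 1" "(\<Sum>l<b. vec_scale (f l) (a l)) = 0"
  shows "\<exists>e' a'. generating_family V r d Z (b - 1) e' a'"
proof -
  \<comment> \<open>The enumeration of all indices except \<open>l\<close>.\<close>
  define s where "s m = (if m < l then m else Suc m)" for m
  have inj: "inj_on s {..<b - 1}" by (auto simp: s_def inj_on_def split: if_splits)
  have img: "s ` {..<b - 1} = {..<b} - {l}"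
  proof (intro equalityI subsetI)
    fix m assume m: "m \<in> {..<b} - {l}"
    then have "m = s (if m < l then m else m - 1)" "(if m < l then m else m - 1) < b - 1"
      using l by (auto simp: s_def)
    then show "m \<in> s ` {..<b - 1}" by blast
  qed (use l in \<open>auto simp: s_def split: if_splits\<close>)
  have sb: "s m < b" if "m < b - 1" for m using img that by blast
  have "generating_family V r d Z (b - 1) (e \<circ> s) (a \<circ> s)"
    unfolding generating_family_def
  proof (intro conjI allI impI ballI)
    fix z assume "z \<in> Z"
    then obtain q where q: "q \<in> free_module V b" "z = (\<Sum>m<b. vec_scale (q m) (a m))"
      using g by (auto simp: generating_family_def)
    define p where "p m = (if m < b - 1 then q (s m) - q l * f (s m) else 0)" for m
    have "z = (\<Sum>m<b. vec_scale (q m) (a m)) - vec_scale (q l) (\<Sum>m<b. vec_scale (f m) (a m))"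
      by (simp add: q(2) f(3) vec_scale_simps)
    also have "\<dots> = (\<Sum>m<b. vec_scale (q m - q l * f m) (a m))"
      unfolding vec_scale_sum sum_subtractf[symmetric]
      by (intro sum.cong refl) (simp add: vec_scale_def fun_eq_iff algebra_simps)
    also have "\<dots> = (\<Sum>m\<in>{..<b} - {l}. vec_scale (q m - q l * f m) (a m))"
      using l by (subst sum.remove[of _ l]) (auto simp: f(2) vec_scale_simps)
    also have "\<dots> = (\<Sum>m<b - 1. vec_scale (q (s m) - q l * f (s m)) (a (s m)))"
      unfolding img[symmetric] by (subst sum.reindex[OF inj]) simp
    also have "\<dots> = (\<Sum>m<b - 1. vec_scale (p m) ((a \<circ> s) m))"
      by (intro sum.cong) (auto simp: p_def)
    finally have "z = (\<Sum>m<b - 1. vec_scale (p m) ((a \<circ> s) m))" .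
    moreover have "q (s m) - q l * f (s m) \<in> poly_ring V" for m
      using poly_ring_add[OF free_moduleD(1)[OF q(1)] poly_ring_uminus[OF poly_ring_mult[OF free_moduleD(1)[OF q(1)] free_moduleD(1)[OF f(1)]]]]
      by simp
    then have "p \<in> free_module V (b - 1)" by (intro free_moduleI) (auto simp: p_def)
    ultimately show "\<exists>q\<in>free_module V (b - 1). z = (\<Sum>l<b - 1. vec_scale (q l) ((a \<circ> s) l))" by blast
  qed (use g sb in \<open>auto simp: generating_family_def\<close>)
  then show ?thesis by blast
qed

text \<open>
  Take a homogeneous generating family of least length. A syzygy with a nonzero constant term
  has a homogeneous component with an invertible entry, and this would make one generator superfluous.
\<close>
lemma minimal_cover_exists:
  fixes V :: "'v::linorder set" and Z :: "(nat \<Rightarrow> ('v, 'k::field) mpoly) set"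
  assumes fin: "finite V" and Z: "graded_submodule V r d Z"
    and T: "\<And>j. j > N \<Longrightarrow> tor_vanishes V r d Z 0 j"
  shows "\<exists>b e A. minimal_cover V r d Z b e A"
proof -
  note ZF = graded_submoduleD[OF Z]
  define b where "b = (LEAST b. \<exists>e a. generating_family V r d Z b e a)"
  have "\<exists>e a. generating_family V r d Z b e a"
    unfolding b_def using generating_family_exists[OF assms] by (rule LeastI_ex)
  then obtain e a where g: "generating_family V r d Z b e a" by blast
  have aZ: "a l \<in> Z" "vec_homogeneous r d (e l) (a l)" if "l < b" for l
    using g that by (auto simp: generating_family_def)
  define A where "A k l = a l k" for k l
  have mat: "mat_map r b A f = (\<Sum>l<b. vec_scale (f l) (a l))" for f
  proof
    fix k
    show "mat_map r b A f k = (\<Sum>l<b. vec_scale (f l) (a l)) k"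
    proof (cases "k < r")
      case True
      then show ?thesis by (simp add: mat_map_def A_def sum_fun_apply vec_scale_def mult.commute)
    next
      case False
      then have "a l k = 0" if "l < b" for l using ZF(1)[OF aZ(1)[OF that]] by (auto intro: free_moduleD)
      then show ?thesis using False by (simp add: mat_map_def sum_fun_apply vec_scale_def)
    qed
  qed
  have hom: "homogeneous (e l - d k) (A k l)" if "k < r" "l < b" for k l
    using aZ(2)[OF that(2)] that(1) by (auto simp: vec_homogeneous_def A_def)
  have "minimal_cover V r d Z b e A"
    unfolding minimal_cover_def
  proof (intro conjI allI impI ballI)
    fix k l assume kl: "k < r" "l < b"
    show "A k l \<in> poly_ring V" using ZF(1)[OF aZ(1)[OF kl(2)]] by (auto simp: A_def intro: free_moduleD)
    show "homogeneous (e l - d k) (A k l)" by (rule hom[OF kl])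
  next
    show "mat_map r b A ` free_module V b = Z"
    proof (intro equalityI subsetI)
      fix z assume "z \<in> mat_map r b A ` free_module V b"
      then obtain f where f: "f \<in> free_module V b" "z = (\<Sum>l<b. vec_scale (f l) (a l))" unfolding mat by blast
      then show "z \<in> Z"
        using graded_submodule_sum[OF Z, of "{..<b}"] ZF(4)[OF free_moduleD(1)[OF f(1)] aZ(1)] by auto
    next
      fix z assume "z \<in> Z"
      then obtain q where "q \<in> free_module V b" "z = (\<Sum>l<b. vec_scale (q l) (a l))"
        using g by (auto simp: generating_family_def)
      then show "z \<in> mat_map r b A ` free_module V b" unfolding mat by blast
    qed
  next
    fix f l assume f: "f \<in> syzygies V r b A" and l: "l < b"
    note K = graded_submoduleD[OF graded_submodule_syzygies[of r b e d A V, OF hom]]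
    show "lookup (f l) 0 = 0"
    proof (rule ccontr)
      assume c: "lookup (f l) 0 \<noteq> 0"
      \<comment> \<open>The component in the degree of the \<open>l\<close>-th generator, normalized to have entry 1 there.\<close>
      define f' where "f' = vec_scale (single 0 (inverse (lookup (f l) 0))) (vec_hcomp e (e l) f)"
      have "f' \<in> syzygies V r b A"
        unfolding f'_def by (intro K(4) K(5) f poly_ring_single) simp_all
      then have f': "f' \<in> free_module V b" "(\<Sum>l<b. vec_scale (f' l) (a l)) = 0"
        by (auto simp: syzygies_def mat zero_fun_def)
      have "hcomp 0 (f l) = single 0 (lookup (f l) 0)"
        using homogeneous_degree_0[OF homogeneous_hcomp, of "f l"] by (simp add: lookup_hcomp)
      then have "f' l = 1"
        using c by (simp add: f'_def vec_scale_def vec_hcomp_def mult_single)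
      from generating_family_remove[OF g l f'(1) this f'(2)]
      have "\<exists>e a. generating_family V r d Z (b - 1) e a" .
      then have "b \<le> b - 1" unfolding b_def by (rule Least_le)
      then show False using l by simp
    qed
  qed
  then show ?thesis by blast
qed

section \<open>Minimal resolutions\<close>

lemma minimal_cover_column:
  assumes "minimal_cover V r d Z b e A" "l < b"
  shows "(\<lambda>k. if k < r then A k l else 0) \<in> Z"
proof -
  let ?u = "\<lambda>m. if m = l then 1 else 0"
  have "?u \<in> free_module V b" using assms(2) by (intro free_moduleI) (auto simp: poly_ring_1)
  moreover have "mat_map r b A ?u = (\<lambda>k. if k < r then A k l else 0)"
    using assms(2) by (auto simp: mat_map_def fun_eq_iff if_distrib cong: if_cong)
  ultimately have "(\<lambda>k. if k < r then A k l else 0) \<in> mat_map r b A ` free_module V b"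
    by (intro image_eqI[of _ _ ?u]) simp_all
  then show ?thesis using assms(1) by (simp add: minimal_cover_def)
qed

lemma gens_map_ideal_module: "gens_map (ideal_module I) b g f = mat_map 1 b (\<lambda>_. g) f 0"
  by (simp add: gens_map_def ideal_module_def mat_map_def mult.commute)

lemma mat_map_1: "k > 0 \<Longrightarrow> mat_map 1 b A f k = 0"
  by (simp add: mat_map_def)

lemma syzygies_1: "syzygies V 1 b (\<lambda>_. g) = {f \<in> free_module V b. gens_map (ideal_module I) b g f = 0}"
proof -
  have "mat_map 1 b (\<lambda>_. g) f = (\<lambda>_. 0) \<longleftrightarrow> mat_map 1 b (\<lambda>_. g) f 0 = 0" for f
    using mat_map_1[of _ b "\<lambda>_. g" f] by (auto simp: fun_eq_iff) (metis gr0I)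
  then show ?thesis by (simp add: syzygies_def gens_map_ideal_module)
qed

lemma lookup_mult_0: "lookup p 0 = 0 \<Longrightarrow> lookup ((p :: ('v, 'k::field) mpoly) * q) 0 = 0"
proof (rule ccontr)
  assume p: "lookup p 0 = 0" and "lookup (p * q) 0 \<noteq> 0"
  then have "0 \<in> keys (p * q)" by (simp add: in_keys_iff)
  then obtain a b where ab: "0 = a + b" "a \<in> keys p" using keys_mult[of p q] by blast
  from arg_cong[OF ab(1), of tdeg] have "a = 0" by (simp add: tdeg_plus tdeg_eq_0_iff)
  then show False using ab(2) p by (simp add: in_keys_iff)
qed

lemma image_constant_term_0:
  assumes "\<And>k l. k < r \<Longrightarrow> l < b \<Longrightarrow> lookup (A k l) 0 = 0" "f \<in> mat_map r b A ` S" "k < r"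
  shows "lookup (f k) 0 = 0"
  using assms by (auto simp: mat_map_def lookup_sum lookup_mult_0)

text \<open>
  The terms of a resolution are successive minimal covers, the first one of the ideal and each later one of the
  syzygies of its predecessor. Iterating the dimension shift reduces the claim to homological degree 0.
\<close>
lemma resolution_tor:
  fixes V :: "'v::linorder set" and I :: "('v, 'k::field) mpoly set"
  assumes fin: "finite V" and I: "graded_submodule V 1 (\<lambda>_. 0) (ideal_power I 1)"
    and res: "minimal_graded_resolution V (ideal_module I) b d g A"
  shows "(\<exists>k<b i. d i k = j) \<longleftrightarrow> \<not> tor_vanishes V 1 (\<lambda>_. 0) (ideal_power I 1) i j"
proof -
  from res have g: "\<And>k. k < b 0 \<Longrightarrow> g k \<in> I \<and> homogeneous (d 0 k) (g k)"
    and A: "\<And>i k l. k < b i \<Longrightarrow> l < b (Suc i) \<Longrightarrow> A i k l \<in> poly_ring V \<and>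
        homogeneous (d (Suc i) l - d i k) (A i k l) \<and> lookup (A i k l) 0 = 0"
    and onto: "gens_map (ideal_module I) (b 0) g ` free_module V (b 0) = I"
    and ex0: "syzygies V 1 (b 0) (\<lambda>_. g) = mat_map (b 0) (b 1) (A 0) ` free_module V (b 1)"
    and ex: "\<And>i. syzygies V (b i) (b (Suc i)) (A i) =
        mat_map (b (Suc i)) (b (Suc (Suc i))) (A (Suc i)) ` free_module V (b (Suc (Suc i)))"
    unfolding minimal_graded_resolution_def syzygies_1[of V _ g I] syzygies_def[of V "b _"]
    by (simp_all add: ideal_module_def)
  \<comment> \<open>The ideal is placed in front as a submodule of a free module of rank 1 with shift 0, so that all maps are matrices.\<close>
  define rk where "rk i = (case i of 0 \<Rightarrow> 1 | Suc n \<Rightarrow> b n)" for i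
  define sh where "sh i = (case i of 0 \<Rightarrow> (\<lambda>_. 0) | Suc n \<Rightarrow> d n)" for i
  define B where "B i = (case i of 0 \<Rightarrow> (\<lambda>_. g) | Suc n \<Rightarrow> A n)" for i
  define Z where "Z i = (case i of 0 \<Rightarrow> ideal_power I 1 | Suc n \<Rightarrow> syzygies V (rk n) (b n) (B n))" for i
  have ker: "syzygies V (rk i) (b i) (B i) = mat_map (b i) (b (Suc i)) (A i) ` free_module V (b (Suc i))" for i
    by (cases i) (use ex0 ex in \<open>auto simp: rk_def B_def\<close>)
  have entries: "B i k l \<in> poly_ring V \<and> homogeneous (d i l - sh i k) (B i k l)" if "k < rk i" "l < b i" for i k l
  proof (cases i)
    case 0
    have "(\<lambda>m. if m = 0 then g l else 0) \<in> ideal_power I 1"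
      using g that(2) 0 by (simp add: ideal_power_def)
    from graded_submoduleD(1)[OF I this] have "g l \<in> poly_ring V"
      by (auto dest!: free_moduleD(1)[where k = 0])
    then show ?thesis using g that 0 by (simp add: B_def sh_def)
  next
    case (Suc n)
    then show ?thesis using A that by (simp add: B_def sh_def rk_def)
  qed
  have "minimal_cover V (rk i) (sh i) (Z i) (b i) (d i) (B i)" for i
    unfolding minimal_cover_def
  proof (intro conjI allI impI ballI)
    show "mat_map (rk i) (b i) (B i) ` free_module V (b i) = Z i"
    proof (cases i)
      case 0
      have "mat_map 1 (b 0) (\<lambda>_. g) ` free_module V (b 0) = ideal_power I 1"
      proof (intro equalityI subsetI)
        fix z assume "z \<in> mat_map 1 (b 0) (\<lambda>_. g) ` free_module V (b 0)"
        then obtain f where f: "f \<in> free_module V (b 0)" "z = mat_map 1 (b 0) (\<lambda>_. g) f" by blast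
        then have "z 0 \<in> I" using onto by (auto simp: gens_map_ideal_module)
        then show "z \<in> ideal_power I 1" using f(2) by (auto simp: ideal_power_def mat_map_def)
      next
        fix z assume z: "z \<in> ideal_power I 1"
        then have "z 0 \<in> gens_map (ideal_module I) (b 0) g ` free_module V (b 0)"
          unfolding onto by (simp add: ideal_power_def)
        then obtain f where f: "f \<in> free_module V (b 0)" "z 0 = mat_map 1 (b 0) (\<lambda>_. g) f 0"
          by (auto simp: gens_map_ideal_module)
        have "z = mat_map 1 (b 0) (\<lambda>_. g) f"
        proof
          fix k show "z k = mat_map 1 (b 0) (\<lambda>_. g) f k"
          proof (cases "k = 0")
            case False
            then have "z k = 0" using z by (simp add: ideal_power_def)
            moreover have "mat_map 1 (b 0) (\<lambda>_. g) f k = 0" using False by (intro mat_map_1) simp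
            ultimately show ?thesis by (rule trans[OF _ sym])
          qed (use f(2) in simp)
        qed
        then show "z \<in> mat_map 1 (b 0) (\<lambda>_. g) ` free_module V (b 0)" using f(1) by blast
      qed
      then show ?thesis using 0 by (simp add: rk_def B_def Z_def)
    next
      case (Suc n)
      have "Z i = syzygies V (rk n) (b n) (B n)" using Suc by (simp add: Z_def)
      then show ?thesis using ker[of n] Suc by (simp add: rk_def B_def)
    qed
    fix f l assume f: "f \<in> syzygies V (rk i) (b i) (B i)" and l: "l < b i"
    show "lookup (f l) 0 = 0"
      by (rule image_constant_term_0[OF _ f[unfolded ker] l]) (simp add: A)
  next
    fix k l assume kl: "k < rk i" "l < b i"
    show "B i k l \<in> poly_ring V" "homogeneous (d i l - sh i k) (B i k l)" using entries[OF kl] by simp_all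
  qed
  moreover have "graded_submodule V (rk i) (sh i) (Z i)" for i
  proof (cases i)
    case 0
    then show ?thesis using I by (simp add: rk_def sh_def Z_def)
  next
    case (Suc n)
    have "graded_submodule V (b n) (d n) (syzygies V (rk n) (b n) (B n))"
      by (rule graded_submodule_syzygies[where d = "sh n"]) (use entries in blast)
    then show ?thesis using Suc by (simp add: rk_def sh_def Z_def)
  qed
  ultimately have cover: "cover V (rk i) (sh i) (Z i) (b i) (d i) (B i)" for i
    using fin by (simp add: cover_def)
  have shift: "tor_vanishes V (rk i) (sh i) (Z i) m j \<longleftrightarrow> tor_vanishes V 1 (\<lambda>_. 0) (ideal_power I 1) (i + m) j" for m
  proof (induction i arbitrary: m)
    case 0
    then show ?case by (simp add: rk_def sh_def Z_def)
  next
    case (Suc i)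
    have "tor_vanishes V (rk i) (sh i) (Z i) (Suc m) j \<longleftrightarrow> tor_vanishes V (rk (Suc i)) (sh (Suc i)) (Z (Suc i)) m j"
      using cover.tor_vanishes_Suc[OF cover[of i]] by (simp add: rk_def sh_def Z_def)
    then show ?case using Suc.IH[of "Suc m"] by simp
  qed
  show ?thesis
    using cover.tor_vanishes_0[OF cover[of i], of j] shift[of 0] by auto
qed

text \<open>
  The vanishing for degrees above \<open>N\<close> passes from a module to its syzygies, so minimal covers can be
  chosen one after the other.
\<close>
lemma resolution_exists:
  fixes V :: "'v::linorder set" and I :: "('v, 'k::field) mpoly set"
  assumes fin: "finite V" and I: "graded_submodule V 1 (\<lambda>_. 0) (ideal_power I 1)"
    and T: "\<And>i j. j > N \<Longrightarrow> tor_vanishes V 1 (\<lambda>_. 0) (ideal_power I 1) i j"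
  shows "\<exists>b d g A. minimal_graded_resolution V (ideal_module I) b d g A"
proof -
  define im where "im r b A = mat_map r b A ` free_module V b"
    for r b and A :: "nat \<Rightarrow> nat \<Rightarrow> ('v, 'k) mpoly"
  define st where "st r d b e A \<longleftrightarrow> cover V r d (im r b A) b e A \<and>
      (\<forall>i. \<forall>j>N. tor_vanishes V r d (im r b A) i j)"
    for r d b e and A :: "nat \<Rightarrow> nat \<Rightarrow> ('v, 'k) mpoly"
  have stI: "\<exists>b e A. st r d b e A \<and> im r b A = Z"
    if Z: "graded_submodule V r d Z" and TZ: "\<And>i j. j > N \<Longrightarrow> tor_vanishes V r d Z i j" for r d Z
  proof -
    obtain b e A where c: "minimal_cover V r d Z b e A"
      using minimal_cover_exists[OF fin Z TZ] by blast
    then have "im r b A = Z" by (simp add: minimal_cover_def im_def)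
    then show ?thesis using c Z TZ fin by (intro exI[of _ b] exI[of _ e] exI[of _ A]) (simp add: st_def cover_def)
  qed
  have step: "\<exists>b' e' A'. st b e b' e' A' \<and> im b b' A' = syzygies V r b A" if s: "st r d b e A" for r d b e A
  proof (rule stI)
    interpret cover V r d "im r b A" b e A using s by (simp add: st_def)
    show "graded_submodule V b e (syzygies V r b A)" by (rule syzygies_graded)
    show "tor_vanishes V b e (syzygies V r b A) i j" if "j > N" for i j
      using s that tor_vanishes_Suc[of i j] by (simp add: st_def)
  qed
  \<comment> \<open>The state consists of the ambient rank and shifts, and the rank, shifts and matrix of the cover.\<close>
  define P where "P n x \<longleftrightarrow> (case x of (r, d, b, e, A) \<Rightarrow>
      st r d b e A \<and> (n = 0 \<longrightarrow> r = 1 \<and> d = (\<lambda>_. 0) \<and> im r b A = ideal_power I 1))" for n :: nat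
    and x :: "nat \<times> (nat \<Rightarrow> int) \<times> nat \<times> (nat \<Rightarrow> int) \<times> (nat \<Rightarrow> nat \<Rightarrow> ('v, 'k) mpoly)"
  define Q where "Q (n :: nat) x y \<longleftrightarrow> (case x of (r, d, b, e, A) \<Rightarrow> case y of (r', d', b', e', A') \<Rightarrow>
      r' = b \<and> d' = e \<and> im r' b' A' = syzygies V r b A)" for n
    and x y :: "nat \<times> (nat \<Rightarrow> int) \<times> nat \<times> (nat \<Rightarrow> int) \<times> (nat \<Rightarrow> nat \<Rightarrow> ('v, 'k) mpoly)"
  have base: "\<exists>x. P 0 x"
    using stI[OF I T] unfolding P_def by (auto intro!: exI[of _ "(1, (\<lambda>_. 0), _)"])
  have "\<exists>y. P (Suc n) y \<and> Q n x y" if "P n x" for x n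
  proof -
    obtain r d b e A where x: "x = (r, d, b, e, A)" by (cases x)
    from that have "st r d b e A" by (simp add: P_def x)
    from step[OF this] obtain b' e' A' where y: "st b e b' e' A'" "im b b' A' = syzygies V r b A" by blast
    then show ?thesis by (intro exI[of _ "(b, e, b', e', A')"]) (simp add: P_def Q_def x)
  qed
  from dependent_nat_choice[of P Q, OF base this]
  obtain f where f: "\<And>n. P n (f n)" "\<And>n. Q n (f n) (f (Suc n))" by blast
  define rk where "rk n = fst (f n)" for n
  define sh where "sh n = fst (snd (f n))" for n
  define b where "b n = fst (snd (snd (f n)))" for n
  define e where "e n = fst (snd (snd (snd (f n))))" for n
  define A where "A n = snd (snd (snd (snd (f n))))" for n
  have f_eq: "f n = (rk n, sh n, b n, e n, A n)" for n
    by (simp add: rk_def sh_def b_def e_def A_def)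
  have st: "st (rk n) (sh n) (b n) (e n) (A n)" for n
    using f(1)[of n] unfolding f_eq P_def by simp
  have "st (rk 0) (sh 0) (b 0) (e 0) (A 0) \<and> rk 0 = 1 \<and> sh 0 = (\<lambda>_. 0) \<and>
      im (rk 0) (b 0) (A 0) = ideal_power I 1"
    using f(1)[of 0, unfolded f_eq P_def prod.case] by blast
  then have start: "rk 0 = 1" "sh 0 = (\<lambda>_. 0)" "im (rk 0) (b 0) (A 0) = ideal_power I 1"
    by blast+
  have succ: "rk (Suc n) = b n" "sh (Suc n) = e n"
    "im (rk (Suc n)) (b (Suc n)) (A (Suc n)) = syzygies V (rk n) (b n) (A n)" for n
    using f(2)[of n, unfolded f_eq[of n] f_eq[of "Suc n"] Q_def prod.case] by blast+
  have cov: "minimal_cover V (rk n) (sh n) (im (rk n) (b n) (A n)) (b n) (e n) (A n)" for n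
    using st[of n] by (simp add: st_def cover_def)
  define g where "g l = A 0 0 l" for l
  have A0: "mat_map 1 (b 0) (A 0) = mat_map 1 (b 0) (\<lambda>_. g)"
    by (auto simp: mat_map_def g_def fun_eq_iff)
  have "minimal_graded_resolution V (ideal_module I) b e g (\<lambda>n. A (Suc n))"
    unfolding minimal_graded_resolution_def
  proof (intro conjI allI impI)
    fix l assume l: "l < b 0"
    have "(\<lambda>k. if k < rk 0 then A 0 k l else 0) \<in> ideal_power I 1"
      using minimal_cover_column[OF cov[of 0] l] by (simp only: start(3))
    then have "g l \<in> I" by (auto simp: ideal_power_def g_def start)
    moreover have "homogeneous (e 0 l) (g l)"
      using cov[of 0] l unfolding minimal_cover_def by (auto simp: start g_def)
    ultimately show "g l \<in> mcomp (ideal_module I) (e 0 l)" by (simp add: ideal_module_def)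
  next
    fix i k l assume k: "k < b i" and l: "l < b (Suc i)"
    from cov[of "Suc i"] k l show "A (Suc i) k l \<in> poly_ring V" "homogeneous (e (Suc i) l - e i k) (A (Suc i) k l)"
      unfolding minimal_cover_def succ by blast+
    have "(\<lambda>k. if k < b i then A (Suc i) k l else 0) \<in> syzygies V (rk i) (b i) (A i)"
      using minimal_cover_column[OF cov[of "Suc i"] l, unfolded succ(3)] by (simp only: succ(1))
    with cov[of i] k show "lookup (A (Suc i) k l) 0 = 0"
      unfolding minimal_cover_def by fastforce
  next
    show "gens_map (ideal_module I) (b 0) g ` free_module V (b 0) = mcarrier (ideal_module I)"
    proof -
      have "gens_map (ideal_module I) (b 0) g ` free_module V (b 0) = (\<lambda>f. f 0) ` im (rk 0) (b 0) (A 0)"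
        by (simp only: gens_map_ideal_module[abs_def] im_def start(1) A0 image_image)
      also have "\<dots> = I" unfolding start(3)
      proof (intro equalityI subsetI)
        fix p assume "p \<in> I"
        then show "p \<in> (\<lambda>f. f 0) ` ideal_power I 1"
          by (intro image_eqI[of _ _ "\<lambda>k. if k = 0 then p else 0"]) (auto simp: ideal_power_def)
      qed (auto simp: ideal_power_def)
      finally show ?thesis by (simp add: ideal_module_def)
    qed
    show "{f \<in> free_module V (b 0). gens_map (ideal_module I) (b 0) g f = 0} =
        mat_map (b 0) (b 1) (A (Suc 0)) ` free_module V (b 1)"
    proof -
      have "syzygies V 1 (b 0) (\<lambda>_. g) = syzygies V (rk 0) (b 0) (A 0)"
        by (simp only: syzygies_def start(1) A0)
      also have "\<dots> = im (rk (Suc 0)) (b (Suc 0)) (A (Suc 0))" by (rule succ(3)[symmetric])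
      also have "\<dots> = mat_map (b 0) (b 1) (A (Suc 0)) ` free_module V (b 1)"
        by (simp only: im_def succ(1) One_nat_def)
      finally show ?thesis unfolding syzygies_1[of V _ g I] .
    qed
    fix i
    show "{f \<in> free_module V (b (Suc i)). mat_map (b i) (b (Suc i)) (A (Suc i)) f = (\<lambda>_. 0)} =
        mat_map (b (Suc i)) (b (Suc (Suc i))) (A (Suc (Suc i))) ` free_module V (b (Suc (Suc i)))"
      using succ(3)[of "Suc i", symmetric] by (simp only: im_def syzygies_def succ(1))
  qed
  then show ?thesis by blast
qed

section \<open>Betti numbers of squarefree monomial ideals\<close>

lemma tor_vanishes_monomial_ideal_iff:
  fixes V :: "'v::linorder set"
  assumes fin: "finite V" and up: "up_closed U"
  shows "tor_vanishes V 1 (\<lambda>_. 0) (ideal_power (monomial_ideal V U :: ('v, 'k::field) mpoly set) 1) i j \<longleftrightarrow>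
      (\<forall>W\<subseteq>V. int (card W) = j \<longrightarrow> acyclic_at TYPE('k) V (koszul_complex U W) i)"
proof
  assume "tor_vanishes V 1 (\<lambda>_. 0) (ideal_power (monomial_ideal V U :: ('v, 'k) mpoly set) 1) i j"
  from exact_ideal_of_tor_vanishes[OF this monomial_ideal_0] acyclic_of_exact_monomial_ideal[OF fin up]
  show "\<forall>W\<subseteq>V. int (card W) = j \<longrightarrow> acyclic_at TYPE('k) V (koszul_complex U W) i" by blast
next
  assume "\<forall>W\<subseteq>V. int (card W) = j \<longrightarrow> acyclic_at TYPE('k) V (koszul_complex U W) i"
  then have "exact_at V var_act (ideal_coeff V (monomial_ideal V U :: ('v, 'k) mpoly set) j) i"
    by (intro exact_monomial_ideal[OF fin up]) blast
  then show "tor_vanishes V 1 (\<lambda>_. 0) (ideal_power (monomial_ideal V U :: ('v, 'k) mpoly set) 1) i j"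
    by (intro tor_vanishes_ideal_power) simp
qed

lemma monomial_ideal_resolution_exists:
  fixes V :: "'v::linorder set"
  assumes fin: "finite V" and up: "up_closed U"
  shows "\<exists>b d g A. minimal_graded_resolution V (ideal_module (monomial_ideal V U :: ('v, 'k::field) mpoly set)) b d g A"
proof (rule resolution_exists[OF fin graded_submodule_ideal_power[OF up]])
  fix i j assume j: "j > int (card V)"
  have "int (card W) \<noteq> j" if "W \<subseteq> V" for W
    using card_mono[OF fin that] j by linarith
  then show "tor_vanishes V 1 (\<lambda>_. 0) (ideal_power (monomial_ideal V U :: ('v, 'k) mpoly set) 1) i j"
    unfolding tor_vanishes_monomial_ideal_iff[OF fin up] by blast
qed

text \<open>
  The choice made in the definition of the Betti numbers is harmless, because the criterion holds for
  every minimal resolution and one exists.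
\<close>
theorem graded_betti_monomial_ideal:
  fixes V :: "'v::linorder set"
  assumes fin: "finite V" and up: "up_closed U"
  shows "graded_betti V (ideal_module (monomial_ideal V U :: ('v, 'k::field) mpoly set)) i j \<noteq> 0 \<longleftrightarrow>
      (\<exists>W\<subseteq>V. int (card W) = j \<and> \<not> acyclic_at TYPE('k) V (koszul_complex U W) i)"
proof -
  let ?I = "monomial_ideal V U :: ('v, 'k) mpoly set"
  have "\<exists>c b d g A. minimal_graded_resolution V (ideal_module ?I) b d g A \<and> c = card {k. k < b i \<and> d i k = j}"
    using monomial_ideal_resolution_exists[OF fin up] by blast
  from someI_ex[OF this] obtain b d g A where res: "minimal_graded_resolution V (ideal_module ?I) b d g A"
    and c: "graded_betti V (ideal_module ?I) i j = card {k. k < b i \<and> d i k = j}"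
    unfolding graded_betti_def by blast
  have "graded_betti V (ideal_module ?I) i j \<noteq> 0 \<longleftrightarrow> (\<exists>k<b i. d i k = j)"
    unfolding c by (auto simp: card_eq_0_iff)
  also have "\<dots> \<longleftrightarrow> \<not> tor_vanishes V 1 (\<lambda>_. 0) (ideal_power ?I 1) i j"
    by (rule resolution_tor[OF fin graded_submodule_ideal_power[OF up] res])
  finally show ?thesis unfolding tor_vanishes_monomial_ideal_iff[OF fin up] by blast
qed

section \<open>Regularity of Stanley-Reisner ideals\<close>

lemma nonacyclic_koszul_complex:
  assumes "\<not> acyclic_at TYPE('k::ab_group_add) V (koszul_complex U W) i"
  obtains F where "F \<subseteq> W" "card F = i" "W - F \<in> U"
proof (rule ccontr)
  assume *: "\<not> thesis"
  have "acyclic_at TYPE('k) V (koszul_complex U W) i"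
  proof (rule acyclic_atI)
    fix c :: "_ \<Rightarrow> 'k"
    assume c: "\<And>F. c F \<noteq> 0 \<Longrightarrow> F \<in> koszul_complex U W \<and> F \<subseteq> V \<and> card F = i"
    have "c F = 0" for F
    proof (rule ccontr)
      assume "c F \<noteq> 0"
      from c[OF this] show False using * that by (auto simp: koszul_complex_def)
    qed
    then show "\<exists>w. (\<forall>F. w F \<noteq> 0 \<longrightarrow> F \<in> koszul_complex U W \<and> F \<subseteq> V \<and> card F = Suc i) \<and> (\<forall>F. simplicial_bd V w F = c F)"
      by (intro exI[of _ "\<lambda>_. 0"]) (simp add: koszul_bd_def)
  qed
  with assms show False ..
qed

text \<open>
  At a minimal nonface the complex consists of the empty face only. These are the minimal
  generators of the ideal.
\<close>
lemma nonacyclic_minimal_nonface: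
  assumes fin: "finite V" and W: "W \<subseteq> V" "W \<in> U" and min: "\<And>v. v \<in> W \<Longrightarrow> W - {v} \<notin> U"
  shows "\<not> acyclic_at TYPE('k::field) V (koszul_complex U W) 0"
proof
  assume A: "acyclic_at TYPE('k) V (koszul_complex U W) 0"
  define c where "c F = (if F = {} then 1 else 0 :: 'k)" for F :: "'a set"
  have 1: "F \<in> koszul_complex U W \<and> F \<subseteq> V \<and> card F = 0" if "c F \<noteq> 0" for F
    using that W by (auto simp: c_def koszul_complex_def split: if_splits)
  have 2: "simplicial_bd V c F = 0" for F by (simp add: koszul_bd_def c_def)
  obtain w :: "_ \<Rightarrow> 'k" where w: "\<And>F. w F \<noteq> 0 \<Longrightarrow> F \<in> koszul_complex U W \<and> F \<subseteq> V \<and> card F = Suc 0"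
    "\<And>F. simplicial_bd V w F = c F" using acyclic_atD[OF A 1 2] by metis
  have "w {v} = 0" for v
  proof (rule ccontr)
    assume "w {v} \<noteq> 0"
    from w(1)[OF this] show False using min[of v] by (auto simp: koszul_complex_def)
  qed
  then have "simplicial_bd V w {} = 0" by (simp add: koszul_bd_def)
  then show False by (simp add: w(2) c_def)
qed

lemma monomial_ideal_eq_0_iff:
  assumes fin: "finite V"
  shows "(monomial_ideal V U :: ('v, 'k::field) mpoly set) = {0} \<longleftrightarrow> (\<forall>G\<subseteq>V. G \<notin> U)"
proof
  assume I0: "(monomial_ideal V U :: ('v, 'k) mpoly set) = {0}"
  show "\<forall>G\<subseteq>V. G \<notin> U"
  proof (intro allI impI notI)
    fix G assume G: "G \<subseteq> V" "G \<in> U"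
    then have "keys (squarefree_monomial G) = G" using finite_subset[OF _ fin] by (intro keys_squarefree_monomial)
    then have "single (squarefree_monomial G) (1 :: 'k) \<in> monomial_ideal V U"
      using G by (simp add: monomial_ideal_def poly_ring_def)
    then have "single (squarefree_monomial G) (1 :: 'k) = 0" unfolding I0 by simp
    from arg_cong[OF this, of keys] show False by simp
  qed
next
  assume *: "\<forall>G\<subseteq>V. G \<notin> U"
  have "p = 0" if "p \<in> monomial_ideal V U" for p :: "('v, 'k) mpoly"
  proof -
    have "keys p = {}" using that * by (auto simp: monomial_ideal_def poly_ring_def)
    then show ?thesis by simp
  qed
  then show "(monomial_ideal V U :: ('v, 'k) mpoly set) = {0}" using monomial_ideal_0 by blast
qed

text \<open>
  The set whose maximum is the regularity.
\<close>
definition degree_shifts :: "'v set \<Rightarrow> ('v, 'k::field) mpoly set \<Rightarrow> int set" where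
  "degree_shifts V I = {j - int i | i j. graded_betti V (ideal_module I) i j \<noteq> 0}"

lemma degree_shifts_monomial_ideal:
  fixes V :: "'v::linorder set"
  assumes fin: "finite V" and up: "up_closed U"
  shows "degree_shifts V (monomial_ideal V U :: ('v, 'k::field) mpoly set) =
    {int (card W) - int i | W i. W \<subseteq> V \<and> \<not> acyclic_at TYPE('k) V (koszul_complex U W) i}"
  unfolding degree_shifts_def graded_betti_monomial_ideal[OF fin up] by blast

text \<open>
  The lower bound says that the regularity is at least 1: if \<open>F\<close> were all of \<open>W\<close>, the empty set
  would be a nonface.
\<close>
lemma degree_shifts_bounds:
  fixes V :: "'v::linorder set"
  assumes fin: "finite V" and up: "up_closed U" and U: "{} \<notin> U"
    and s: "s \<in> degree_shifts V (monomial_ideal V U :: ('v, 'k::field) mpoly set)"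
  shows "1 \<le> s" "s \<le> int (card V)"
proof -
  obtain W i where W: "s = int (card W) - int i" "W \<subseteq> V" "\<not> acyclic_at TYPE('k) V (koszul_complex U W) i"
    using s unfolding degree_shifts_monomial_ideal[OF fin up] by blast
  obtain F where F: "F \<subseteq> W" "card F = i" "W - F \<in> U" using nonacyclic_koszul_complex[OF W(3)] .
  have "F \<noteq> W" using F(3) U by auto
  then have "card F < card W" using F(1) W(2) fin by (meson finite_subset psubsetI psubset_card_mono)
  moreover have "card W \<le> card V" by (rule card_mono[OF fin W(2)])
  ultimately show "1 \<le> s" "s \<le> int (card V)" using W(1) F(2) by auto
qed

lemma finite_degree_shifts:
  fixes V :: "'v::linorder set"
  assumes "finite V" "up_closed U" "{} \<notin> U"
  shows "finite (degree_shifts V (monomial_ideal V U :: ('v, 'k::field) mpoly set))"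
proof (rule finite_subset)
  show "degree_shifts V (monomial_ideal V U :: ('v, 'k) mpoly set) \<subseteq> {1..int (card V)}"
    using degree_shifts_bounds[OF assms] by (auto simp: subset_eq)
qed simp

lemma degree_shifts_nonempty:
  fixes V :: "'v::linorder set"
  assumes fin: "finite V" and up: "up_closed U" and I: "(monomial_ideal V U :: ('v, 'k::field) mpoly set) \<noteq> {0}"
  shows "degree_shifts V (monomial_ideal V U :: ('v, 'k) mpoly set) \<noteq> {}"
proof -
  let ?S = "{G. G \<subseteq> V \<and> G \<in> U}"
  have "finite ?S" using fin by simp
  moreover have "?S \<noteq> {}" using I monomial_ideal_eq_0_iff[OF fin, of U, where 'k = 'k] by blast
  ultimately obtain W where W: "W \<in> ?S" "\<And>G. G \<in> ?S \<Longrightarrow> G \<subseteq> W \<Longrightarrow> W = G"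
    using finite_has_minimal[of ?S] by auto
  have "W - {v} \<notin> U" if "v \<in> W" for v using W(2)[of "W - {v}"] W(1) that by auto
  then have "\<not> acyclic_at TYPE('k) V (koszul_complex U W) 0"
    using nonacyclic_minimal_nonface[OF fin] W(1) by blast
  then show ?thesis unfolding degree_shifts_monomial_ideal[OF fin up] using W(1) by blast
qed

lemma reg_ideal_eq: "reg_ideal V I = (if I = {0} then 1 else Max (degree_shifts V I))"
  by (simp add: reg_ideal_def regularity_def degree_shifts_def)

lemma reg_monomial_ideal_ge_1:
  fixes V :: "'v::linorder set"
  assumes "finite V" "up_closed U" "{} \<notin> U"
  shows "1 \<le> reg_ideal V (monomial_ideal V U :: ('v, 'k::field) mpoly set)"
proof (cases "(monomial_ideal V U :: ('v, 'k) mpoly set) = {0}")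
  case False
  from degree_shifts_bounds(1)[OF assms Max_in[OF finite_degree_shifts[OF assms] degree_shifts_nonempty[OF assms(1,2) this]]]
  show ?thesis using False by (simp add: reg_ideal_eq)
qed (simp add: reg_ideal_eq)

lemma acyclic_above_regularity:
  fixes V :: "'v::linorder set"
  assumes "finite V" "up_closed U" "{} \<notin> U" "W \<subseteq> V"
    and "int (card W) - int i > reg_ideal V (monomial_ideal V U :: ('v, 'k::field) mpoly set)"
  shows "acyclic_at TYPE('k) V (koszul_complex U W) i"
proof (rule ccontr)
  assume A: "\<not> acyclic_at TYPE('k) V (koszul_complex U W) i"
  let ?I = "monomial_ideal V U :: ('v, 'k) mpoly set"
  obtain F where F: "F \<subseteq> W" "W - F \<in> U" using nonacyclic_koszul_complex[OF A] .
  have "W - F \<subseteq> V" using assms(4) by auto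
  then have "?I \<noteq> {0}" unfolding monomial_ideal_eq_0_iff[OF assms(1)] using F(2) by auto
  moreover have "int (card W) - int i \<in> degree_shifts V ?I"
    unfolding degree_shifts_monomial_ideal[OF assms(1,2)] using A assms(4) by blast
  then have "int (card W) - int i \<le> Max (degree_shifts V ?I)"
    by (rule Max_ge[OF finite_degree_shifts[OF assms(1-3)]])
  ultimately show False using assms(5) by (simp add: reg_ideal_eq)
qed

text \<open>
  For the zero ideal the claim is the convention $\mathrm{reg}(0)=1$, which is why \<open>R\<close> has to be at least 1.
\<close>
lemma reg_monomial_ideal_le:
  fixes V :: "'v::linorder set"
  assumes "finite V" "up_closed U" "{} \<notin> U" "1 \<le> R"
    and "\<And>W i. W \<subseteq> V \<Longrightarrow> int (card W) - int i > R \<Longrightarrow> acyclic_at TYPE('k::field) V (koszul_complex U W) i"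
  shows "reg_ideal V (monomial_ideal V U :: ('v, 'k) mpoly set) \<le> R"
proof (cases "(monomial_ideal V U :: ('v, 'k) mpoly set) = {0}")
  case False
  have "s \<le> R" if s: "s \<in> degree_shifts V (monomial_ideal V U :: ('v, 'k) mpoly set)" for s
  proof -
    obtain W i where "s = int (card W) - int i" "W \<subseteq> V" "\<not> acyclic_at TYPE('k) V (koszul_complex U W) i"
      using s unfolding degree_shifts_monomial_ideal[OF assms(1,2)] by blast
    then show ?thesis using assms(5)[of W i] by linarith
  qed
  then show ?thesis
    using False Max.boundedI[OF finite_degree_shifts[OF assms(1-3)] degree_shifts_nonempty[OF assms(1,2) False]]
    by (simp add: reg_ideal_eq)
qed (use assms(4) in \<open>simp add: reg_ideal_eq\<close>)

section \<open>Stanley-Reisner ideals of expansions\<close>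

lemma gen_ideal_0: "0 \<in> gen_ideal V B"
  unfolding gen_ideal_def by (intro CollectI exI[of _ "{}"] exI) simp

lemma gen_ideal_add:
  assumes "p \<in> gen_ideal V B" "q \<in> gen_ideal V B" shows "p + q \<in> gen_ideal V B"
proof -
  obtain A f where A: "p = (\<Sum>b\<in>A. f b * b)" "finite A" "A \<subseteq> B" "\<forall>b\<in>A. f b \<in> poly_ring V"
    using assms(1) by (auto simp: gen_ideal_def)
  obtain A' f' where A': "q = (\<Sum>b\<in>A'. f' b * b)" "finite A'" "A' \<subseteq> B" "\<forall>b\<in>A'. f' b \<in> poly_ring V"
    using assms(2) by (auto simp: gen_ideal_def)
  let ?g = "\<lambda>b. (if b \<in> A then f b else 0) + (if b \<in> A' then f' b else 0)"
  have "p = (\<Sum>b\<in>A \<union> A'. (if b \<in> A then f b else 0) * b)"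
    unfolding A(1) using A(2) A'(2) by (intro sum.mono_neutral_cong_left) auto
  moreover have "q = (\<Sum>b\<in>A \<union> A'. (if b \<in> A' then f' b else 0) * b)"
    unfolding A'(1) using A(2) A'(2) by (intro sum.mono_neutral_cong_left) auto
  ultimately have "p + q = (\<Sum>b\<in>A \<union> A'. ?g b * b)"
    by (simp only: sum.distrib distrib_right)
  moreover have "\<forall>b\<in>A \<union> A'. ?g b \<in> poly_ring V"
    using A(4) A'(4) by (auto intro: poly_ring_add)
  ultimately show ?thesis
    unfolding gen_ideal_def using A(2,3) A'(2,3) by (intro CollectI exI[of _ "A \<union> A'"] exI[of _ ?g]) auto
qed

lemma gen_ideal_sum: "(\<And>a. a \<in> A \<Longrightarrow> f a \<in> gen_ideal V B) \<Longrightarrow> sum f A \<in> gen_ideal V B"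
  by (induction A rule: infinite_finite_induct) (auto simp: gen_ideal_0 gen_ideal_add)

lemma gen_ideal_multiple: "b \<in> B \<Longrightarrow> q \<in> poly_ring V \<Longrightarrow> q * b \<in> gen_ideal V B"
  unfolding gen_ideal_def by (intro CollectI exI[of _ "{b}"] exI[of _ "\<lambda>_. q"]) simp

lemma prod_var: "finite G \<Longrightarrow> (\<Prod>x\<in>G. var x) = single (squarefree_monomial G) 1"
  by (induction G rule: finite_induct) (auto simp: squarefree_monomial_def var_def mult_single)

text \<open>
  A monomial with support \<open>G\<close> is a multiple of the generator belonging to \<open>G\<close>, and conversely supports only grow under
  multiplication.
\<close>
lemma stanley_reisner_ideal_eq_monomial_ideal:
  assumes fin: "finite X" and up: "up_closed U" and U: "\<And>G. G \<subseteq> X \<Longrightarrow> G \<in> U \<longleftrightarrow> G \<notin> \<Gamma>"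
  shows "stanley_reisner_ideal X \<Gamma> = (monomial_ideal X U :: ('v, 'k::field) mpoly set)"
proof (intro equalityI subsetI)
  let ?B = "(\<lambda>G. \<Prod>x\<in>G. var x :: ('v, 'k) mpoly) ` {G. G \<subseteq> X \<and> G \<notin> \<Gamma>}"
  fix p :: "('v, 'k) mpoly"
  {
    assume "p \<in> stanley_reisner_ideal X \<Gamma>"
    then obtain A q where A: "p = (\<Sum>b\<in>A. q b * b)" "A \<subseteq> ?B" "\<forall>b\<in>A. q b \<in> poly_ring X"
      by (auto simp: stanley_reisner_ideal_def gen_ideal_def)
    have gen: "b \<in> monomial_ideal X U" if "b \<in> ?B" for b
    proof -
      obtain G where G: "b = (\<Prod>x\<in>G. var x)" "G \<subseteq> X" "G \<notin> \<Gamma>"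
        using \<open>b \<in> ?B\<close> by auto
      have "finite G" using G(2) fin finite_subset by blast
      then show ?thesis
        using G U by (simp add: prod_var monomial_ideal_def poly_ring_def keys_squarefree_monomial)
    qed
    have "q b * b \<in> monomial_ideal X U" if "b \<in> A" for b
    proof (rule monomial_ideal_mult[OF up])
      show "q b \<in> poly_ring X" using A(3) that by (rule bspec)
      show "b \<in> monomial_ideal X U" using subsetD[OF A(2) that] by (rule gen)
    qed
    then show "p \<in> monomial_ideal X U"
      unfolding A(1) by (induction A rule: infinite_finite_induct) (auto simp: monomial_ideal_0 monomial_ideal_add)
  }
  {
    assume p: "p \<in> monomial_ideal X U"
    have "single m (lookup p m) \<in> gen_ideal X ?B" if m: "m \<in> keys p" for m
    proof -
      have G: "keys m \<subseteq> X" "keys m \<in> U" using p m by (auto simp: monomial_ideal_def poly_ring_def)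
      let ?q = "single (m - squarefree_monomial (keys m)) (lookup p m)"
      have eq: "m - squarefree_monomial (keys m) + squarefree_monomial (keys m) = m"
        by (rule squarefree_monomial_diff) auto
      from arg_cong[OF eq, of keys] have "keys (m - squarefree_monomial (keys m)) \<subseteq> X"
        using G(1) by (auto simp: keys_plus_nat)
      then have "?q \<in> poly_ring X" by (rule poly_ring_single)
      moreover have "(\<Prod>x\<in>keys m. var x) \<in> ?B" using G U by blast
      ultimately have "?q * (\<Prod>x\<in>keys m. var x) \<in> gen_ideal X ?B" by (intro gen_ideal_multiple)
      then show ?thesis by (simp add: prod_var mult_single eq)
    qed
    then have "(\<Sum>m\<in>keys p. single m (lookup p m)) \<in> gen_ideal X ?B" by (rule gen_ideal_sum)
    then show "p \<in> stanley_reisner_ideal X \<Gamma>"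
      by (simp add: stanley_reisner_ideal_def sum_monomials[symmetric])
  }
qed

text \<open>
  A set with injective projection is itself a facet of the expansion of its projection: the
  choice of indices is read off from the set.
\<close>
lemma expansion_iff:
  assumes \<Delta>: "simplicial_complex_on X \<Delta>" and G: "G \<subseteq> expansion_vertices \<alpha> X"
  shows "G \<in> expansion \<alpha> \<Delta> \<longleftrightarrow> inj_on fst G \<and> fst ` G \<in> \<Delta>"
proof
  assume "G \<in> expansion \<alpha> \<Delta>"
  then obtain F j where F: "F \<in> \<Delta>" "G \<subseteq> (\<lambda>i. (i, j i)) ` F"
    by (auto simp: expansion_def simplex_expansion_def expansion_facets_def)
  have "inj_on fst ((\<lambda>i. (i, j i)) ` F)" by (auto simp: inj_on_def)
  then have "inj_on fst G" by (rule inj_on_subset[OF _ F(2)])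
  moreover have "fst ` G \<subseteq> F" using F(2) by auto
  ultimately show "inj_on fst G \<and> fst ` G \<in> \<Delta>" using \<Delta> F(1) by (auto simp: simplicial_complex_on_def)
next
  assume *: "inj_on fst G \<and> fst ` G \<in> \<Delta>"
  define j where "j i = snd (inv_into G fst i)" for i
  have j: "(fst p, j (fst p)) = p" if "p \<in> G" for p
    using * that by (simp add: j_def inv_into_f_f)
  then have "G = (\<lambda>i. (i, j i)) ` fst ` G" by (force simp: image_iff)
  moreover have "j i \<in> {1..\<alpha> i}" if "i \<in> fst ` G" for i
  proof -
    from that obtain p where p: "i = fst p" "p \<in> G" by (rule imageE)
    then have "(i, j i) \<in> expansion_vertices \<alpha> X" using j[OF p(2)] p(1) G by auto
    then show ?thesis by (simp add: expansion_vertices_def)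
  qed
  ultimately have "G \<in> expansion_facets \<alpha> (fst ` G)"
    unfolding expansion_facets_def by blast
  then show "G \<in> expansion \<alpha> \<Delta>"
    using * by (auto simp: expansion_def simplex_expansion_def)
qed

lemma card_repeated_vertices_le:
  assumes "finite X" "W \<subseteq> expansion_vertices \<alpha> X"
  shows "card (repeated_vertices W) \<le> card {i \<in> X. \<alpha> i > 1}"
proof (rule card_mono)
  show "repeated_vertices W \<subseteq> {i \<in> X. \<alpha> i > 1}"
  proof
    fix x assume "x \<in> repeated_vertices W"
    then obtain a b where "a \<noteq> b" "(x, a) \<in> W" "(x, b) \<in> W" by (auto simp: repeated_vertices_def)
    then have "a \<noteq> b" "x \<in> X" "a \<in> {1..\<alpha> x}" "b \<in> {1..\<alpha> x}"
      using assms(2) by (auto simp: expansion_vertices_def)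
    then show "x \<in> {i \<in> X. \<alpha> i > 1}" by auto
  qed
qed (use assms(1) in simp)

theorem theorem3p1:
  fixes n :: nat and \<alpha> :: "nat \<Rightarrow> nat" and \<Delta> :: "nat set set"
  assumes "simplicial_complex_on {1..n} \<Delta>"
    and "\<And>i. i \<in> {1..n} \<Longrightarrow> \<alpha> i \<ge> 1"
  shows "reg_ideal (expansion_vertices \<alpha> {1..n})
           (stanley_reisner_ideal (expansion_vertices \<alpha> {1..n}) (expansion \<alpha> \<Delta>)
             :: (nat \<times> nat, 'k::field) mpoly set)
         \<le> reg_ideal {1..n} (stanley_reisner_ideal {1..n} \<Delta> :: (nat, 'k) mpoly set)
           + int (card {i \<in> {1..n}. \<alpha> i > 1})"
proof -
  let ?X = "{1..n}" and ?V = "expansion_vertices \<alpha> {1..n}"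
  let ?U = "- \<Delta>" and ?U' = "expanded_nonfaces (- \<Delta>)"
  let ?R = "reg_ideal ?X (monomial_ideal ?X ?U :: (nat, 'k) mpoly set)"
  let ?r = "int (card {i \<in> {1..n}. \<alpha> i > 1})"
  have finV: "finite ?V" by (simp add: expansion_vertices_def)
  have face0: "{} \<in> \<Delta>" using assms(1) by (simp add: simplicial_complex_on_def)
  have up: "up_closed ?U" using assms(1) unfolding up_closed_def simplicial_complex_on_def by blast
  note up' = up_closed_expanded_nonfaces[OF up]
  have face0': "{} \<notin> ?U'" using face0 by (simp add: expanded_nonfaces_def)
  have SR: "stanley_reisner_ideal ?X \<Delta> = (monomial_ideal ?X ?U :: (nat, 'k) mpoly set)"
    by (rule stanley_reisner_ideal_eq_monomial_ideal[OF _ up]) simp_all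
  have SR': "stanley_reisner_ideal ?V (expansion \<alpha> \<Delta>) = (monomial_ideal ?V ?U' :: (nat \<times> nat, 'k) mpoly set)"
    by (rule stanley_reisner_ideal_eq_monomial_ideal[OF finV up'])
      (auto simp: expansion_iff[OF assms(1)] expanded_nonfaces_def)
  have R1: "1 \<le> ?R" using face0 by (intro reg_monomial_ideal_ge_1[OF _ up]) auto
  have "reg_ideal ?V (monomial_ideal ?V ?U' :: (nat \<times> nat, 'k) mpoly set) \<le> ?R + ?r"
  proof (rule reg_monomial_ideal_le[OF finV up' face0'])
    show "1 \<le> ?R + ?r" using R1 by linarith
    fix W i assume W: "W \<subseteq> ?V" and gt: "int (card W) - int i > ?R + ?r"
    show "acyclic_at TYPE('k) ?V (koszul_complex ?U' W) i"
    proof (rule acyclic_expanded[OF finV up R1 _ _ _ W])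
      show "finite ?X" "fst ` ?V \<subseteq> ?X" by (auto simp: expansion_vertices_def)
      show "int (card W) - int i > ?R + int (card (repeated_vertices W))"
        using card_repeated_vertices_le[OF _ W] gt by simp
      show "acyclic_at TYPE('k) ?X (koszul_complex ?U W) i"
        if "W \<subseteq> ?X" "int (card W) - int i > ?R" for W i
        using that face0 by (intro acyclic_above_regularity[OF _ up]) auto
    qed
  qed
  then show ?thesis by (simp only: SR SR')
qed

end
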